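(* Suppose that $\Theta$ is convex and that $\ell(\theta,z)$ is convex in $\theta$ for every fixed $z\in\mathcal Z$. Let $\varepsilon\ge 0$. Consider the following conditions. (A) For any $z\in\mathcal Z$, $\ell(\theta,z)$ is lower semicontinuous in $\theta$. (B) For any $\mathbb Q\in\mathbb B_\varepsilon(\hat{\mathbb P})$ and any $\bar\theta\in\Theta$ there exists a neighborhood $\mathcal U$ of $\bar\theta$ such that the family of functions $\ell^-(\theta,z)=-\min\{0,\ell(\theta,z)\}$ parametrized by $\theta\in\mathcal U$ is uniformly $\mathbb Q$-integrable in $z$. (C) There exists $\mathbb Q\in\mathbb B_\varepsilon(\hat{\mathbb P})$ such that $\mathbb E_{Z\sim\mathbb Q}[\ell(\theta,Z)]$ is inf-compact in $\theta\in\Theta$, i.e. $\{\theta\in\Theta:\mathbb E_{Z\sim\mathbb Q}[\ell(\theta,Z)]\le t\}$ is compact for every $t\in\mathbb R$. (D) There exists $\theta\in\Theta$ with $\sup_{\mathbb Q\in\mathbb B_\varepsilon(\hat{\mathbb P})}\mathbb E_{Z\sim\mathbb Q}[\ell(\theta,Z)]<+\infty$. (E) There exists $\mathbb Q\in\mathbb B_\varepsilon(\hat{\mathbb P})$ with $\inf_{\theta\in\Theta}\mathbb E_{Z\sim\mathbb Q}[\ell(\theta,Z)]>-\infty$. (F) There exist $\hat z_0\in\mathcal Z$ and $C<\infty$ with $\mathbb E_{Z\sim\hat{\mathbb P}}[c(Z,\hat z_0)]\le C$, and there exist a metric $d$ on $\mathcal Z$ with compact sublevel sets and an exponent $p\in\mathbb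 N$ such that $c(z,\hat z)\ge d^p(z,\hat z)$. (G) With $d$ and $p$ as in (F): for any $\theta\in\Theta$ there are $g>0$, $\hat z_0\in\mathcal Z$ and $r\in(0,p)$ with $\ell(\theta,z)\le g[1+d^r(z,\hat z_0)]$ for all $z\in\mathcal Z$. Then the following hold. (i) If (A), (B), (C) and (D) hold, then $$\min_{\theta\in\Theta}\sup_{\mathbb Q\in\mathbb B_\varepsilon(\hat{\mathbb P})}\mathbb E_{Z\sim\mathbb Q}[\ell(\theta,Z)]=\sup_{\mathbb Q\in\mathbb B_\varepsilon(\hat{\mathbb P})}\inf_{\theta\in\Theta}\mathbb E_{Z\sim\mathbb Q}[\ell(\theta,Z)].$$ (ii) If (E), (F) and (G) hold, then $$\inf_{\theta\in\Theta}\sup_{\mathbb Q\in\mathbb B_\varepsilon(\hat{\mathbb P})}\mathbb E_{Z\sim\mathbb Q}[\ell(\theta,Z)]=\max_{\mathbb Q\in\mathbb B_\varepsilon(\hat{\mathbb P})}\inf_{\theta\in\Theta}\mathbb E_{Z\sim\mathbb Q}[\ell(\theta,Z)].$$ (iii) If (A)–(G) all hold, then $$\min_{\theta\in\Theta}\sup_{\mathbb Q\in\mathbb B_\varepsilon(\hat{\mathbb P})}\mathbb E_{Z\sim\mathbb Q}[\ell(\theta,Z)]=\max_{\mathbb Q\in\mathbb B_\varepsilon(\hat{\mathbb P})}\inf_{\theta\in\Theta}\mathbb E_{Z\sim\mathbb Q}[\ell(\theta,Z)].$$ Here writing $\min$ (respectively $\max$) for the outer optimization asserts that the outer optimum is 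attained.
   Context: $\Theta\subseteq\mathbb R^m$ and $\mathcal Z\subseteq\mathbb R^d$ are non-empty closed sets and $\ell:\mathbb R^m\times\mathbb R^d\to(-\infty,\infty]$ is a loss function. $\mathcal P(\mathcal Z)$ is the set of probability distributions on $\mathcal Z$, and $\hat{\mathbb P}\in\mathcal P(\mathcal Z)$ is a fixed reference distribution. The transportation cost $c:\mathcal Z\times\mathcal Z\to[0,+\infty]$ satisfies $c(z,\hat z)=0$ if and only if $z=\hat z$. $\Pi(\mathbb Q,\hat{\mathbb P})$ is the set of joint distributions of $(Z,\hat Z)$ with marginals $\mathbb Q$ and $\hat{\mathbb P}$; $d_c(\mathbb Q,\hat{\mathbb P})=\inf_{\pi\in\Pi(\mathbb Q,\hat{\mathbb P})}\mathbb E_{(Z,\hat Z)\sim\pi}[c(Z,\hat Z)]$; and $\mathbb B_\varepsilon(\hat{\mathbb P})=\{\mathbb Q\in\mathcal P(\mathcal Z):d_c(\mathbb Q,\hat{\mathbb P})\le\varepsilon\}$. Standing assumptions: $c(z,\hat z)$ is lower semicontinuous in $(z,\hat z)$; for any $\theta\in\Theta$, $\ell(\theta,\cdot)$ is upper semicontinuous and $\hat{\mathbb P}$-integrable. *)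

theory Defs
  imports "HOL-Probability.Probability"
begin

section \<open>Extended-real-valued functions\<close>

text \<open>Semicontinuity is relative to the set \<open>S\<close>. The filter omits the point \<open>x\<close> itself, which does
  not affect the inequalities, and there is no condition at isolated points of \<open>S\<close>.\<close>

definition lsc_on :: "'a::topological_space set \<Rightarrow> ('a \<Rightarrow> 'b::complete_linorder) \<Rightarrow> bool" where
  "lsc_on S f \<longleftrightarrow> (\<forall>x\<in>S. f x \<le> Liminf (at x within S) f)"

definition usc_on :: "'a::topological_space set \<Rightarrow> ('a \<Rightarrow> 'b::complete_linorder) \<Rightarrow> bool" where
  "usc_on S f \<longleftrightarrow> (\<forall>x\<in>S. Limsup (at x within S) f \<le> f x)"

text \<open>The analogue of \<open>convex_on\<close>; intended for functions that never take the value
  \<open>-\<infinity>\<close>, so that the right-hand side is unambiguous (and \<open>0 * \<infinity> = 0\<close>).\<close>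

definition ereal_convex_on :: "'a::real_vector set \<Rightarrow> ('a \<Rightarrow> ereal) \<Rightarrow> bool" where
  "ereal_convex_on S f \<longleftrightarrow> convex S \<and>
    (\<forall>x\<in>S. \<forall>y\<in>S. \<forall>u\<ge>0. \<forall>v\<ge>0. u + v = 1 \<longrightarrow>
      f (u *\<^sub>R x + v *\<^sub>R y) \<le> ereal u * f x + ereal v * f y)"

definition inf_compact_on :: "'a::topological_space set \<Rightarrow> ('a \<Rightarrow> ereal) \<Rightarrow> bool" where
  "inf_compact_on S f \<longleftrightarrow> (\<forall>t::real. compact {x \<in> S. f x \<le> ereal t})"

text \<open>Since \<open>e2ennreal\<close> sends negative numbers to \<open>0\<close>, the two terms are the integrals of the
  positive and of the negative part. If both are infinite, the value is \<open>\<infinity> - \<infinity> = \<infinity>\<close>.\<close>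

definition expect :: "'a measure \<Rightarrow> ('a \<Rightarrow> ereal) \<Rightarrow> ereal" where
  "expect M f =
    enn2ereal (\<integral>\<^sup>+x. e2ennreal (f x) \<partial>M) - enn2ereal (\<integral>\<^sup>+x. e2ennreal (- f x) \<partial>M)"

definition ereal_integrable :: "'a measure \<Rightarrow> ('a \<Rightarrow> ereal) \<Rightarrow> bool" where
  "ereal_integrable M f \<longleftrightarrow> f \<in> borel_measurable M \<and> (\<integral>\<^sup>+x. e2ennreal \<bar>f x\<bar> \<partial>M) < \<infinity>"

definition uniformly_integrable :: "'a measure \<Rightarrow> 'i set \<Rightarrow> ('i \<Rightarrow> 'a \<Rightarrow> ereal) \<Rightarrow> bool" where
  "uniformly_integrable M I f \<longleftrightarrow> (\<forall>i\<in>I. f i \<in> borel_measurable M) \<and>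
    ((\<lambda>K::real. SUP i\<in>I. \<integral>\<^sup>+x. e2ennreal \<bar>f i x\<bar> * indicator {x. ereal K \<le> \<bar>f i x\<bar>} x \<partial>M)
      \<longlongrightarrow> 0) at_top"


section \<open>Optimal transport ambiguity sets\<close>

definition prob_dists :: "'a::topological_space set \<Rightarrow> 'a measure set" where
  "prob_dists Z = {Q. prob_space Q \<and> sets Q = sets (restrict_space borel Z)}"

definition couplings :: "'a measure \<Rightarrow> 'a measure \<Rightarrow> ('a \<times> 'a) measure set" where
  "couplings Q P = {\<pi>. prob_space \<pi> \<and> sets \<pi> = sets (Q \<Otimes>\<^sub>M P) \<and>
    distr \<pi> Q fst = Q \<and> distr \<pi> P snd = P}"

definition ot_discrepancy :: "('a \<Rightarrow> 'a \<Rightarrow> ennreal) \<Rightarrow> 'a measure \<Rightarrow> 'a measure \<Rightarrow> ennreal" where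
  "ot_discrepancy c Q P = (INF \<pi>\<in>couplings Q P. \<integral>\<^sup>+w. c (fst w) (snd w) \<partial>\<pi>)"

definition ot_ball ::
  "('a::topological_space \<Rightarrow> 'a \<Rightarrow> ennreal) \<Rightarrow> 'a set \<Rightarrow> 'a measure \<Rightarrow> real \<Rightarrow> 'a measure set" where
  "ot_ball c Z P \<epsilon> = {Q \<in> prob_dists Z. ot_discrepancy c Q P \<le> ennreal \<epsilon>}"


section \<open>Conditions of the minimax theorem\<close>

text \<open>In the following definitions \<open>B\<close> is the ambiguity set.\<close>

definition lsc_in_decision ::
  "'a::topological_space set \<Rightarrow> 'b set \<Rightarrow> ('a \<Rightarrow> 'b \<Rightarrow> ereal) \<Rightarrow> bool" where
  "lsc_in_decision \<Theta> Z loss \<longleftrightarrow> (\<forall>z\<in>Z. lsc_on \<Theta> (\<lambda>\<theta>. loss \<theta> z))"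

text \<open>Only decisions in \<open>\<Theta>\<close> matter, so neighbourhoods are taken relative to \<open>\<Theta>\<close>.\<close>

definition loc_unif_integrable_neg_part ::
  "'b measure set \<Rightarrow> 'a::topological_space set \<Rightarrow> ('a \<Rightarrow> 'b \<Rightarrow> ereal) \<Rightarrow> bool" where
  "loc_unif_integrable_neg_part B \<Theta> loss \<longleftrightarrow>
    (\<forall>Q\<in>B. \<forall>\<theta>\<^sub>0\<in>\<Theta>. \<exists>U. open U \<and> \<theta>\<^sub>0 \<in> U \<and>
      uniformly_integrable Q (U \<inter> \<Theta>) (\<lambda>\<theta> z. - min 0 (loss \<theta> z)))"

definition inf_compact_for_some ::
  "'b measure set \<Rightarrow> 'a::topological_space set \<Rightarrow> ('a \<Rightarrow> 'b \<Rightarrow> ereal) \<Rightarrow> bool" where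
  "inf_compact_for_some B \<Theta> loss \<longleftrightarrow> (\<exists>Q\<in>B. inf_compact_on \<Theta> (\<lambda>\<theta>. expect Q (loss \<theta>)))"

definition finite_worst_case ::
  "'b measure set \<Rightarrow> 'a set \<Rightarrow> ('a \<Rightarrow> 'b \<Rightarrow> ereal) \<Rightarrow> bool" where
  "finite_worst_case B \<Theta> loss \<longleftrightarrow> (\<exists>\<theta>\<in>\<Theta>. (SUP Q\<in>B. expect Q (loss \<theta>)) < \<infinity>)"

definition finite_optimal_risk ::
  "'b measure set \<Rightarrow> 'a set \<Rightarrow> ('a \<Rightarrow> 'b \<Rightarrow> ereal) \<Rightarrow> bool" where
  "finite_optimal_risk B \<Theta> loss \<longleftrightarrow> (\<exists>Q\<in>B. (INF \<theta>\<in>\<Theta>. expect Q (loss \<theta>)) > -\<infinity>)"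

text \<open>\<open>compact\<close> refers to the topology of the ambient type, not to the one induced by \<open>d\<close>.\<close>

definition cost_growth ::
  "('b::topological_space \<Rightarrow> 'b \<Rightarrow> ennreal) \<Rightarrow> 'b set \<Rightarrow> 'b measure \<Rightarrow> ('b \<Rightarrow> 'b \<Rightarrow> real) \<Rightarrow> nat \<Rightarrow> bool"
where
  "cost_growth c Z P d p \<longleftrightarrow>
    (\<exists>z\<^sub>0\<in>Z. \<exists>C<\<infinity>. (\<integral>\<^sup>+z. c z z\<^sub>0 \<partial>P) \<le> C) \<and>
    Metric_space Z d \<and>
    (\<forall>z\<^sub>0\<in>Z. \<forall>r. compact {z \<in> Z. d z z\<^sub>0 \<le> r}) \<and>
    (\<forall>z\<in>Z. \<forall>z'\<in>Z. ennreal (d z z' ^ p) \<le> c z z')"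

definition loss_growth ::
  "'a set \<Rightarrow> 'b set \<Rightarrow> ('a \<Rightarrow> 'b \<Rightarrow> ereal) \<Rightarrow> ('b \<Rightarrow> 'b \<Rightarrow> real) \<Rightarrow> nat \<Rightarrow> bool" where
  "loss_growth \<Theta> Z loss d p \<longleftrightarrow>
    (\<forall>\<theta>\<in>\<Theta>. \<exists>g>0. \<exists>z\<^sub>0\<in>Z. \<exists>r. 0 < r \<and> r < real p \<and>
      (\<forall>z\<in>Z. loss \<theta> z \<le> ereal (g * (1 + d z z\<^sub>0 powr r))))"

end

(*
  Both minimax identities rest on one statement about a family of functions F y : X -> (-inf, inf]
  that is convexlike in x and concavelike in y: if finitely many of the F y have maximum above a
  level everywhere on X, then a single F y stays above any smaller level. It reduces to two functions,
  hence to separating two convex sets in the plane. Compactness passes from arbitrary to finite families.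

  (i) Here x is the decision and y the distribution. Uniform integrability and Fatou's lemma make
  the risk lower semicontinuous in the decision, and sublevel sets of one of the risks are compact.

  (ii) Here x is the distribution and y the decision. The ball is sequentially compact: the growth
  of the cost makes couplings with P tight; they are coded as distributions on [0, 1] by
  Schoenberg's space-filling curve, where Helly's theorem and the Skorohod representation apply.
  Decoding gives random vectors that converge almost surely, so that Fatou's lemma bounds the cost of the
  limit coupling, and, using the growth of the loss to control its positive part, shows that the risk is
  upper semicontinuous in the distribution.
*)

theory Submission
  imports Defs "HOL-Real_Asymp.Real_Asymp"
begin

section \<open>Finite minimax alternatives\<close>

text \<open>Infinite values and missing lower bounds shape the argument. A separating line in the
  plane may give one function the weight 0, and since \<open>0 * \<infinity> = 0\<close> such a
  weight forgets where that function is infinite. The weights therefore have to be pushed into the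
  open unit interval, at the price of an arbitrarily small drop of the level; this is why separation
  always involves two levels. The push is cheap only if one function cannot fall quickly while the
  other grows, which convexity yields as soon as the first is bounded below and the second is
  bounded below on each sublevel set of the first. In (i) this is what inf-compactness provides:
  outside compact sets only the one inf-compact risk is controlled. In (ii) signs are reversed, and
  the growth of the loss bounds the expectation of \<open>- loss\<close> from below over the whole
  ball. Fatou's lemma wants nonnegative integrands, which the risks do not have: integrands are
  raised by \<open>K\<close> and cut at 0, and the error is a tail that vanishes as \<open>K\<close>
  grows, by uniform integrability in (i) and by the exponent \<open>r < p\<close> in (ii).\<close>

definition convexlike_pair :: "'x set \<Rightarrow> ('x \<Rightarrow> ereal) \<Rightarrow> ('x \<Rightarrow> ereal) \<Rightarrow> bool" where
  "convexlike_pair X f g \<longleftrightarrow> (\<forall>x\<in>X. \<forall>y\<in>X. \<forall>u. 0 < u \<and> u < 1 \<longrightarrow>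
     (\<exists>w\<in>X. f w \<le> ereal u * f x + ereal (1 - u) * f y \<and> g w \<le> ereal u * g x + ereal (1 - u) * g y))"

text \<open>The set \<open>S\<close> of points above some \<open>(a x, b x)\<close> is convex
  because \<open>D\<close> is convexlike, and \<open>mx\<close> keeps it away from the open quadrant
  \<open>T\<close> below \<open>(\<beta>, \<beta>)\<close>. The normal \<open>(u, v)\<close> of a
  separating line, divided by \<open>u + v\<close>, supplies the weights.\<close>

lemma convex_alternative_real:
  fixes a b :: "'x \<Rightarrow> real"
  assumes conv: "\<And>x y u. x \<in> D \<Longrightarrow> y \<in> D \<Longrightarrow> 0 < u \<Longrightarrow> u < 1 \<Longrightarrow>
      \<exists>w\<in>D. a w \<le> u * a x + (1 - u) * a y \<and> b w \<le> u * b x + (1 - u) * b y"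
    and mx: "\<And>x. x \<in> D \<Longrightarrow> \<beta> \<le> a x \<or> \<beta> \<le> b x"
  shows "\<exists>t. 0 \<le> t \<and> t \<le> 1 \<and> (\<forall>x\<in>D. \<beta> \<le> t * a x + (1 - t) * b x)"
proof (cases "D = {}")
  case True
  then show ?thesis by (auto intro!: exI[of _ 0])
next
  case False
  define S where "S = {(p, q). \<exists>x\<in>D. a x \<le> p \<and> b x \<le> q}"
  define T where "T = {..<\<beta>} \<times> {..<\<beta>}"
  have "convex T"
    unfolding T_def by (intro convex_Times) auto
  have "convex S"
  proof (rule convexI)
    fix v w and r s :: real
    assume v: "v \<in> S" and w: "w \<in> S" and rs: "0 \<le> r" "0 \<le> s" "r + s = 1"
    show "r *\<^sub>R v + s *\<^sub>R w \<in> S"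
    proof (cases "r = 0 \<or> s = 0")
      case True
      then show ?thesis using v w rs by auto
    next
      case False
      then have r: "0 < r" "r < 1" and s: "s = 1 - r" using rs by auto
      obtain p q where vp: "v = (p, q)" by (cases v)
      obtain p' q' where wp: "w = (p', q')" by (cases w)
      obtain x where x: "x \<in> D" "a x \<le> p" "b x \<le> q" using v by (auto simp: S_def vp)
      obtain y where y: "y \<in> D" "a y \<le> p'" "b y \<le> q'" using w by (auto simp: S_def wp)
      obtain z where z: "z \<in> D" "a z \<le> r * a x + (1 - r) * a y" "b z \<le> r * b x + (1 - r) * b y"
        using conv[OF x(1) y(1) r] by auto
      have "r * a x + (1 - r) * a y \<le> r * p + s * p'" "r * b x + (1 - r) * b y \<le> r * q + s * q'"
        using x y r s by (auto intro!: add_mono mult_left_mono)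
      then show ?thesis using z by (force simp: S_def vp wp)
    qed
  qed
  have "S \<inter> T = {}" using mx by (force simp: S_def T_def)
  have "S \<noteq> {}" using False by (auto simp: S_def)
  have "T \<noteq> {}" by (auto simp: T_def intro: lt_ex)
  obtain h k where h: "h \<noteq> 0" "\<And>x. x \<in> T \<Longrightarrow> inner h x \<le> k" "\<And>x. x \<in> S \<Longrightarrow> k \<le> inner h x"
    using separating_hyperplane_sets[OF \<open>convex T\<close> \<open>convex S\<close> \<open>T \<noteq> {}\<close> \<open>S \<noteq> {}\<close>] \<open>S \<inter> T = {}\<close> by blast
  obtain u v where uv: "h = (u, v)" by (cases h)
  have T: "u * p + v * q \<le> k" if "p < \<beta>" "q < \<beta>" for p q
    using h(2)[of "(p, q)"] that by (auto simp: T_def uv)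
  have S: "k \<le> u * p + v * q" if "x \<in> D" "a x \<le> p" "b x \<le> q" for p q x
    using h(3)[of "(p, q)"] that by (auto simp: S_def uv)
  have u: "0 \<le> u"
  proof (rule ccontr)
    assume "\<not> 0 \<le> u"
    then have u: "u < 0" by simp
    \<comment> \<open>With the second coordinate fixed at \<open>\<beta> - 1\<close>, a point of
      \<open>T\<close> far to the left would make \<open>u * p\<close> exceed the bound
      \<open>M\<close> that separation imposes on it.\<close>
    define M where "M = k - v * (\<beta> - 1)"
    have "u * (min (\<beta> - 1) ((M + 1) / u)) \<ge> M + 1"
      using u by (auto simp: min_def field_simps)
    moreover have "u * (min (\<beta> - 1) ((M + 1) / u)) + v * (\<beta> - 1) \<le> k"
      by (rule T) auto
    ultimately show False by (simp add: M_def)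
  qed
  have v: "0 \<le> v"
  proof (rule ccontr)
    assume "\<not> 0 \<le> v"
    then have u: "v < 0" by simp
    define M where "M = k - u * (\<beta> - 1)"
    have "v * (min (\<beta> - 1) ((M + 1) / v)) \<ge> M + 1"
      using u by (auto simp: min_def field_simps)
    moreover have "u * (\<beta> - 1) + v * (min (\<beta> - 1) ((M + 1) / v)) \<le> k"
      by (rule T) auto
    ultimately show False by (simp add: M_def)
  qed
  have pos: "0 < u + v" using u v h(1) by (auto simp: uv zero_prod_def) 
  \<comment> \<open>The corner of the open quadrant is only a limit of its points, here of
    \<open>(\<beta> - e', \<beta> - e')\<close>.\<close>
  have k: "(u + v) * \<beta> \<le> k"
  proof (rule field_le_epsilon)
    fix e :: real assume "e > 0"
    define e' where "e' = e / (u + v)"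
    have e': "0 < e'" "(u + v) * e' = e" using pos \<open>e > 0\<close> by (auto simp: e'_def)
    have "u * (\<beta> - e') + v * (\<beta> - e') \<le> k"
      using e' by (intro T) auto
    moreover have "u * (\<beta> - e') + v * (\<beta> - e') = (u + v) * \<beta> - e"
      by (simp add: e'(2)[symmetric] algebra_simps)
    ultimately show "(u + v) * \<beta> \<le> k + e" by simp
  qed
  show ?thesis
  proof (intro exI[of _ "u / (u + v)"] conjI ballI)
    fix x assume "x \<in> D"
    have "(u + v) * \<beta> \<le> u * a x + v * b x" using S[OF \<open>x \<in> D\<close>, of "a x" "b x"] k by simp
    moreover have "1 - u / (u + v) = v / (u + v)" using pos by (simp add: field_simps)
    ultimately show "\<beta> \<le> u / (u + v) * a x + (1 - u / (u + v)) * b x"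
      using pos by (simp add: add_divide_distrib[symmetric] pos_le_divide_eq mult.commute)
  qed (use u v pos in auto)
qed

text \<open>On the common finite domain \<open>D\<close>, convexity along segments to a fixed point
  \<open>x1\<close> shows that \<open>g\<close> falls at most linearly in \<open>f\<close>. Hence
  the pair perturbed by a small \<open>\<delta>\<close> still has maximum at least
  \<open>\<beta> - \<delta> * K\<close>, and the real alternative applied to it returns weights
  that, in terms of \<open>f\<close> and \<open>g\<close>, are both at least
  \<open>\<delta>\<close>.\<close>

lemma convex_alternative:
  fixes f g :: "'x \<Rightarrow> ereal" and \<alpha> \<beta> :: real
  assumes cv: "convexlike_pair X f g"
    and nf: "\<And>x. x \<in> X \<Longrightarrow> f x \<noteq> -\<infinity>" and ng: "\<And>x. x \<in> X \<Longrightarrow> g x \<noteq> -\<infinity>"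
    and bf: "\<exists>m::real. \<forall>x\<in>X. ereal m \<le> f x"
    and bg: "\<And>L::real. \<exists>m::real. \<forall>x\<in>X. f x \<le> ereal L \<longrightarrow> ereal m \<le> g x"
    and mx: "\<And>x. x \<in> X \<Longrightarrow> ereal \<beta> < f x \<or> ereal \<beta> < g x"
    and ab: "\<alpha> < \<beta>"
  shows "\<exists>t. 0 < t \<and> t < 1 \<and> (\<forall>x\<in>X. ereal \<alpha> < ereal t * f x + ereal (1 - t) * g x)"
proof -
  define D where "D = {x\<in>X. f x \<noteq> \<infinity> \<and> g x \<noteq> \<infinity>}"
  define a where "a x = real_of_ereal (f x)" for x
  define b where "b x = real_of_ereal (g x)" for x
  have fa: "f x = ereal (a x)" and gb: "g x = ereal (b x)" if "x \<in> D" for x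
    using that nf[of x] ng[of x] by (auto simp: D_def a_def b_def ereal_real)
  have inf: "ereal t * f x + ereal (1 - t) * g x = \<infinity>" if "x \<in> X" "x \<notin> D" "0 < t" "t < 1" for x t
    using that nf[of x] ng[of x] by (cases "f x"; cases "g x") (auto simp: D_def)
  have conv: "\<exists>w\<in>D. a w \<le> u * a x + (1 - u) * a y \<and> b w \<le> u * b x + (1 - u) * b y"
    if xy: "x \<in> D" "y \<in> D" "0 < u" "u < 1" for x y u
  proof -
    obtain w where w: "w \<in> X" "f w \<le> ereal u * f x + ereal (1 - u) * f y"
      "g w \<le> ereal u * g x + ereal (1 - u) * g y"
      using cv xy unfolding convexlike_pair_def D_def by blast
    then have 1: "f w \<le> ereal (u * a x + (1 - u) * a y)" "g w \<le> ereal (u * b x + (1 - u) * b y)"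
      by (simp_all add: fa[OF xy(1)] fa[OF xy(2)] gb[OF xy(1)] gb[OF xy(2)])
    then have "w \<in> D" using w(1) by (auto simp: D_def)
    then show ?thesis using 1 by (auto simp: fa gb intro!: bexI[of _ w])
  qed
  show ?thesis
  proof (cases "D = {}")
    case True
    then have "ereal (1/2) * f x + ereal (1 - 1/2) * g x = \<infinity>" if "x \<in> X" for x
      using that by (intro inf) auto
    then show ?thesis by (intro exI[of _ "1/2"] conjI ballI) (simp_all only: ereal_less, simp_all)
  next
    case False
    then obtain x1 where x1: "x1 \<in> D" by auto
    obtain m0 where m0: "\<And>x. x \<in> X \<Longrightarrow> ereal m0 \<le> f x" using bf by auto
    define m where "m = min m0 0"
    have m: "m \<le> a x" if "x \<in> D" for x
      using m0[of x] fa[OF that] that by (auto simp: D_def m_def)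
    \<comment> \<open>One unit above the value at \<open>x1\<close>: points with
      \<open>a x > L\<close> then satisfy \<open>a x - a x1 > 1\<close>, so its reciprocal is an
      admissible weight.\<close>
    define L where "L = a x1 + 1"
    obtain l0 where l0: "\<And>x. x \<in> X \<Longrightarrow> f x \<le> ereal L \<Longrightarrow> ereal l0 \<le> g x" using bg by blast
    define M where "M = 1 + \<bar>l0\<bar> + \<bar>b x1\<bar> + \<bar>m\<bar>"
    have l: "- \<bar>l0\<bar> \<le> b x" if "x \<in> D" "a x \<le> L" for x
      using l0[of x] that fa[OF that(1)] gb[OF that(1)] by (auto simp: D_def)
    have growth: "- M * (1 + (a x - m)) \<le> b x" if x: "x \<in> D" for x
    proof (cases "a x \<le> L")
      case True
      have "M * 1 \<le> M * (1 + (a x - m))" using m[OF x] by (intro mult_left_mono) (auto simp: M_def)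
      then have "- M * (1 + (a x - m)) \<le> - M" by simp
      also have "- M \<le> b x" using l[OF x True] by (simp add: M_def)
      finally show ?thesis .
    next
      case False
      \<comment> \<open>This weight brings the combination of \<open>x\<close> and \<open>x1\<close>
        down to the level \<open>L\<close>, where \<open>g\<close> is bounded below by
        \<open>- \<bar>l0\<bar>\<close>. Solving the convexity inequality for \<open>b x\<close>
        costs the factor \<open>a x - a x1\<close> and gives the linear bound.\<close>
      define u where "u = 1 / (a x - a x1)"
      have gt: "a x - a x1 > 1" using False by (simp add: L_def)
      have u: "0 < u" "u < 1" using gt by (auto simp: u_def)
      obtain w where w: "w \<in> D" "a w \<le> u * a x + (1 - u) * a x1" "b w \<le> u * b x + (1 - u) * b x1"
        using conv[OF x x1 u] by auto
      have "u * a x + (1 - u) * a x1 = u * (a x - a x1) + a x1" by (simp add: algebra_simps)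
      also have "\<dots> = L" using gt by (simp add: u_def L_def)
      finally have "- \<bar>l0\<bar> \<le> b w" using l[OF w(1)] w(2) by simp
      then have "- \<bar>l0\<bar> \<le> u * b x + (1 - u) * b x1" using w(3) by simp
      also have "(1 - u) * b x1 \<le> 1 * \<bar>b x1\<bar>"
        using u by (intro order_trans[OF mult_left_mono mult_right_mono]) auto
      finally have "- M \<le> u * b x" by (simp add: M_def)
      then have "- M * (a x - a x1) \<le> b x" using gt by (simp add: u_def field_simps)
      moreover have "M * (a x - a x1) \<le> M * (1 + (a x - m))"
        using m[OF x1] by (intro mult_left_mono) (auto simp: M_def)
      ultimately show ?thesis by simp
    qed
    have M1: "M \<ge> 1" by (simp add: M_def)
    text \<open>Mixing a small amount \<open>\<delta>\<close> of each function into the other makes all weights positive,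
      so that points outside the common domain do no harm.\<close>
    define K where "K = M * (1 + (\<bar>\<beta>\<bar> - m)) + \<bar>\<beta>\<bar> + 1"
    have K1: "K \<ge> 1" using M1 by (auto simp: K_def m_def intro!: mult_nonneg_nonneg)
    \<comment> \<open>The first bound keeps the coefficient \<open>1 - \<delta> * (1 + M)\<close>
      positive, the second keeps the drop \<open>\<delta> * K\<close> below
      \<open>\<beta> - \<alpha>\<close>.\<close>
    define \<delta> where "\<delta> = min (1 / (2 + 2 * M)) ((\<beta> - \<alpha>) / (2 * K))"
    have d: "0 < \<delta>" "\<delta> \<le> 1 / (2 + 2 * M)" "\<delta> \<le> (\<beta> - \<alpha>) / (2 * K)"
      using ab M1 K1 by (auto simp: \<delta>_def)
    have d2: "\<delta> < 1/2"
    proof -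
      have "1 / (2 + 2 * M) < 1/2" using M1 by (simp add: field_simps)
      then show ?thesis using d by simp
    qed
    have dM: "\<delta> * (1 + M) \<le> 1/2"
      using d(2) M1 by (simp add: field_simps)
    have dK: "\<delta> * K < \<beta> - \<alpha>"
    proof -
      have "\<delta> * K \<le> (\<beta> - \<alpha>) / (2 * K) * K" using d(3) K1 by (intro mult_right_mono) auto
      also have "\<dots> < \<beta> - \<alpha>" using ab K1 by simp
      finally show ?thesis .
    qed
    define A where "A x = (1 - \<delta>) * a x + \<delta> * b x" for x
    define B where "B x = \<delta> * a x + (1 - \<delta>) * b x" for x
    \<comment> \<open>The smaller value \<open>\<nu>\<close> may fall linearly in the larger value
      \<open>\<mu>\<close>, but the total coefficient of \<open>\<mu>\<close> remains positive, so
      the worst case is \<open>\<mu> = \<beta>\<close>; \<open>K\<close> bounds what is lost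
      there.\<close>
    have key: "\<beta> - \<delta> * K \<le> (1 - \<delta>) * \<mu> + \<delta> * \<nu>"
      if "\<beta> \<le> \<mu>" "- M * (1 + (\<mu> - m)) \<le> \<nu>" for \<mu> \<nu>
    proof -
      have "\<delta> * (- M * (1 + (\<mu> - m))) \<le> \<delta> * \<nu>" using d that by (intro mult_left_mono) auto
      moreover have "(1 - \<delta> * (1 + M)) * \<beta> \<le> (1 - \<delta> * (1 + M)) * \<mu>"
        using dM that by (intro mult_left_mono) auto
      ultimately have "(1 - \<delta> * (1 + M)) * \<beta> - \<delta> * M * (1 - m) \<le> (1 - \<delta>) * \<mu> + \<delta> * \<nu>"
        by (simp add: algebra_simps)
      moreover have "\<delta> * ((1 + M) * \<beta> + M * (1 - m)) \<le> \<delta> * K"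
      proof (rule mult_left_mono)
        have "(1 + M) * \<beta> \<le> (1 + M) * \<bar>\<beta>\<bar>" using M1 by (intro mult_left_mono) auto
        then show "(1 + M) * \<beta> + M * (1 - m) \<le> K" by (simp add: K_def algebra_simps)
      qed (use d in auto)
      ultimately show ?thesis by (simp add: algebra_simps)
    qed
    have "\<exists>t. 0 \<le> t \<and> t \<le> 1 \<and> (\<forall>x\<in>D. \<beta> - \<delta> * K \<le> t * A x + (1 - t) * B x)"
    proof (rule convex_alternative_real)
      fix x y u assume xy: "x \<in> D" "y \<in> D" "0 < u" "u < (1::real)"
      obtain w where w: "w \<in> D" "a w \<le> u * a x + (1 - u) * a y" "b w \<le> u * b x + (1 - u) * b y"
        using conv[OF xy] by auto
      have 1: "A w \<le> (1 - \<delta>) * (u * a x + (1 - u) * a y) + \<delta> * (u * b x + (1 - u) * b y)"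
        using w d d2 unfolding A_def by (intro add_mono mult_left_mono) auto
      have 2: "B w \<le> \<delta> * (u * a x + (1 - u) * a y) + (1 - \<delta>) * (u * b x + (1 - u) * b y)"
        using w d d2 unfolding B_def by (intro add_mono mult_left_mono) auto
      show "\<exists>w\<in>D. A w \<le> u * A x + (1 - u) * A y \<and> B w \<le> u * B x + (1 - u) * B y"
        using 1 2 by (intro bexI[OF _ w(1)]) (auto simp: A_def B_def algebra_simps)
    next
      fix x assume x: "x \<in> D"
      show "\<beta> - \<delta> * K \<le> A x \<or> \<beta> - \<delta> * K \<le> B x"
      proof (cases "a x \<ge> b x")
        case True
        then have "\<beta> \<le> a x" using mx[of x] x fa[OF x] gb[OF x] by (auto simp: D_def)
        then show ?thesis using key[OF _ growth[OF x]] by (simp add: A_def)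
      next
        case False
        then have "\<beta> \<le> b x" using mx[of x] x fa[OF x] gb[OF x] by (auto simp: D_def)
        \<comment> \<open>The roles in \<open>key\<close> are exchanged; the growth bound is now
          immediate from \<open>a x \<ge> m \<ge> - M\<close> and
          \<open>b x \<ge> m\<close>.\<close>
        moreover have "- M * (1 + (b x - m)) \<le> a x"
        proof -
          have "M * 1 \<le> M * (1 + (b x - m))"
            using m[OF x] False M1 by (intro mult_left_mono) auto
          moreover have "- M \<le> m" by (simp add: M_def)
          ultimately show ?thesis using m[OF x] by simp
        qed
        ultimately show ?thesis using key[of "b x" "a x"] by (simp add: B_def algebra_simps)
      qed
    qed
    then obtain t where t: "0 \<le> t" "t \<le> 1" "\<And>x. x \<in> D \<Longrightarrow> \<beta> - \<delta> * K \<le> t * A x + (1 - t) * B x"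
      by auto
    \<comment> \<open>The coefficient of \<open>a x\<close> in
      \<open>t * A x + (1 - t) * B x\<close>.\<close>
    define s where "s = t * (1 - \<delta>) + (1 - t) * \<delta>"
    have s1: "\<delta> \<le> s" "s \<le> 1 - \<delta>"
    proof -
      have "0 \<le> t * (1 - 2 * \<delta>)" "0 \<le> (1 - t) * (1 - 2 * \<delta>)" using t d2 by auto
      then show "\<delta> \<le> s" "s \<le> 1 - \<delta>" by (auto simp: s_def algebra_simps)
    qed
    show ?thesis
    proof (intro exI[of _ s] conjI ballI)
      show "0 < s" "s < 1" using s1 d by auto
      fix x assume x: "x \<in> X"
      show "ereal \<alpha> < ereal s * f x + ereal (1 - s) * g x"
      proof (cases "x \<in> D")
        case True
        have "\<alpha> < t * A x + (1 - t) * B x" using t(3)[OF True] dK by simp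
        also have "\<dots> = s * a x + (1 - s) * b x" by (simp add: A_def B_def s_def algebra_simps)
        finally show ?thesis by (simp add: fa[OF True] gb[OF True])
      next
        case False
        have "0 < s" "s < 1" using s1 d by auto
        from inf[OF x False this] show ?thesis by (simp only: less_ereal.simps)
      qed
    qed
  qed
qed

lemma ereal_convex_bound:
  assumes "x \<le> ereal a" "y \<le> ereal a" "0 < u" "u < 1"
  shows "ereal u * x + ereal (1 - u) * y \<le> ereal a"
proof -
  have "ereal u * x + ereal (1 - u) * y \<le> ereal u * ereal a + ereal (1 - u) * ereal a"
    using assms by (intro add_mono ereal_mult_left_mono) auto
  also have "\<dots> = ereal a" by (simp add: algebra_simps)
  finally show ?thesis .
qed

text \<open>Induction on \<open>S\<close> with \<open>X\<close> varying: where the new function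
  \<open>F y0\<close> is at most \<open>\<beta>\<close>, the others must do, and the induction
  hypothesis on this sublevel set merges them into one \<open>F y1\<close>. The two-function
  alternative then merges \<open>F y0\<close> and \<open>F y1\<close> on all of \<open>X\<close>.
  Combinations in \<open>X\<close> and \<open>Y\<close> are only asked to exist, because one of the
  two sets will consist of measures.\<close>

lemma convexlike_finite_alternative:
  fixes F :: "'y \<Rightarrow> 'x \<Rightarrow> ereal"
  assumes "finite S" "S \<subseteq> Y" "Y \<noteq> {}"
    and conc: "\<And>y y' t. \<lbrakk>y \<in> Y; y' \<in> Y; 0 < t; t < 1\<rbrakk> \<Longrightarrow>
      \<exists>y''\<in>Y. \<forall>x\<in>X. ereal t * F y x + ereal (1 - t) * F y' x \<le> F y'' x"
    and conv: "\<And>x x' u. \<lbrakk>x \<in> X; x' \<in> X; 0 < u; u < 1\<rbrakk> \<Longrightarrow>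
      \<exists>w\<in>X. \<forall>y\<in>Y. F y w \<le> ereal u * F y x + ereal (1 - u) * F y x'"
    and nF: "\<And>x y. x \<in> X \<Longrightarrow> y \<in> Y \<Longrightarrow> F y x \<noteq> -\<infinity>"
    and bF: "\<And>y. y \<in> Y \<Longrightarrow> \<exists>m::real. \<forall>x\<in>X. ereal m \<le> F y x"
    and "\<And>x. x \<in> X \<Longrightarrow> \<exists>y\<in>S. ereal \<beta> < F y x"
    and "\<alpha> < \<beta>"
  shows "\<exists>y\<in>Y. \<forall>x\<in>X. ereal \<alpha> < F y x"
  using assms
proof (induction S arbitrary: X \<alpha> rule: finite_induct)
  case empty
  then obtain y where "y \<in> Y" by auto
  moreover have "X = {}" using empty.prems(7) by auto
  ultimately show ?case by auto
next
  case (insert y0 S)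
  define X' where "X' = {x\<in>X. F y0 x \<le> ereal \<beta>}"
  have y0: "y0 \<in> Y" using insert.prems by auto
  have X': "X' \<subseteq> X" by (auto simp: X'_def)
  \<comment> \<open>Both the induction hypothesis and the final merging lower the level, so the gap
    is split.\<close>
  obtain \<gamma> where \<gamma>: "\<alpha> < \<gamma>" "\<gamma> < \<beta>" using dense[OF insert.prems(8)] by auto
  have "\<exists>y\<in>Y. \<forall>x\<in>X'. ereal \<gamma> < F y x"
  proof (rule insert.IH)
    show "S \<subseteq> Y" "Y \<noteq> {}" "\<gamma> < \<beta>" using insert.prems \<gamma> by auto
    show "\<exists>y''\<in>Y. \<forall>x\<in>X'. ereal t * F y x + ereal (1 - t) * F y' x \<le> F y'' x"
      if "y \<in> Y" "y' \<in> Y" "0 < t" "t < 1" for y y' t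
      using insert.prems(3)[OF that] X' by blast
    show "\<exists>w\<in>X'. \<forall>y\<in>Y. F y w \<le> ereal u * F y x + ereal (1 - u) * F y x'"
      if "x \<in> X'" "x' \<in> X'" "0 < u" "u < 1" for x x' u
    proof -
      have "\<exists>w\<in>X. \<forall>y\<in>Y. F y w \<le> ereal u * F y x + ereal (1 - u) * F y x'"
        using that X' by (intro insert.prems(4)) auto
      then obtain w where w: "w \<in> X" "\<forall>y\<in>Y. F y w \<le> ereal u * F y x + ereal (1 - u) * F y x'"
        by blast
      have "F y0 w \<le> ereal \<beta>"
        using w(2) y0 ereal_convex_bound[of "F y0 x" \<beta> "F y0 x'" u] that
        by (auto simp: X'_def intro: order_trans)
      then show ?thesis using w by (auto simp: X'_def)
    qed
    show "F y x \<noteq> -\<infinity>" if "x \<in> X'" "y \<in> Y" for x y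
      using insert.prems(5)[of x y] that X' by auto
    show "\<exists>m::real. \<forall>x\<in>X'. ereal m \<le> F y x" if "y \<in> Y" for y
      using insert.prems(6)[OF that] X' by blast
    show "\<exists>y\<in>S. ereal \<beta> < F y x" if "x \<in> X'" for x
      using insert.prems(7)[of x] that by (auto simp: X'_def)
  qed
  then obtain y1 where y1: "y1 \<in> Y" "\<And>x. x \<in> X' \<Longrightarrow> ereal \<gamma> < F y1 x" by auto
  have "\<exists>t. 0 < t \<and> t < 1 \<and> (\<forall>x\<in>X. ereal \<alpha> < ereal t * F y0 x + ereal (1 - t) * F y1 x)"
  proof (rule convex_alternative)
    show "convexlike_pair X (F y0) (F y1)"
      unfolding convexlike_pair_def using insert.prems(4) y0 y1(1) by meson
    show "F y0 x \<noteq> -\<infinity>" "F y1 x \<noteq> -\<infinity>" if "x \<in> X" for x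
      using insert.prems(5)[OF that] y0 y1(1) by auto
    show "\<exists>m::real. \<forall>x\<in>X. ereal m \<le> F y0 x" using insert.prems(6)[OF y0] .
    show "\<exists>m::real. \<forall>x\<in>X. F y0 x \<le> ereal L \<longrightarrow> ereal m \<le> F y1 x" for L
      using insert.prems(6)[OF y1(1)] by auto
    show "ereal \<gamma> < F y0 x \<or> ereal \<gamma> < F y1 x" if "x \<in> X" for x
    proof (cases "x \<in> X'")
      case False
      then have "ereal \<beta> < F y0 x" using that by (auto simp: X'_def)
      moreover have "ereal \<gamma> < ereal \<beta>" using \<gamma> by simp
      ultimately show ?thesis by (blast intro: less_trans)
    qed (use y1(2) in auto)
    show "\<alpha> < \<gamma>" by fact
  qed
  then obtain t where t: "0 < t" "t < 1" "\<And>x. x \<in> X \<Longrightarrow> ereal \<alpha> < ereal t * F y0 x + ereal (1 - t) * F y1 x"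
    by auto
  obtain y2 where "y2 \<in> Y" "\<forall>x\<in>X. ereal t * F y0 x + ereal (1 - t) * F y1 x \<le> F y2 x"
    using insert.prems(3)[OF y0 y1(1) t(1,2)] by auto
  then show ?case using t(3) by (meson less_le_trans)
qed

section \<open>Coding measures on Euclidean space by measures on the line\<close>

text \<open>The point of the Cantor set with ternary digits 0 and 2 given by \<open>\<beta>\<close>.
  The gaps of the Cantor set make it possible to read the digits by a continuous function.\<close>

definition cantor_code :: "(nat \<Rightarrow> bool) \<Rightarrow> real" where
  "cantor_code \<beta> = (\<Sum>m. 2 * of_bool (\<beta> m) / 3 ^ Suc m)"

lemma summable_cantor_code: "summable (\<lambda>m. 2 * of_bool (\<beta> m) / 3 ^ Suc m :: real)"
proof (rule summable_comparison_test[OF exI[of _ 0]])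
  show "summable (\<lambda>m. 2 / 3 * (1 / 3) ^ m :: real)"
    by (intro summable_mult summable_geometric) auto
qed (auto simp: field_simps)

text \<open>Multiplication by 3 shifts the expansion, and the digit that passes the point
  contributes an even integer, invisible to a function of period 2.\<close>

lemma cantor_code_Suc: "3 * cantor_code \<beta> = 2 * of_bool (\<beta> 0) + cantor_code (\<lambda>m. \<beta> (Suc m))"
proof -
  have "cantor_code \<beta> = 2 * of_bool (\<beta> 0) / 3 + (\<Sum>m. 2 * of_bool (\<beta> (Suc m)) / 3 ^ Suc (Suc m))"
    unfolding cantor_code_def using suminf_split_head[OF summable_cantor_code[of \<beta>]] by simp
  also have "(\<Sum>m. 2 * of_bool (\<beta> (Suc m)) / 3 ^ Suc (Suc m) :: real) = cantor_code (\<lambda>m. \<beta> (Suc m)) / 3"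
    unfolding cantor_code_def
    by (subst suminf_divide[OF summable_cantor_code, symmetric]) (simp add: field_simps)
  finally show ?thesis by simp
qed

lemma cantor_code_bounds: "0 \<le> cantor_code \<beta>" "cantor_code \<beta> \<le> 1"
proof -
  show "0 \<le> cantor_code \<beta>"
    unfolding cantor_code_def by (intro suminf_nonneg summable_cantor_code) auto
  have "cantor_code \<beta> \<le> (\<Sum>m. 2 / 3 * (1 / 3) ^ m)"
    unfolding cantor_code_def
    by (intro suminf_le summable_cantor_code summable_mult summable_geometric) (auto simp: field_simps)
  also have "\<dots> = 1"
    by (subst suminf_mult) (auto simp: suminf_geometric summable_geometric)
  finally show "cantor_code \<beta> \<le> 1" .
qed

text \<open>Any continuous function of period 2 that is 0 on \<open>[0, 1/3]\<close> and 1 on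
  \<open>[2/3, 1]\<close> would do. The cut-off cosine is one since \<open>cos\<close> takes the
  values 1/2 and -1/2 at \<open>pi / 3\<close> and \<open>2 * pi / 3\<close>.\<close>

definition plateau :: "real \<Rightarrow> real" where
  "plateau t = max 0 (min 1 (1 / 2 - cos (pi * t)))"

lemma plateau_bounds: "0 \<le> plateau t" "plateau t \<le> 1"
  by (auto simp: plateau_def)

lemma plateau_periodic: "plateau (2 * of_int n + t) = plateau t"
proof -
  have "cos (pi * (2 * of_int n + t)) = cos (2 * pi * of_int n + pi * t)" by (simp add: algebra_simps)
  also have "\<dots> = cos (pi * t)"
    by (simp only: cos_add cos_integer_2pi[OF Ints_of_int] sin_integer_2pi[OF Ints_of_int])
  finally show ?thesis by (simp add: plateau_def)
qed

lemma plateau_0: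
  assumes "0 \<le> t" "t \<le> 1 / 3"
  shows "plateau t = 0"
proof -
  have "pi * t \<le> pi * (1/3)" using assms by (intro mult_left_mono) auto
  then have "cos (pi / 3) \<le> cos (pi * t)" using assms by (intro cos_monotone_0_pi_le) auto
  then show ?thesis by (simp add: plateau_def cos_60)
qed

lemma plateau_1:
  assumes "2 / 3 \<le> t" "t \<le> 1"
  shows "plateau t = 1"
proof -
  have "pi * (2/3) \<le> pi * t" "pi * t \<le> pi * 1" using assms by (intro mult_left_mono; simp)+
  then have "cos (pi * t) \<le> cos (pi * (2 / 3))" by (intro cos_monotone_0_pi_le) auto
  also have "pi * (2 / 3) = pi - pi / 3" by simp
  also have "cos (pi - pi / 3) = - cos (pi / 3)" by (rule cos_pi_minus)
  finally show ?thesis by (simp add: plateau_def cos_60)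
qed

text \<open>After \<open>m\<close> shifts and removal of an even integer there remains a code whose
  leading digit is that of \<open>\<beta> m\<close>; it lies in \<open>[0, 1/3]\<close> or in
  \<open>[2/3, 1]\<close> accordingly.\<close>

lemma plateau_cantor_code: "plateau (3 ^ m * cantor_code \<beta>) = of_bool (\<beta> m)"
proof -
  have "\<exists>n::int. 3 ^ m * cantor_code \<beta> = 2 * of_int n + cantor_code (\<lambda>j. \<beta> (j + m))"
  proof (induction m)
    case (Suc m)
    then obtain n :: int where "3 ^ m * cantor_code \<beta> = 2 * of_int n + cantor_code (\<lambda>j. \<beta> (j + m))" by auto
    then have "3 ^ Suc m * cantor_code \<beta> = 6 * of_int n + 3 * cantor_code (\<lambda>j. \<beta> (j + m))" by simp
    also have "\<dots> = 2 * of_int (3 * n + of_bool (\<beta> m)) + cantor_code (\<lambda>j. \<beta> (j + Suc m))"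
      unfolding cantor_code_Suc[of "\<lambda>j. \<beta> (j + m)"] by simp
    finally show ?case by blast
  qed auto
  then have "plateau (3 ^ m * cantor_code \<beta>) = plateau (cantor_code (\<lambda>j. \<beta> (j + m)))"
    using plateau_periodic by fastforce
  also have "\<dots> = of_bool (\<beta> m)"
    using cantor_code_Suc[of "\<lambda>j. \<beta> (j + m)"] cantor_code_bounds[of "\<lambda>j. \<beta> (Suc j + m)"]
    by (cases "\<beta> m") (auto intro: plateau_0 plateau_1)
  finally show ?thesis .
qed

text \<open>Digits after the binary point, counted from 0; rounding down selects the terminating
  expansion of a dyadic number.\<close>

definition binary_digit :: "nat \<Rightarrow> real \<Rightarrow> bool" where
  "binary_digit k u \<longleftrightarrow> odd \<lfloor>2 ^ Suc k * u\<rfloor>"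

lemma binary_digit_sums:
  assumes u: "0 \<le> u" "u < 1"
  shows "(\<lambda>k. of_bool (binary_digit k u) / 2 ^ Suc k) sums u"
proof -
  \<comment> \<open>The partial sums are the truncations of \<open>u\<close> to \<open>K\<close>
    binary places; \<open>u < 1\<close> matters for \<open>K = 0\<close>.\<close>
  have part: "(\<Sum>k<K. of_bool (binary_digit k u) / 2 ^ Suc k) = real_of_int \<lfloor>2 ^ K * u\<rfloor> / 2 ^ K" for K
  proof (induction K)
    case 0
    then show ?case using u by (simp add: floor_eq_iff)
  next
    case (Suc K)
    have "\<lfloor>2 ^ Suc K * u\<rfloor> div 2 = \<lfloor>2 ^ K * u\<rfloor>"
      using floor_divide_real_eq_div[of 2 "2 ^ Suc K * u"] by simp
    then have "\<lfloor>2 ^ Suc K * u\<rfloor> = 2 * \<lfloor>2 ^ K * u\<rfloor> + of_bool (binary_digit K u)"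
      unfolding binary_digit_def by (metis mult_div_mod_eq mod2_eq_if of_bool_eq)
    then have "real_of_int \<lfloor>2 ^ Suc K * u\<rfloor> = 2 * real_of_int \<lfloor>2 ^ K * u\<rfloor> + of_bool (binary_digit K u)"
      by simp
    then show ?case unfolding sum.lessThan_Suc Suc by (simp add: field_simps)
  qed
  have "(\<lambda>K. real_of_int \<lfloor>2 ^ K * u\<rfloor> / 2 ^ K) \<longlonglongrightarrow> u"
  proof (rule real_tendsto_sandwich)
    show "(\<lambda>K. u - (1/2) ^ K) \<longlonglongrightarrow> u"
      using tendsto_diff[OF tendsto_const LIMSEQ_power_zero[of "1/2::real"], of u] by simp
    show "\<forall>\<^sub>F K in sequentially. u - (1/2) ^ K \<le> real_of_int \<lfloor>2 ^ K * u\<rfloor> / 2 ^ K"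
    proof (rule always_eventually, rule allI)
      fix K
      have "2 ^ K * u - 1 \<le> real_of_int \<lfloor>2 ^ K * u\<rfloor>" by linarith
      then have "(2 ^ K * u - 1) / 2 ^ K \<le> real_of_int \<lfloor>2 ^ K * u\<rfloor> / 2 ^ K" by (rule divide_right_mono) auto
      then show "u - (1/2) ^ K \<le> real_of_int \<lfloor>2 ^ K * u\<rfloor> / 2 ^ K" by (simp add: diff_divide_distrib power_one_over)
    qed
    show "\<forall>\<^sub>F K in sequentially. real_of_int \<lfloor>2 ^ K * u\<rfloor> / 2 ^ K \<le> u"
    proof (rule always_eventually, rule allI)
      fix K
      have "real_of_int \<lfloor>2 ^ K * u\<rfloor> \<le> 2 ^ K * u" by linarith
      then show "real_of_int \<lfloor>2 ^ K * u\<rfloor> / 2 ^ K \<le> u" by (simp add: pos_divide_le_eq mult.commute)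
    qed
  qed auto
  then show ?thesis unfolding sums_def part .
qed

text \<open>Schoenberg's curve \<open>h\<close> recovers each coordinate from its share of the
  digits and is continuous as a uniform limit. Its section \<open>s\<close> on the open unit ball
  encodes the digits of all coordinates; measurability is all that is asked of it.\<close>

lemma space_filling_curve:
  obtains h :: "real \<Rightarrow> 'a::euclidean_space" and s :: "'a \<Rightarrow> real"
  where "continuous_on UNIV h" "s \<in> borel_measurable borel" "\<And>x. 0 \<le> s x" "\<And>x. s x \<le> 1"
    "\<And>x. norm x < 1 \<Longrightarrow> h (s x) = x"
proof -
  define D where "D = DIM('a)"
  have D: "D > 0" by (simp add: D_def)
  obtain e where e: "bij_betw e (Basis::'a set) {0..<D}"
    using ex_bij_betw_finite_nat[of "Basis::'a set"] by (auto simp: D_def)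
  define g where "g = inv_into Basis e"
  have ge: "g (e b) = b" and el: "e b < D" if "b \<in> Basis" for b
    using e that by (auto simp: g_def bij_betw_def)
  \<comment> \<open>The coordinates are interleaved: position \<open>k * D + j\<close> holds digit
    \<open>k\<close> of coordinate number \<open>j\<close>, after \<open>(- 1, 1)\<close> has been
    rescaled to \<open>(0, 1)\<close>. The factor 2 and the summand -1 in \<open>h\<close> undo the
    rescaling.\<close>
  define \<beta> where "\<beta> x m = binary_digit (m div D) ((1 + x \<bullet> g (m mod D)) / 2)" for x :: 'a and m
  define s where "s x = cantor_code (\<beta> x)" for x
  define \<eta> where "\<eta> b t = (\<Sum>k. plateau (3 ^ (k * D + e b) * t) / 2 ^ Suc k)" for b t
  define h where "h t = (\<Sum>b\<in>Basis. (2 * \<eta> b t - 1) *\<^sub>R b)" for t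
  have cont_pl: "continuous_on UNIV (\<lambda>t. plateau (c * t))" for c
    unfolding plateau_def by (intro continuous_intros)
  have "continuous_on UNIV (\<eta> b)" for b
    unfolding \<eta>_def
  proof (rule uniform_limit_theorem[OF _ Weierstrass_m_test])
    show "\<forall>\<^sub>F n in sequentially. continuous_on UNIV (\<lambda>t. \<Sum>k<n. plateau (3 ^ (k * D + e b) * t) / 2 ^ Suc k)"
      by (intro always_eventually allI continuous_intros cont_pl) auto
    show "norm (plateau (3 ^ (k * D + e b) * t) / 2 ^ Suc k) \<le> (1 / 2) * (1 / 2) ^ k" for k t
      using plateau_bounds[of "3 ^ (k * D + e b) * t"] by (simp add: field_simps)
    show "summable (\<lambda>k. (1 / 2) * (1 / 2) ^ k :: real)"
      by (intro summable_mult summable_geometric) auto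
  qed auto
  then have "continuous_on UNIV h"
    unfolding h_def by (intro continuous_intros)
  moreover have "s \<in> borel_measurable borel"
  proof -
    have [measurable]: "Measurable.pred borel (\<lambda>x. \<beta> x m)" for m
      unfolding \<beta>_def binary_digit_def by measurable
    show ?thesis
      unfolding s_def cantor_code_def of_bool_def by measurable
  qed
  moreover have "h (s x) = x" if x: "norm x < 1" for x
  proof -
    have "2 * \<eta> b (s x) - 1 = x \<bullet> b" if b: "b \<in> Basis" for b
    proof -
      have "\<bar>x \<bullet> b\<bar> < 1" using Basis_le_norm[OF b, of x] x by simp
      then have "(\<lambda>k. of_bool (binary_digit k ((1 + x \<bullet> b) / 2)) / 2 ^ Suc k) sums ((1 + x \<bullet> b) / 2)"
        by (intro binary_digit_sums) auto
      moreover have "\<beta> x (k * D + e b) = binary_digit k ((1 + x \<bullet> b) / 2)" for k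
        using el[OF b] D ge[OF b] by (simp add: \<beta>_def)
      ultimately have "\<eta> b (s x) = (1 + x \<bullet> b) / 2"
        unfolding \<eta>_def s_def plateau_cantor_code by (simp add: sums_iff)
      then show ?thesis by simp
    qed
    then have "h (s x) = (\<Sum>b\<in>Basis. (x \<bullet> b) *\<^sub>R b)"
      unfolding h_def by (metis (mono_tags, lifting) sum.cong)
    then show ?thesis
      by (simp only: euclidean_representation)
  qed
  moreover have "0 \<le> s x" "s x \<le> 1" for x
    by (auto simp: s_def cantor_code_bounds)
  ultimately show ?thesis using that by blast
qed

section \<open>Lower semicontinuous functions and almost sure representation\<close>

lemma lsc_borel_measurable:
  fixes f :: "'a::topological_space \<Rightarrow> ennreal"
  assumes "\<And>a. a < \<infinity> \<Longrightarrow> closed {x. f x \<le> a}"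
  shows "f \<in> borel_measurable borel"
proof (rule borel_measurableI_le)
  fix a
  show "{x \<in> space borel. f x \<le> a} \<in> sets borel"
    using assms[of a] by (cases a) auto
qed

lemma liminf_ge_of_closed_sublevels:
  fixes f :: "'a::metric_space \<Rightarrow> ennreal"
  assumes cl: "\<And>a. a < \<infinity> \<Longrightarrow> closed {x. f x \<le> a}" and x: "X \<longlonglongrightarrow> x"
  shows "f x \<le> liminf (\<lambda>n. f (X n))"
  unfolding le_Liminf_iff
proof (intro allI impI)
  fix y assume y: "y < f x"
  then have "y < \<infinity>" using less_le_trans[OF y top_greatest] by (simp add: infinity_ennreal_def)
  then have "open (- {x. f x \<le> y})" by (intro open_Compl cl)
  moreover have "x \<in> - {x. f x \<le> y}" using y by auto
  ultimately have "\<forall>\<^sub>F n in sequentially. X n \<in> - {x. f x \<le> y}"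
    using x by (rule topological_tendstoD[rotated])
  then show "\<forall>\<^sub>F n in sequentially. y < f (X n)" by (auto simp: not_le)
qed

lemma skorohod_representation:
  fixes \<mu> :: "nat \<Rightarrow> 'a::euclidean_space measure" and V :: "'a \<Rightarrow> ennreal"
  assumes prob: "\<And>n. prob_space (\<mu> n)" and sets [measurable_cong]: "\<And>n. sets (\<mu> n) = sets borel"
    and V: "\<And>a. a < \<infinity> \<Longrightarrow> compact {x. V x \<le> a}"
    and M: "M < \<infinity>" "\<And>n. (\<integral>\<^sup>+x. V x \<partial>\<mu> n) \<le> M"
  obtains r :: "nat \<Rightarrow> nat" and \<Omega> :: "real measure" and X Y
  where "strict_mono r" "prob_space \<Omega>" "\<And>n. X n \<in> borel_measurable \<Omega>" "Y \<in> borel_measurable \<Omega>"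
    "\<And>n. distr \<Omega> borel (X n) = \<mu> (r n)" "AE \<omega> in \<Omega>. (\<lambda>n. X n \<omega>) \<longlonglongrightarrow> (Y \<omega> :: 'a)"
proof -
  obtain h :: "real \<Rightarrow> 'a" and s where h: "continuous_on UNIV h"
    and s: "s \<in> borel_measurable borel" "\<And>x. 0 \<le> s x" "\<And>x. s x \<le> 1" "\<And>x. norm x < 1 \<Longrightarrow> h (s x) = x"
    using space_filling_curve by metis
  define \<sigma> :: "'a \<Rightarrow> 'a" where "\<sigma> x = (1 / (1 + norm x)) *\<^sub>R x" for x
  define \<tau> :: "'a \<Rightarrow> 'a" where "\<tau> y = (1 / (1 - norm y)) *\<^sub>R y" for y
  have norm_\<sigma>: "norm (\<sigma> x) < 1" for x
    by (simp add: \<sigma>_def divide_less_eq add_pos_nonneg)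
  have \<tau>\<sigma>: "\<tau> (\<sigma> x) = x" for x
  proof -
    have p: "1 + norm x > 0" by (simp add: add_pos_nonneg)
    then have "1 - norm (\<sigma> x) = 1 / (1 + norm x)" by (simp add: \<sigma>_def field_simps)
    then show ?thesis using p by (simp add: \<tau>_def \<sigma>_def)
  qed
  have \<sigma>\<tau>: "\<sigma> (\<tau> y) = y" if "norm y < 1" for y
  proof -
    have "1 + norm (\<tau> y) = 1 / (1 - norm y)" using that by (simp add: \<tau>_def field_simps)
    then show ?thesis using that by (simp add: \<tau>_def \<sigma>_def)
  qed
  have \<sigma>_cont: "continuous_on A \<sigma>" for A
    unfolding \<sigma>_def by (intro continuous_intros) (auto simp: add_nonneg_eq_0_iff)
  have \<tau>_lim: "(\<lambda>n. \<tau> (Y n)) \<longlonglongrightarrow> \<tau> y" if "Y \<longlonglongrightarrow> y" "norm y < 1" for Y and y :: 'a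
    unfolding \<tau>_def using that by (intro tendsto_intros) auto
  have [measurable]: "\<sigma> \<in> borel_measurable borel" "\<tau> \<in> borel_measurable borel"
    "h \<in> borel_measurable borel" "s \<in> borel_measurable borel"
    using s(1) borel_measurable_continuous_onI[OF h] unfolding \<sigma>_def \<tau>_def by measurable
  have V_closed: "closed {x. V x \<le> a}" if "a < \<infinity>" for a
    using V[OF that] by (rule compact_imp_closed)
  have V_meas [measurable]: "V \<in> borel_measurable borel"
    by (rule lsc_borel_measurable[OF V_closed])
  text \<open>\<open>V\<close> transported to the open unit ball; being infinite outside of it, its integrability
    prevents mass from escaping to infinity.\<close>
  define W where "W y = (if norm y < 1 then V (\<tau> y) else \<infinity>)" for y
  have W_closed: "closed {y. W y \<le> a}" if "a < \<infinity>" for a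
  proof -
    \<comment> \<open>As the continuous image of a compact set the sublevel set is closed in the
      whole space, although the open ball is not.\<close>
    have "{y. W y \<le> a} = \<sigma> ` {x. V x \<le> a}"
      using that \<sigma>\<tau> by (auto simp: W_def \<tau>\<sigma> norm_\<sigma> image_iff top_unique split: if_splits) metis
    then show ?thesis
      using compact_continuous_image[OF \<sigma>_cont V[OF that]] by (simp add: compact_imp_closed)
  qed
  have W_meas [measurable]: "W \<in> borel_measurable borel"
    by (rule lsc_borel_measurable[OF W_closed])
  define \<nu> where "\<nu> n = distr (\<mu> n) borel (\<lambda>x. s (\<sigma> x))" for n
  have rd: "real_distribution (\<nu> n)" for n
  proof -
    interpret prob_space "\<mu> n" by (rule prob)
    show ?thesis unfolding \<nu>_def by (intro real_distribution_distr) measurable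
  qed
  have "tight \<nu>"
    unfolding tight_def
  proof (intro conjI allI impI rd)
    fix \<epsilon> :: real assume "\<epsilon> > 0"
    \<comment> \<open>The intervals in the definition of tightness are open on the left, and the
      code 0 may carry mass, hence the end point -1.\<close>
    have "measure (\<nu> n) {-1<..1} = 1" for n
    proof -
      interpret prob_space "\<mu> n" by (rule prob)
      have "-1 < s y" for y using s(2)[of y] by linarith
      then have "(\<lambda>x. s (\<sigma> x)) -` {-1<..1} \<inter> space (\<mu> n) = space (\<mu> n)"
        using s(3) by auto
      then show ?thesis unfolding \<nu>_def by (subst measure_distr) (auto simp: prob_space)
    qed
    then show "\<exists>a b. a < b \<and> (\<forall>n. 1 - \<epsilon> < measure (\<nu> n) {a<..b})"
      using \<open>\<epsilon> > 0\<close> by (intro exI[of _ "-1"] exI[of _ 1]) auto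
  qed
  then obtain r \<rho> where r: "strict_mono (r :: nat \<Rightarrow> nat)" "real_distribution \<rho>" "weak_conv_m (\<nu> \<circ> id \<circ> r) \<rho>"
    using tight_imp_convergent_subsubsequence[of \<nu> id] by (auto simp: strict_mono_def)
  have "\<exists>(\<Omega> :: real measure) Y_seq Y. prob_space \<Omega> \<and> (\<forall>n. Y_seq n \<in> borel_measurable \<Omega>) \<and>
      (\<forall>n. distr \<Omega> borel (Y_seq n) = \<nu> (r n)) \<and> Y \<in> borel_measurable \<Omega> \<and>
      (\<forall>x\<in>space \<Omega>. (\<lambda>n. Y_seq n x) \<longlonglongrightarrow> Y x)"
  proof -
    have "weak_conv_m (\<lambda>n. \<nu> (r n)) \<rho>" using r(3) by (simp add: comp_def)
    from Skorohod[OF rd r(2) this] show ?thesis by (simp add: measurable_lborel1) blast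
  qed
  then obtain \<Omega> :: "real measure" and Y' Y where \<Omega>: "prob_space \<Omega>"
    and Y': "\<And>n. Y' n \<in> borel_measurable \<Omega>" "\<And>n. distr \<Omega> borel (Y' n) = \<nu> (r n)"
    and Y: "Y \<in> borel_measurable \<Omega>" and lim: "\<And>x. x \<in> space \<Omega> \<Longrightarrow> (\<lambda>n. Y' n x) \<longlonglongrightarrow> Y x"
    by blast
  have [measurable]: "Y' n \<in> borel_measurable \<Omega>" "Y \<in> borel_measurable \<Omega>" for n
    by fact+
  \<comment> \<open>On the open ball \<open>h\<close> inverts \<open>s\<close>, so decoding recovers
    the law of \<open>\<sigma>\<close> exactly, for every \<open>n\<close>.\<close>
  have law: "distr \<Omega> borel (\<lambda>\<omega>. h (Y' n \<omega>)) = distr (\<mu> (r n)) borel \<sigma>" for n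
  proof -
    have "distr \<Omega> borel (\<lambda>\<omega>. h (Y' n \<omega>)) = distr (distr \<Omega> borel (Y' n)) borel h"
      by (subst distr_distr) (auto simp: comp_def)
    also have "\<dots> = distr (\<mu> (r n)) borel (\<lambda>x. h (s (\<sigma> x)))"
      unfolding Y' \<nu>_def by (subst distr_distr) (auto simp: comp_def)
    also have "\<dots> = distr (\<mu> (r n)) borel \<sigma>"
      by (intro distr_cong) (auto simp: s(4) norm_\<sigma>)
    finally show ?thesis .
  qed
  have hlim: "(\<lambda>n. h (Y' n \<omega>)) \<longlonglongrightarrow> h (Y \<omega>)" if "\<omega> \<in> space \<Omega>" for \<omega>
    using continuous_on_tendsto_compose[OF h lim[OF that]] by simp
  have "(\<integral>\<^sup>+\<omega>. W (h (Y \<omega>)) \<partial>\<Omega>) \<le> (\<integral>\<^sup>+\<omega>. liminf (\<lambda>n. W (h (Y' n \<omega>))) \<partial>\<Omega>)"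
    by (intro nn_integral_mono liminf_ge_of_closed_sublevels W_closed hlim) auto
  also have "\<dots> \<le> liminf (\<lambda>n. \<integral>\<^sup>+\<omega>. W (h (Y' n \<omega>)) \<partial>\<Omega>)"
    by (intro nn_integral_liminf) measurable
  also have "\<dots> \<le> liminf (\<lambda>n. M)"
  proof (intro Liminf_mono always_eventually allI)
    fix n
    have "(\<integral>\<^sup>+\<omega>. W (h (Y' n \<omega>)) \<partial>\<Omega>) = (\<integral>\<^sup>+y. W y \<partial>distr \<Omega> borel (\<lambda>\<omega>. h (Y' n \<omega>)))"
      by (subst nn_integral_distr) auto
    also have "\<dots> = (\<integral>\<^sup>+x. V x \<partial>\<mu> (r n))"
      unfolding law by (subst nn_integral_distr) (auto simp: W_def norm_\<sigma> \<tau>\<sigma>)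
    finally show "(\<integral>\<^sup>+\<omega>. W (h (Y' n \<omega>)) \<partial>\<Omega>) \<le> M" using M(2) by simp
  qed
  also have "\<dots> = M" by (simp add: Liminf_const)
  finally have "(\<integral>\<^sup>+\<omega>. W (h (Y \<omega>)) \<partial>\<Omega>) \<noteq> \<infinity>" using M(1) by auto
  then have "AE \<omega> in \<Omega>. W (h (Y \<omega>)) \<noteq> \<infinity>"
    by (intro nn_integral_PInf_AE) measurable
  then have "AE \<omega> in \<Omega>. (\<lambda>n. \<tau> (h (Y' n \<omega>))) \<longlonglongrightarrow> \<tau> (h (Y \<omega>))"
    by (rule AE_mp) (auto intro!: AE_I2 \<tau>_lim hlim simp: W_def split: if_splits)
  moreover have "distr \<Omega> borel (\<lambda>\<omega>. \<tau> (h (Y' n \<omega>))) = \<mu> (r n)" for n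
  proof -
    have "distr \<Omega> borel (\<lambda>\<omega>. \<tau> (h (Y' n \<omega>))) = distr (distr \<Omega> borel (\<lambda>\<omega>. h (Y' n \<omega>))) borel \<tau>"
      by (subst distr_distr) (auto simp: comp_def)
    also have "\<dots> = distr (\<mu> (r n)) borel (\<lambda>x. \<tau> (\<sigma> x))"
      unfolding law by (subst distr_distr) (auto simp: comp_def)
    also have "\<dots> = \<mu> (r n)"
      unfolding \<tau>\<sigma> using distr_id2[OF sets[symmetric]] by (simp add: id_def)
    finally show ?thesis .
  qed
  ultimately show ?thesis using r(1) \<Omega> by (intro that[of r \<Omega> "\<lambda>n \<omega>. \<tau> (h (Y' n \<omega>))" "\<lambda>\<omega>. \<tau> (h (Y \<omega>))"]) auto
qed

section \<open>Extended-real-valued expectations\<close>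

lemma e2ennreal_ereal [simp]: "e2ennreal (ereal x) = ennreal x"
  by (simp add: ennreal.abs_eq e2ennreal_def max_def sup_ereal_def)

text \<open>The positive and negative parts of \<open>x + K\<close> differ by \<open>x + K\<close>.
  Written without subtraction, the identity survives infinite values and can be integrated term by
  term.\<close>

lemma e2ennreal_shift:
  assumes "0 \<le> K"
  shows "e2ennreal (x + ereal K) + e2ennreal (- x) = e2ennreal x + ennreal K + e2ennreal (- x - ereal K)"
proof (cases x)
  case (real r)
  consider "r \<ge> 0" | "r < 0" "r + K \<ge> 0" | "r < 0" "r + K < 0" by linarith
  then show ?thesis
    using assms by cases (auto simp: real ennreal_neg ennreal_plus[symmetric] simp del: ennreal_plus)
qed (auto simp: e2ennreal_neg)

text \<open>Additivity of positive minus negative part, again with all subtractions moved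
  across.\<close>

lemma e2ennreal_add:
  "e2ennreal (x + y) + e2ennreal (- x) + e2ennreal (- y) = e2ennreal (- (x + y)) + e2ennreal x + e2ennreal y"
proof (cases x; cases y)
  fix r s assume [simp]: "x = ereal r" "y = ereal s"
  show ?thesis
    by (cases "r \<ge> 0"; cases "s \<ge> 0"; cases "r + s \<ge> 0")
      (auto simp: ennreal_neg ennreal_plus[symmetric] simp del: ennreal_plus)
qed (auto simp: e2ennreal_neg)

lemma ennreal_add_le: "ennreal (a + b) \<le> ennreal a + ennreal b"
  by (cases "0 \<le> a"; cases "0 \<le> b") (auto simp: ennreal_neg intro!: ennreal_leI)

lemma e2ennreal_uminus_add_le: "e2ennreal (- (x + y)) \<le> e2ennreal (- x) + e2ennreal (- y)"
proof (cases x; cases y)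
  fix r s assume "x = ereal r" "y = ereal s"
  then show ?thesis using ennreal_add_le[of "- r" "- s"] by simp
qed (auto simp: e2ennreal_neg)

lemma e2ennreal_mult:
  assumes "0 < u"
  shows "e2ennreal (ereal u * x) = ennreal u * e2ennreal x"
proof (cases x)
  case (real r)
  then show ?thesis
    using assms by (cases "0 \<le> r") (auto simp: ennreal_mult ennreal_neg mult_nonneg_nonpos)
qed (use assms in \<open>auto simp: ennreal_mult_top e2ennreal_neg\<close>)

abbreviation pos_int :: "'a measure \<Rightarrow> ('a \<Rightarrow> ereal) \<Rightarrow> ennreal" where
  "pos_int M f \<equiv> \<integral>\<^sup>+x. e2ennreal (f x) \<partial>M"

abbreviation neg_int :: "'a measure \<Rightarrow> ('a \<Rightarrow> ereal) \<Rightarrow> ennreal" where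
  "neg_int M f \<equiv> \<integral>\<^sup>+x. e2ennreal (- f x) \<partial>M"

lemma expect_mono:
  assumes "\<And>x. x \<in> space M \<Longrightarrow> f x \<le> g x"
  shows "expect M f \<le> expect M g"
proof -
  have "pos_int M f \<le> pos_int M g" "neg_int M g \<le> neg_int M f"
    using assms by (intro nn_integral_mono e2ennreal_mono; simp)+
  then show ?thesis
    unfolding expect_def less_eq_ennreal.rep_eq by (rule ereal_minus_mono)
qed

lemma expect_not_MInfty:
  assumes "neg_int M f < \<infinity>"
  shows "expect M f \<noteq> -\<infinity>"
  using assms unfolding expect_def
  by (cases "neg_int M f"; cases "pos_int M f") auto

text \<open>The convention \<open>\<infinity> - \<infinity> = \<infinity>\<close> is not symmetric
  under a change of sign; a finite positive part excludes this case.\<close>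

lemma expect_uminus:
  assumes "pos_int M f < \<infinity>"
  shows "expect M (\<lambda>x. - f x) = - expect M f"
  using assms unfolding expect_def
  by (cases "neg_int M f"; cases "pos_int M f") auto

text \<open>The integrated form of \<open>e2ennreal_add\<close> is solved for the expectations;
  finite negative parts are what makes cancelling them legitimate.\<close>

lemma expect_add:
  assumes [measurable]: "f \<in> borel_measurable M" "g \<in> borel_measurable M"
    and "neg_int M f < \<infinity>" "neg_int M g < \<infinity>"
  shows "expect M (\<lambda>x. f x + g x) = expect M f + expect M g"
proof -
  have eq: "pos_int M (\<lambda>x. f x + g x) + neg_int M f + neg_int M g =
      neg_int M (\<lambda>x. f x + g x) + pos_int M f + pos_int M g"
    by (simp add: nn_integral_add[symmetric] e2ennreal_add)
  have "e2ennreal (- (f x + g x)) \<le> e2ennreal (- f x) + e2ennreal (- g x)" for x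
    by (rule e2ennreal_uminus_add_le)
  then have "neg_int M (\<lambda>x. f x + g x) \<le> neg_int M f + neg_int M g"
    by (subst nn_integral_add[symmetric]) (auto intro!: nn_integral_mono)
  also have "\<dots> < \<infinity>" using assms by simp
  finally have fin: "neg_int M (\<lambda>x. f x + g x) < \<infinity>" .
  show ?thesis
    using eq fin assms(3,4) unfolding expect_def
    apply (cases "neg_int M f"; cases "neg_int M g"; cases "neg_int M (\<lambda>x. f x + g x)";
        cases "pos_int M f"; cases "pos_int M g"; cases "pos_int M (\<lambda>x. f x + g x)")
    by (auto simp: ennreal_plus[symmetric] simp del: ennreal_plus)
qed

lemma expect_cmult:
  assumes [measurable]: "f \<in> borel_measurable M" and "0 < u"
  shows "expect M (\<lambda>x. ereal u * f x) = ereal u * expect M f"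
proof -
  have "pos_int M (\<lambda>x. ereal u * f x) = ennreal u * pos_int M f"
    using assms(2) by (simp add: e2ennreal_mult nn_integral_cmult)
  moreover have "neg_int M (\<lambda>x. ereal u * f x) = ennreal u * neg_int M f"
    using assms(2) e2ennreal_mult[OF assms(2), of "- f x" for x] by (simp add: nn_integral_cmult)
  ultimately show ?thesis
    using assms(2) unfolding expect_def
    by (cases "neg_int M f"; cases "pos_int M f")
      (auto simp: ennreal_mult[symmetric] ennreal_mult_top algebra_simps)
qed

lemma neg_int_cmult_finite:
  assumes [measurable]: "f \<in> borel_measurable M" and "0 < u" "neg_int M f < \<infinity>"
  shows "neg_int M (\<lambda>x. ereal u * f x) < \<infinity>"
  using assms(3) e2ennreal_mult[OF assms(2), of "- f x" for x]
  by (simp add: nn_integral_cmult ennreal_mult_less_top)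

lemma expect_combination:
  assumes [measurable]: "f \<in> borel_measurable M" "g \<in> borel_measurable M"
    and "neg_int M f < \<infinity>" "neg_int M g < \<infinity>" "0 < u" "0 < v"
  shows "expect M (\<lambda>x. ereal u * f x + ereal v * g x) = ereal u * expect M f + ereal v * expect M g"
  by (subst expect_add; (intro neg_int_cmult_finite assms borel_measurable_ereal_times borel_measurable_const)?)
    (simp add: expect_cmult assms)

section \<open>Expectations compared through integrands raised by a constant and cut at 0\<close>

lemma integral_shift:
  assumes "prob_space M" and [measurable]: "f \<in> borel_measurable M" and "0 \<le> K"
  shows "(\<integral>\<^sup>+x. e2ennreal (f x + ereal K) \<partial>M) + neg_int M f =
    pos_int M f + ennreal K + (\<integral>\<^sup>+x. e2ennreal (- f x - ereal K) \<partial>M)"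
proof -
  interpret prob_space M by fact
  have "(\<integral>\<^sup>+x. e2ennreal (f x + ereal K) \<partial>M) + neg_int M f =
      (\<integral>\<^sup>+x. e2ennreal (f x) + ennreal K + e2ennreal (- f x - ereal K) \<partial>M)"
    using assms(3) by (simp add: nn_integral_add[symmetric] e2ennreal_shift)
  also have "\<dots> = pos_int M f + ennreal K + (\<integral>\<^sup>+x. e2ennreal (- f x - ereal K) \<partial>M)"
    by (simp add: nn_integral_add emeasure_space_1)
  finally show ?thesis .
qed

text \<open>Converts a bound on an expectation into one on a nonnegative integrand, to which Fatou's
  lemma applies. The error term is the tail of \<open>f\<close> below \<open>- K\<close>.\<close>

lemma expect_le_trunc:
  assumes "prob_space M" "f \<in> borel_measurable M" "0 \<le> K" "0 \<le> a + K"
    and "neg_int M f < \<infinity>" "expect M f \<le> ereal a"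
  shows "(\<integral>\<^sup>+x. e2ennreal (f x + ereal K) \<partial>M) \<le> ennreal (a + K) + (\<integral>\<^sup>+x. e2ennreal (- f x - ereal K) \<partial>M)"
proof -
  obtain n where n: "neg_int M f = ennreal n" "0 \<le> n"
    using assms(5) by (cases "neg_int M f") auto
  obtain p where p: "pos_int M f = ennreal p" "0 \<le> p"
    using assms(6) n unfolding expect_def by (cases "pos_int M f") auto
  have "p + K \<le> a + K + n" using assms(6) n p unfolding expect_def by simp
  then have "ennreal p + ennreal K \<le> ennreal (a + K) + ennreal n"
    using n p assms(3,4) by (simp add: ennreal_plus[symmetric] ennreal_leI del: ennreal_plus)
  then have "(\<integral>\<^sup>+x. e2ennreal (f x + ereal K) \<partial>M) + ennreal n \<le>
      ennreal (a + K) + (\<integral>\<^sup>+x. e2ennreal (- f x - ereal K) \<partial>M) + ennreal n"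
    using integral_shift[OF assms(1-3)] n p
    by (simp add: add.assoc add.commute add.left_commute)
  then show ?thesis
    using ennreal_add_left_cancel_le[of "ennreal n"] by (simp add: add.commute)
qed

text \<open>The way back: by \<open>integral_shift\<close> the constant \<open>K\<close> cancels,
  and the error \<open>\<tau> K\<close> disappears as \<open>K\<close> grows.\<close>

lemma expect_le_of_trunc:
  fixes \<tau> :: "real \<Rightarrow> ennreal"
  assumes "prob_space M" "f \<in> borel_measurable M" "neg_int M f < \<infinity>"
    and tr: "\<And>K. 0 < K \<Longrightarrow> 0 \<le> a + K \<Longrightarrow> (\<integral>\<^sup>+x. e2ennreal (f x + ereal K) \<partial>M) \<le> ennreal (a + K) + \<tau> K"
    and \<tau>: "(\<tau> \<longlongrightarrow> 0) at_top"
  shows "expect M f \<le> ereal a"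
proof -
  obtain n where n: "neg_int M f = ennreal n" "0 \<le> n"
    using assms(3) by (cases "neg_int M f") auto
  have *: "\<exists>p\<ge>0. pos_int M f = ennreal p \<and> p \<le> a + n + e" if e: "e > 0" for e
  proof -
    have "\<forall>\<^sub>F K in at_top. \<tau> K < ennreal e" using e by (intro order_tendstoD(2)[OF \<tau>]) auto
    then have "\<forall>\<^sub>F K in at_top. \<tau> K < ennreal e \<and> K \<ge> 1 + \<bar>a\<bar>"
      by (intro eventually_conj eventually_ge_at_top)
    \<comment> \<open>Besides a small tail, \<open>K\<close> must make \<open>a + K\<close>
      nonnegative, since \<open>ennreal\<close> cuts negative numbers at 0.\<close>
    then obtain K where K: "\<tau> K < ennreal e" "K \<ge> 1 + \<bar>a\<bar>"
      unfolding eventually_at_top_linorder by blast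
    then have K': "0 < K" "0 \<le> K" "0 \<le> a + K" by auto
    have "pos_int M f + ennreal K \<le> (\<integral>\<^sup>+x. e2ennreal (f x + ereal K) \<partial>M) + neg_int M f"
      unfolding integral_shift[OF assms(1,2) K'(2)] by simp
    also have "\<dots> \<le> ennreal (a + K) + ennreal e + ennreal n"
      using tr[OF K'(1,3)] K(1) n by (auto intro!: add_right_mono order_trans[OF tr[OF K'(1,3)]] add_left_mono)
    finally have *: "pos_int M f + ennreal K \<le> ennreal (a + K + e + n)"
      using n K' e by (simp add: ennreal_plus[symmetric] del: ennreal_plus)
    then obtain p where p: "pos_int M f = ennreal p" "0 \<le> p"
      by (cases "pos_int M f") (auto simp: top_unique)
    with * have "ennreal (p + K) \<le> ennreal (a + K + e + n)"
      using K' by simp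
    then have "p + K \<le> a + K + e + n"
      using n K' e by (subst (asm) ennreal_le_iff) auto
    then show ?thesis using p by auto
  qed
  obtain p where p: "0 \<le> p" "pos_int M f = ennreal p" using *[of 1] by auto
  have "p \<le> a + n"
  proof (rule field_le_epsilon)
    fix e :: real assume "e > 0"
    from *[OF this] show "p \<le> a + n + e" using p by auto
  qed
  then show ?thesis using p n by (simp add: expect_def)
qed

text \<open>Integrand and measure vary together so that one statement serves twice: for a fixed
  distribution and converging decisions, and for a fixed decision and converging
  distributions.\<close>

lemma expect_le_limit:
  fixes \<tau> :: "real \<Rightarrow> ennreal"
  assumes M: "prob_space M" "f \<in> borel_measurable M" "neg_int M f < \<infinity>"
    and N: "\<And>n. prob_space (N n)" "\<And>n. g n \<in> borel_measurable (N n)" "\<And>n. neg_int (N n) (g n) < \<infinity>"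
    and le: "\<And>n. expect (N n) (g n) \<le> ereal a"
    and lim: "\<And>K. 0 < K \<Longrightarrow> (\<integral>\<^sup>+x. e2ennreal (f x + ereal K) \<partial>M)
        \<le> liminf (\<lambda>n. \<integral>\<^sup>+x. e2ennreal (g n x + ereal K) \<partial>N n)"
    and tail: "\<And>K n. 0 < K \<Longrightarrow> (\<integral>\<^sup>+x. e2ennreal (- g n x - ereal K) \<partial>N n) \<le> \<tau> K"
    and \<tau>: "(\<tau> \<longlongrightarrow> 0) at_top"
  shows "expect M f \<le> ereal a"
proof (rule expect_le_of_trunc[OF M _ \<tau>])
  fix K :: real assume K: "0 < K" "0 \<le> a + K"
  note lim[OF K(1)]
  also have "liminf (\<lambda>n. \<integral>\<^sup>+x. e2ennreal (g n x + ereal K) \<partial>N n) \<le> ennreal (a + K) + \<tau> K"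
  proof (intro Liminf_le always_eventually allI)
    fix n
    have "(\<integral>\<^sup>+x. e2ennreal (g n x + ereal K) \<partial>N n) \<le>
        ennreal (a + K) + (\<integral>\<^sup>+x. e2ennreal (- g n x - ereal K) \<partial>N n)"
      using K by (intro expect_le_trunc N le) auto
    also have "\<dots> \<le> ennreal (a + K) + \<tau> K" by (intro add_left_mono tail K)
    finally show "(\<integral>\<^sup>+x. e2ennreal (g n x + ereal K) \<partial>N n) \<le> ennreal (a + K) + \<tau> K" .
  qed auto
  finally show "(\<integral>\<^sup>+x. e2ennreal (f x + ereal K) \<partial>M) \<le> ennreal (a + K) + \<tau> K" .
qed

section \<open>Mixtures of measures\<close>

text \<open>The convex combination \<open>u * M + (1 - u) * N\<close>, realized as the law after the
  toss of a biased coin; the integral formula is then that of the monadic bind.\<close>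

definition mix :: "real \<Rightarrow> 'a measure \<Rightarrow> 'a measure \<Rightarrow> 'a measure" where
  "mix u M N = measure_pmf (bernoulli_pmf u) \<bind> (\<lambda>b. if b then M else N)"

context
  fixes M N :: "'a measure" and u :: real
  assumes prob: "prob_space M" "prob_space N" and sets_eq: "sets N = sets M" and u: "0 < u" "u < 1"
begin

lemma mix_kernel_measurable:
  "(\<lambda>b. if b then M else N) \<in> measurable (measure_pmf p) (subprob_algebra M)"
  using prob sets_eq by (auto simp: space_subprob_algebra prob_space_imp_subprob_space)

lemma sets_mix: "sets (mix u M N) = sets M"
  unfolding mix_def by (rule sets_bind) (auto simp: sets_eq)

lemma space_mix: "space (mix u M N) = space M"
  by (rule sets_eq_imp_space_eq[OF sets_mix])

lemma nn_integral_mix: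
  assumes "f \<in> borel_measurable M"
  shows "(\<integral>\<^sup>+x. f x \<partial>mix u M N) = ennreal u * (\<integral>\<^sup>+x. f x \<partial>M) + ennreal (1 - u) * (\<integral>\<^sup>+x. f x \<partial>N)"
  unfolding mix_def using u
  by (subst nn_integral_bind[OF assms mix_kernel_measurable]) (simp add: mult.commute)

lemma emeasure_mix:
  assumes "A \<in> sets M"
  shows "emeasure (mix u M N) A = ennreal u * emeasure M A + ennreal (1 - u) * emeasure N A"
  using nn_integral_mix[of "indicator A"] assms sets_eq by (simp add: sets_mix)

lemma convex_weights_ennreal: "ennreal u * x + ennreal (1 - u) * x = x"
  using u by (simp add: distrib_right[symmetric] ennreal_plus[symmetric] del: ennreal_plus)

lemma prob_space_mix: "prob_space (mix u M N)"
proof (rule prob_spaceI)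
  have "emeasure N (space M) = 1"
    using prob_space.emeasure_space_1[OF prob(2)] sets_eq_imp_space_eq[OF sets_eq] by simp
  then show "emeasure (mix u M N) (space (mix u M N)) = 1"
    using emeasure_mix[of "space M"] prob_space.emeasure_space_1[OF prob(1)] convex_weights_ennreal[of 1]
    by (simp add: space_mix)
qed

end

text \<open>Marginals depend affinely on the joint law. Both second marginals are \<open>P\<close>,
  and the mixture of \<open>P\<close> with itself is \<open>P\<close>.\<close>

lemma coupling_mix:
  assumes "\<pi>\<^sub>1 \<in> couplings Q\<^sub>1 P" "\<pi>\<^sub>2 \<in> couplings Q\<^sub>2 P"
    and Q: "prob_space Q\<^sub>1" "prob_space Q\<^sub>2" "sets Q\<^sub>2 = sets Q\<^sub>1" and u: "0 < u" "u < 1"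
  shows "mix u \<pi>\<^sub>1 \<pi>\<^sub>2 \<in> couplings (mix u Q\<^sub>1 Q\<^sub>2) P"
proof -
  have p: "prob_space \<pi>\<^sub>1" "prob_space \<pi>\<^sub>2"
    and s1: "sets \<pi>\<^sub>1 = sets (Q\<^sub>1 \<Otimes>\<^sub>M P)" and s2: "sets \<pi>\<^sub>2 = sets (Q\<^sub>2 \<Otimes>\<^sub>M P)"
    and d: "distr \<pi>\<^sub>1 Q\<^sub>1 fst = Q\<^sub>1" "distr \<pi>\<^sub>2 Q\<^sub>2 fst = Q\<^sub>2" "distr \<pi>\<^sub>1 P snd = P" "distr \<pi>\<^sub>2 P snd = P"
    using assms(1,2) by (auto simp: couplings_def)
  note sets_pair_measure_cong[OF Q(3) refl, of P]
  with s1 s2 have s: "sets \<pi>\<^sub>2 = sets \<pi>\<^sub>1" by simp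
  note sp = space_mix[OF p s u] and sm = sets_mix[OF p s u]
  have sQ: "sets (mix u Q\<^sub>1 Q\<^sub>2) = sets Q\<^sub>1" by (rule sets_mix[OF Q u])
  have [measurable_cong]: "sets \<pi>\<^sub>1 = sets (Q\<^sub>1 \<Otimes>\<^sub>M P)" "sets \<pi>\<^sub>2 = sets (Q\<^sub>1 \<Otimes>\<^sub>M P)"
    "sets (mix u \<pi>\<^sub>1 \<pi>\<^sub>2) = sets (Q\<^sub>1 \<Otimes>\<^sub>M P)"
    using s1 s sm by auto
  have fst: "distr (mix u \<pi>\<^sub>1 \<pi>\<^sub>2) (mix u Q\<^sub>1 Q\<^sub>2) fst = mix u Q\<^sub>1 Q\<^sub>2"
  proof (rule measure_eqI)
    fix A assume "A \<in> sets (distr (mix u \<pi>\<^sub>1 \<pi>\<^sub>2) (mix u Q\<^sub>1 Q\<^sub>2) fst)"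
    then have A [measurable]: "A \<in> sets Q\<^sub>1" by (simp add: sQ)
    have 1: "fst \<in> measurable (mix u \<pi>\<^sub>1 \<pi>\<^sub>2) (mix u Q\<^sub>1 Q\<^sub>2)" "fst \<in> measurable \<pi>\<^sub>2 Q\<^sub>2"
      by (simp_all add: measurable_cong_sets[OF refl sQ] measurable_cong_sets[OF refl Q(3)])
    have "emeasure Q\<^sub>1 A = emeasure \<pi>\<^sub>1 (fst -` A \<inter> space \<pi>\<^sub>1)"
      by (subst d(1)[symmetric], subst emeasure_distr) auto
    moreover have "emeasure Q\<^sub>2 A = emeasure \<pi>\<^sub>2 (fst -` A \<inter> space \<pi>\<^sub>1)"
      using A Q(3) 1(2) by (subst d(2)[symmetric], subst emeasure_distr) (auto simp: sets_eq_imp_space_eq[OF s])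
    moreover have "fst -` A \<inter> space \<pi>\<^sub>1 \<in> sets \<pi>\<^sub>1"
      by measurable
    ultimately show "emeasure (distr (mix u \<pi>\<^sub>1 \<pi>\<^sub>2) (mix u Q\<^sub>1 Q\<^sub>2) fst) A = emeasure (mix u Q\<^sub>1 Q\<^sub>2) A"
      using A 1(1) by (subst emeasure_distr) (auto simp: sQ sp emeasure_mix[OF p s u] emeasure_mix[OF Q u])
  qed simp
  have snd: "distr (mix u \<pi>\<^sub>1 \<pi>\<^sub>2) P snd = P"
  proof (rule measure_eqI)
    fix A assume "A \<in> sets (distr (mix u \<pi>\<^sub>1 \<pi>\<^sub>2) P snd)"
    then have A [measurable]: "A \<in> sets P" by simp
    have "emeasure P A = emeasure \<pi>\<^sub>1 (snd -` A \<inter> space \<pi>\<^sub>1)"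
      by (subst d(3)[symmetric], subst emeasure_distr) auto
    moreover have "emeasure P A = emeasure \<pi>\<^sub>2 (snd -` A \<inter> space \<pi>\<^sub>1)"
      by (subst d(4)[symmetric], subst emeasure_distr) (auto simp: sets_eq_imp_space_eq[OF s])
    moreover have "snd -` A \<inter> space \<pi>\<^sub>1 \<in> sets \<pi>\<^sub>1"
      by measurable
    ultimately show "emeasure (distr (mix u \<pi>\<^sub>1 \<pi>\<^sub>2) P snd) A = emeasure P A"
      using convex_weights_ennreal[OF p s u, of "emeasure P A"]
      by (subst emeasure_distr) (auto simp: sp emeasure_mix[OF p s u])
  qed simp
  show ?thesis
    using prob_space_mix[OF p s u] sm s1 fst snd sets_pair_measure_cong[OF sQ refl, of P]
    by (simp add: couplings_def)
qed

section \<open>Functions that are lower semicontinuous on a closed set\<close>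

lemma lsc_on_closed_sublevel:
  assumes "closed S" "lsc_on S f"
  shows "closed {x \<in> S. f x \<le> a}"
proof -
  have "open (- {x \<in> S. f x \<le> a})"
  proof (subst open_subopen, rule ballI)
    fix x assume x: "x \<in> - {x \<in> S. f x \<le> a}"
    show "\<exists>T. open T \<and> x \<in> T \<and> T \<subseteq> - {x \<in> S. f x \<le> a}"
    proof (cases "x \<in> S")
      case False
      then show ?thesis using assms(1) by (intro exI[of _ "- S"]) auto
    next
      case True
      then have "\<forall>\<^sub>F y in at x within S. a < f y"
        using assms(2) x unfolding lsc_on_def le_Liminf_iff by auto
      then obtain T where "open T" "x \<in> T" "\<And>y. y \<in> T \<Longrightarrow> y \<noteq> x \<Longrightarrow> y \<in> S \<Longrightarrow> a < f y"
        unfolding eventually_at_topological by auto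
      \<comment> \<open>The filter in \<open>lsc_on\<close> says nothing about \<open>x\<close>
        itself, where \<open>a < f x\<close> holds by the choice of \<open>x\<close>.\<close>
      then show ?thesis using x True by (intro exI[of _ T]) (force simp: not_le)
    qed
  qed
  then show ?thesis by (simp add: closed_def)
qed

text \<open>The value \<open>\<infinity>\<close> off the closed set keeps finite sublevel sets
  closed. Semicontinuity relative to \<open>S\<close> thus becomes semicontinuity on the whole
  space, where the limiting random vectors live.\<close>

definition extend_top :: "'a set \<Rightarrow> ('a \<Rightarrow> ennreal) \<Rightarrow> 'a \<Rightarrow> ennreal" where
  "extend_top S f x = (if x \<in> S then f x else \<infinity>)"

lemma closed_sublevel_extend_top:
  assumes "closed S" "lsc_on S f" "a < \<infinity>"
  shows "closed {x. extend_top S f x \<le> a}"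
proof -
  have "{x. extend_top S f x \<le> a} = {x \<in> S. f x \<le> a}"
    using assms(3) by (auto simp: extend_top_def top_unique)
  then show ?thesis using lsc_on_closed_sublevel[OF assms(1,2)] by simp
qed

lemma borel_measurable_extend_top:
  assumes "closed S" "lsc_on S f"
  shows "extend_top S f \<in> borel_measurable borel"
  using closed_sublevel_extend_top[OF assms] by (rule lsc_borel_measurable)

lemma lsc_on_borel_measurable_restrict:
  fixes f :: "'a::topological_space \<Rightarrow> ennreal"
  assumes "closed S" "lsc_on S f"
  shows "f \<in> borel_measurable (restrict_space borel S)"
proof -
  have "extend_top S f \<in> borel_measurable (restrict_space borel S)"
    by (intro measurable_restrict_space1 borel_measurable_extend_top assms)
  then show ?thesis
    by (subst (asm) measurable_cong[of _ _ f]) (auto simp: extend_top_def space_restrict_space)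
qed

text \<open>Second countability enters here, through the agreement of the product of Borel algebras
  with the Borel algebra of the product.\<close>

lemma measurable_restrict_pair_borel:
  "(\<lambda>w. w) \<in> measurable (restrict_space borel Z \<Otimes>\<^sub>M restrict_space borel Z)
     (borel :: ('a::second_countable_topology \<times> 'a) measure)"
proof -
  have "(\<lambda>w. (fst w, snd w)) \<in> measurable (restrict_space borel Z \<Otimes>\<^sub>M restrict_space borel Z)
     (borel \<Otimes>\<^sub>M (borel :: 'a measure))"
    by (intro measurable_Pair measurable_compose[OF measurable_fst] measurable_compose[OF measurable_snd]
        measurable_restrict_space1) auto
  then show ?thesis by (simp add: borel_prod)
qed

lemma cost_measurable:
  fixes c :: "'a::euclidean_space \<Rightarrow> 'a \<Rightarrow> ennreal"
  assumes "closed Z" "lsc_on (Z \<times> Z) (\<lambda>(z, z'). c z z')"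
  shows "(\<lambda>w. c (fst w) (snd w)) \<in> borel_measurable (restrict_space borel Z \<Otimes>\<^sub>M restrict_space borel Z)"
proof -
  have "(\<lambda>w. extend_top (Z \<times> Z) (\<lambda>(z, z'). c z z') w)
      \<in> borel_measurable (restrict_space borel Z \<Otimes>\<^sub>M restrict_space borel Z)"
    by (rule measurable_compose[OF measurable_restrict_pair_borel borel_measurable_extend_top])
      (use assms in \<open>auto intro: closed_Times\<close>)
  then show ?thesis
    by (rule measurable_cong[THEN iffD1, rotated])
      (auto simp: extend_top_def space_pair_measure space_restrict_space)
qed

section \<open>Convexity of the ambiguity set\<close>

lemma ot_ball_approx_coupling:
  assumes "Q \<in> ot_ball c Z P \<epsilon>" "0 \<le> \<epsilon>" "0 < e"
  obtains \<pi> where "\<pi> \<in> couplings Q P" "(\<integral>\<^sup>+w. c (fst w) (snd w) \<partial>\<pi>) \<le> ennreal (\<epsilon> + e)"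
proof -
  have "ot_discrepancy c Q P \<le> ennreal \<epsilon>" using assms(1) by (simp add: ot_ball_def)
  \<comment> \<open>The discrepancy is an infimum whose attainment is not known here, hence the
    slack \<open>e\<close>.\<close>
  also have "\<dots> < ennreal (\<epsilon> + e)" using assms by (simp add: ennreal_less_iff)
  finally show ?thesis
    using that unfolding ot_discrepancy_def INF_less_iff by (auto intro: less_imp_le)
qed

text \<open>The mixture of two nearly optimal couplings is a coupling of the mixture with the
  averaged cost; the slack is removed at the end.\<close>

lemma ot_ball_mix:
  fixes c :: "'a::euclidean_space \<Rightarrow> 'a \<Rightarrow> ennreal"
  assumes Z: "closed Z" "lsc_on (Z \<times> Z) (\<lambda>(z, z'). c z z')" and P: "P \<in> prob_dists Z" and e: "0 \<le> \<epsilon>"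
    and Q: "Q\<^sub>1 \<in> ot_ball c Z P \<epsilon>" "Q\<^sub>2 \<in> ot_ball c Z P \<epsilon>" and u: "0 < u" "u < 1"
  shows "mix u Q\<^sub>1 Q\<^sub>2 \<in> ot_ball c Z P \<epsilon>"
proof -
  have p: "prob_space Q\<^sub>1" "prob_space Q\<^sub>2" "sets Q\<^sub>2 = sets Q\<^sub>1" and s1: "sets Q\<^sub>1 = sets (restrict_space borel Z)"
    and sP: "sets P = sets (restrict_space borel Z)"
    using Q P by (auto simp: ot_ball_def prob_dists_def)
  have "ot_discrepancy c (mix u Q\<^sub>1 Q\<^sub>2) P \<le> ennreal \<epsilon>"
  proof (rule ennreal_le_epsilon)
    fix e :: real assume "0 < e"
    obtain \<pi>\<^sub>1 where 1: "\<pi>\<^sub>1 \<in> couplings Q\<^sub>1 P" "(\<integral>\<^sup>+w. c (fst w) (snd w) \<partial>\<pi>\<^sub>1) \<le> ennreal (\<epsilon> + e)"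
      using ot_ball_approx_coupling[OF Q(1) \<open>0 \<le> \<epsilon>\<close> \<open>0 < e\<close>] .
    obtain \<pi>\<^sub>2 where 2: "\<pi>\<^sub>2 \<in> couplings Q\<^sub>2 P" "(\<integral>\<^sup>+w. c (fst w) (snd w) \<partial>\<pi>\<^sub>2) \<le> ennreal (\<epsilon> + e)"
      using ot_ball_approx_coupling[OF Q(2) \<open>0 \<le> \<epsilon>\<close> \<open>0 < e\<close>] .
    have pp: "prob_space \<pi>\<^sub>1" "prob_space \<pi>\<^sub>2"
      using 1(1) 2(1) by (auto simp: couplings_def)
    have s\<pi>: "sets \<pi>\<^sub>1 = sets (restrict_space borel Z \<Otimes>\<^sub>M restrict_space borel Z)"
      using 1(1) sets_pair_measure_cong[OF s1 sP] by (auto simp: couplings_def)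
    have s: "sets \<pi>\<^sub>2 = sets \<pi>\<^sub>1"
      using 1(1) 2(1) sets_pair_measure_cong[OF p(3) refl, of P] by (auto simp: couplings_def)
    have "(\<lambda>w. c (fst w) (snd w)) \<in> borel_measurable \<pi>\<^sub>1"
      using cost_measurable[OF Z] measurable_cong_sets[OF s\<pi> refl] by blast
    note nn_integral_mix[OF pp s u this]
    also have "ennreal u * (\<integral>\<^sup>+w. c (fst w) (snd w) \<partial>\<pi>\<^sub>1) + ennreal (1 - u) * (\<integral>\<^sup>+w. c (fst w) (snd w) \<partial>\<pi>\<^sub>2)
        \<le> ennreal u * ennreal (\<epsilon> + e) + ennreal (1 - u) * ennreal (\<epsilon> + e)"
      by (intro add_mono mult_left_mono 1 2) auto
    also have "\<dots> = ennreal \<epsilon> + ennreal e"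
      using \<open>0 < e\<close> \<open>0 \<le> \<epsilon>\<close> unfolding convex_weights_ennreal[OF pp s u] by simp
    finally have "(\<integral>\<^sup>+w. c (fst w) (snd w) \<partial>mix u \<pi>\<^sub>1 \<pi>\<^sub>2) \<le> ennreal \<epsilon> + ennreal e" .
    then show "ot_discrepancy c (mix u Q\<^sub>1 Q\<^sub>2) P \<le> ennreal \<epsilon> + ennreal e"
      unfolding ot_discrepancy_def by (rule INF_lower2[OF coupling_mix[OF 1(1) 2(1) p u]])
  qed
  then show ?thesis
    using prob_space_mix[OF p u] sets_mix[OF p u] s1 by (simp add: ot_ball_def prob_dists_def)
qed

section \<open>Convergence of measures tested on lower semicontinuous functions\<close>

text \<open>Weak convergence in portmanteau form. With \<open>[0, \<infinity>]\<close>-valued test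
  functions that need not be bounded, it is what Fatou's lemma delivers and what the raised and cut
  integrands consume.\<close>

definition wconv :: "'a::topological_space set \<Rightarrow> (nat \<Rightarrow> 'a measure) \<Rightarrow> 'a measure \<Rightarrow> bool" where
  "wconv Z Qs Q \<longleftrightarrow> (\<forall>\<phi>::'a \<Rightarrow> ennreal. lsc_on Z \<phi> \<longrightarrow> (\<integral>\<^sup>+z. \<phi> z \<partial>Q) \<le> liminf (\<lambda>n. \<integral>\<^sup>+z. \<phi> z \<partial>Qs n))"

lemma lsc_on_continuous:
  fixes f :: "'a::topological_space \<Rightarrow> real"
  assumes "continuous_on UNIV f"
  shows "lsc_on Z (\<lambda>x. ennreal (f x))"
  unfolding lsc_on_def le_Liminf_iff
proof (intro ballI allI impI)
  fix x y assume "x \<in> Z" "y < ennreal (f x)"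
  moreover have "((\<lambda>x. ennreal (f x)) \<longlongrightarrow> ennreal (f x)) (at x within Z)"
    using assms by (intro tendsto_ennrealI) (meson continuous_on_def continuous_on_subset subset_UNIV UNIV_I tendsto_within_subset)
  ultimately show "\<forall>\<^sub>F x in at x within Z. y < ennreal (f x)" by (simp add: order_tendstoD)
qed

text \<open>Finite intersections of basic open sets form a countable intersection-stable generator,
  and the indicator of each is an increasing limit of continuous functions built from the distance
  to the complement.\<close>

lemma determining_sequence:
  obtains \<psi> :: "nat \<Rightarrow> 'a::euclidean_space \<Rightarrow> real"
  where "\<And>k. continuous_on UNIV (\<psi> k)" "\<And>k x. 0 \<le> \<psi> k x" "\<And>k x. \<psi> k x \<le> 1"
    "\<And>M N. \<lbrakk>prob_space M; prob_space N; sets M = sets borel; sets N = sets borel;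
      \<And>k. (\<integral>\<^sup>+x. ennreal (\<psi> k x) \<partial>M) = (\<integral>\<^sup>+x. ennreal (\<psi> k x) \<partial>N)\<rbrakk> \<Longrightarrow> M = N"
proof -
  obtain B :: "'a set set" where B: "countable B" "topological_basis B"
    using ex_countable_basis by blast
  \<comment> \<open>The empty family contributes the whole space, which the generator has to
    contain.\<close>
  define U where "U = (\<lambda>F. \<Inter>F) ` {F. finite F \<and> F \<subseteq> B}"
  have U_open: "open V" if "V \<in> U" for V
    using that topological_basis_open[OF B(2)] by (auto simp: U_def intro!: open_Inter)
  have U_count: "countable U"
    unfolding U_def by (intro countable_image countable_Collect_finite_subset B)
  have U_UNIV: "UNIV \<in> U" by (auto simp: U_def intro: image_eqI[of _ _ "{}"])
  have U_Int: "Int_stable U"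
  proof (rule Int_stableI)
    fix V W assume "V \<in> U" "W \<in> U"
    then obtain F G where "F \<subseteq> B" "finite F" "V = \<Inter>F" "G \<subseteq> B" "finite G" "W = \<Inter>G" by (auto simp: U_def)
    then show "V \<inter> W \<in> U" by (auto simp: U_def intro!: image_eqI[of _ _ "F \<union> G"])
  qed
  have U_basis: "topological_basis U"
  proof (rule topological_basisI)
    fix O' :: "'a set" and x assume "open O'" "x \<in> O'"
    then obtain V where "V \<in> B" "x \<in> V" "V \<subseteq> O'" using topological_basisE[OF B(2)] by metis
    moreover have "V \<in> U" using \<open>V \<in> B\<close> by (auto simp: U_def intro!: image_eqI[of _ _ "{V}"])
    ultimately show "\<exists>B'\<in>U. x \<in> B' \<and> B' \<subseteq> O'" by auto
  qed (rule U_open)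
  text \<open>The case distinction is needed because \<open>infdist x {} = 0\<close>.\<close>
  define f where "f V j x = (if V = UNIV then 1 else min 1 (real j * infdist x (- V)))" for V :: "'a set" and j x
  have f_cont: "continuous_on UNIV (f V j)" for V j
    unfolding f_def by (cases "V = UNIV") (auto intro!: continuous_intros)
  have f_bounds: "0 \<le> f V j x" "f V j x \<le> 1" for V j x
    by (auto simp: f_def infdist_nonneg)
  define I where "I = U \<times> (UNIV :: nat set)"
  have I: "countable I" "I \<noteq> {}" using U_count U_UNIV by (auto simp: I_def)
  define \<psi> where "\<psi> k = (case from_nat_into I k of (V, j) \<Rightarrow> f V j)" for k
  have \<psi>_surj: "\<exists>k. \<psi> k = f V j" if "V \<in> U" for V j
  proof -
    have "(V, j) \<in> I" using that by (simp add: I_def)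
    then obtain k where "from_nat_into I k = (V, j)" using from_nat_into_surj[OF I(1)] by blast
    then show ?thesis by (intro exI[of _ k]) (simp add: \<psi>_def)
  qed
  have eq: "M = N" if M: "prob_space M" "prob_space N" "sets M = sets borel" "sets N = sets borel"
    and int: "\<And>k. (\<integral>\<^sup>+x. ennreal (\<psi> k x) \<partial>M) = (\<integral>\<^sup>+x. ennreal (\<psi> k x) \<partial>N)" for M N
  proof (rule measure_eqI_generator_eq[OF U_Int, of UNIV])
    have "sets (borel :: 'a measure) = sigma_sets UNIV U"
      unfolding borel_eq_countable_basis[OF U_count U_basis] by simp
    then show "sets M = sigma_sets UNIV U" "sets N = sigma_sets UNIV U" using M by auto
    show "range (\<lambda>_. UNIV) \<subseteq> U" using U_UNIV by auto
    show "emeasure M UNIV \<noteq> \<infinity>" for i :: nat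
      using prob_space.emeasure_space_1[OF M(1)] sets_eq_imp_space_eq[OF M(3)] by simp
    show "emeasure M V = emeasure N V" if V: "V \<in> U" for V
    proof -
      have lim: "(\<lambda>j. \<integral>\<^sup>+x. ennreal (f V j x) \<partial>K) \<longlonglongrightarrow> emeasure K V" if K: "sets K = sets borel" for K :: "'a measure"
      proof -
        have "(\<lambda>j. \<integral>\<^sup>+x. ennreal (f V j x) \<partial>K) \<longlonglongrightarrow> (\<integral>\<^sup>+x. indicator V x \<partial>K)"
        proof (rule nn_integral_LIMSEQ)
          show "incseq (\<lambda>j x. ennreal (f V j x))"
          proof (intro incseq_SucI le_funI ennreal_leI)
            fix j x
            have "real j * infdist x (- V) \<le> real (Suc j) * infdist x (- V)"
              by (intro mult_right_mono) (auto simp: infdist_nonneg)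
            then show "f V j x \<le> f V (Suc j) x" unfolding f_def by (auto intro: min.mono)
          qed
          show "(\<lambda>x. ennreal (f V j x)) \<in> borel_measurable K" for j
            using borel_measurable_continuous_onI[OF f_cont] measurable_cong_sets[OF K refl]
            by (intro measurable_compose[OF _ measurable_ennreal]) blast
          show "(\<lambda>j. ennreal (f V j x)) \<longlonglongrightarrow> indicator V x" for x
          proof (cases "V = UNIV \<or> x \<notin> V")
            case True
            then have "f V j x = indicator V x" for j by (cases "V = UNIV") (simp_all add: f_def)
            then show ?thesis by (simp add: ennreal_indicator)
          next
            case False
            then have "0 < infdist x (- V)"
              using U_open[OF V] infdist_pos_not_in_closed[of "- V" x] by auto
            then obtain j0 :: nat where j0: "real j0 * infdist x (- V) > 1"
              using reals_Archimedean3 by blast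
            have "f V j x = 1" if "j \<ge> j0" for j
            proof -
              have "real j0 * infdist x (- V) \<le> real j * infdist x (- V)"
                using that by (intro mult_right_mono) (auto simp: infdist_nonneg)
              then show ?thesis using j0 by (simp add: f_def)
            qed
            then have "\<forall>\<^sub>F j in sequentially. ennreal (f V j x) = indicator V x"
              using False by (auto simp: eventually_sequentially)
            then show ?thesis by (rule tendsto_eventually)
          qed
        qed
        then show ?thesis using U_open[OF V] K by simp
      qed
      have "(\<lambda>j. \<integral>\<^sup>+x. ennreal (f V j x) \<partial>M) = (\<lambda>j. \<integral>\<^sup>+x. ennreal (f V j x) \<partial>N)"
        using \<psi>_surj[OF V] int by metis
      then show ?thesis
        using lim[OF M(3)] lim[OF M(4)] LIMSEQ_unique by metis
    qed
  qed auto
  show ?thesis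
  proof (rule that[of \<psi>])
    show "continuous_on UNIV (\<psi> k)" for k
      unfolding \<psi>_def by (auto split: prod.split intro: f_cont)
    show "0 \<le> \<psi> k x" "\<psi> k x \<le> 1" for k x
      unfolding \<psi>_def by (auto split: prod.split intro: f_bounds)
  qed (rule eq)
qed

lemma sets_prob_dists_iff:
  assumes "Q \<in> prob_dists Z" "closed Z"
  shows "A \<in> sets Q \<longleftrightarrow> A \<subseteq> Z \<and> A \<in> sets borel"
  using assms by (simp add: prob_dists_def sets_restrict_space_iff)

lemma space_prob_dists: "Q \<in> prob_dists Z \<Longrightarrow> space Q = Z"
  by (auto simp: prob_dists_def space_restrict_space dest: sets_eq_imp_space_eq)

lemma measurable_prob_dists:
  assumes "Q \<in> prob_dists Z" "f \<in> measurable (restrict_space borel Z) N"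
  shows "f \<in> measurable Q N"
  using assms measurable_cong_sets[of Q "restrict_space borel Z" N N] by (auto simp: prob_dists_def)

text \<open>Measurable subsets of the closed set \<open>Z\<close> are Borel in the ambient space, so
  the image under inclusion loses nothing and the determining sequence of the ambient space can be
  used.\<close>

lemma prob_dists_eqI:
  assumes Z: "closed Z" and Q: "Q \<in> prob_dists Z" "Q' \<in> prob_dists Z"
    and eq: "distr Q borel (\<lambda>x. x) = distr Q' borel (\<lambda>x. x)"
  shows "Q = Q'"
proof (rule measure_eqI)
  show "sets Q = sets Q'" using Q by (simp add: prob_dists_def)
  fix A assume "A \<in> sets Q"
  then have A: "A \<subseteq> Z" "A \<in> sets borel" using sets_prob_dists_iff[OF Q(1) Z] by auto
  have "emeasure (distr R borel (\<lambda>x. x)) A = emeasure R A" if "R \<in> prob_dists Z" for R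
    using A space_prob_dists[OF that]
    by (subst emeasure_distr)
      (auto intro!: measurable_prob_dists[OF that] measurable_restrict_space1 arg_cong[where f="emeasure R"])
  then show "emeasure Q A = emeasure Q' A" using eq Q by metis
qed

text \<open>Both \<open>f\<close> and \<open>1 - f\<close> are admissible test functions; since
  total mass is 1, the two lower bounds amount to convergence.\<close>

lemma wconv_continuous:
  assumes Qs: "\<And>n. Qs n \<in> prob_dists Z" and Q: "Q \<in> prob_dists Z" and w: "wconv Z Qs Q"
    and f: "continuous_on UNIV f" "\<And>x. 0 \<le> f x" "\<And>x. f x \<le> (1::real)"
  shows "(\<lambda>n. enn2real (\<integral>\<^sup>+x. ennreal (f x) \<partial>Qs n)) \<longlonglongrightarrow> enn2real (\<integral>\<^sup>+x. ennreal (f x) \<partial>Q)"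
proof -
  define a where "a R = enn2real (\<integral>\<^sup>+x. ennreal (f x) \<partial>R)" for R
  have a: "(\<integral>\<^sup>+x. ennreal (f x) \<partial>R) = ennreal (a R) \<and> (\<integral>\<^sup>+x. ennreal (1 - f x) \<partial>R) = ennreal (1 - a R)
      \<and> 0 \<le> a R \<and> a R \<le> 1"
    if R: "R \<in> prob_dists Z" for R
  proof -
    interpret prob_space R using R by (simp add: prob_dists_def)
    have [measurable]: "f \<in> borel_measurable R"
      by (intro measurable_prob_dists[OF R] measurable_restrict_space1 borel_measurable_continuous_onI f)
    have s: "(\<integral>\<^sup>+x. ennreal (f x) \<partial>R) + (\<integral>\<^sup>+x. ennreal (1 - f x) \<partial>R) = 1"
      using f(2,3) by (simp add: nn_integral_add[symmetric] ennreal_plus[symmetric] emeasure_space_1 del: ennreal_plus)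
    then obtain p q where "(\<integral>\<^sup>+x. ennreal (f x) \<partial>R) = ennreal p" "0 \<le> p"
        "(\<integral>\<^sup>+x. ennreal (1 - f x) \<partial>R) = ennreal q" "0 \<le> q"
      by (cases "\<integral>\<^sup>+x. ennreal (f x) \<partial>R"; cases "\<integral>\<^sup>+x. ennreal (1 - f x) \<partial>R") auto
    moreover from this s have "p + q = 1"
      by (simp add: ennreal_plus[symmetric] del: ennreal_plus)
    ultimately show ?thesis by (auto simp: a_def algebra_simps)
  qed
  have lo: "\<forall>\<^sub>F n in sequentially. y < a (Qs n)" if "y < a Q" for y
  proof (cases "y < 0")
    case True
    then show ?thesis using a[OF Qs] by (intro always_eventually) (meson less_le_trans)
  next
    case False
    have "ennreal (a Q) \<le> liminf (\<lambda>n. ennreal (a (Qs n)))"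
      using w lsc_on_continuous[OF f(1), of Z] a[OF Q] a[OF Qs] by (auto simp: wconv_def)
    moreover have "ennreal y < ennreal (a Q)" using False that by (simp add: ennreal_less_iff)
    ultimately have "\<forall>\<^sub>F n in sequentially. ennreal y < ennreal (a (Qs n))"
      unfolding le_Liminf_iff by blast
    then show ?thesis using False by (simp add: ennreal_less_iff)
  qed
  have hi: "\<forall>\<^sub>F n in sequentially. a (Qs n) < y" if "a Q < y" for y
  proof (cases "y > 1")
    case True
    then show ?thesis using a[OF Qs] by (intro always_eventually) (meson le_less_trans)
  next
    case False
    have "continuous_on UNIV (\<lambda>x. 1 - f x)" by (intro continuous_intros f)
    from lsc_on_continuous[OF this, of Z] have "ennreal (1 - a Q) \<le> liminf (\<lambda>n. ennreal (1 - a (Qs n)))"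
      using w a[OF Q] a[OF Qs] by (auto simp: wconv_def)
    moreover have "ennreal (1 - y) < ennreal (1 - a Q)" using False that by (simp add: ennreal_less_iff)
    ultimately have "\<forall>\<^sub>F n in sequentially. ennreal (1 - y) < ennreal (1 - a (Qs n))"
      unfolding le_Liminf_iff by blast
    then show ?thesis using False by (simp add: ennreal_less_iff)
  qed
  show ?thesis using lo hi unfolding a_def[symmetric] by (rule order_tendstoI)
qed

lemma prob_dists_determining_sequence:
  fixes Z :: "'a::euclidean_space set"
  assumes Z: "closed Z"
  obtains \<Phi> :: "'a measure \<Rightarrow> nat \<Rightarrow> real"
  where "inj_on \<Phi> (prob_dists Z)"
    "\<And>Qs Q k. \<lbrakk>\<And>n. Qs n \<in> prob_dists Z; Q \<in> prob_dists Z; wconv Z Qs Q\<rbrakk> \<Longrightarrow> (\<lambda>n. \<Phi> (Qs n) k) \<longlonglongrightarrow> \<Phi> Q k"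
proof -
  obtain \<psi> :: "nat \<Rightarrow> 'a \<Rightarrow> real" where \<psi>: "\<And>k. continuous_on UNIV (\<psi> k)" "\<And>k x. 0 \<le> \<psi> k x" "\<And>k x. \<psi> k x \<le> 1"
    and det: "\<And>M N. \<lbrakk>prob_space M; prob_space N; sets M = sets borel; sets N = sets borel;
      \<And>k. (\<integral>\<^sup>+x. ennreal (\<psi> k x) \<partial>M) = (\<integral>\<^sup>+x. ennreal (\<psi> k x) \<partial>N)\<rbrakk> \<Longrightarrow> M = N"
    using determining_sequence by blast
  define \<Phi> where "\<Phi> Q k = enn2real (\<integral>\<^sup>+x. ennreal (\<psi> k x) \<partial>Q)" for Q k
  have fin: "(\<integral>\<^sup>+x. ennreal (\<psi> k x) \<partial>Q) < \<infinity>" if "Q \<in> prob_dists Z" for Q k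
  proof -
    interpret prob_space Q using that by (simp add: prob_dists_def)
    have "(\<integral>\<^sup>+x. ennreal (\<psi> k x) \<partial>Q) \<le> (\<integral>\<^sup>+x. 1 \<partial>Q)"
      using \<psi>(3) by (intro nn_integral_mono) (simp add: ennreal_le_1)
    also have "\<dots> < \<infinity>" by (simp add: emeasure_space_1)
    finally show ?thesis .
  qed
  have "inj_on \<Phi> (prob_dists Z)"
  proof (rule inj_onI)
    fix Q Q' assume Q: "Q \<in> prob_dists Z" "Q' \<in> prob_dists Z" and eq: "\<Phi> Q = \<Phi> Q'"
    have id: "(\<lambda>x. x) \<in> borel_measurable R" if "R \<in> prob_dists Z" for R
      using that by (intro measurable_prob_dists[OF that] measurable_restrict_space1) auto
    show "Q = Q'"
    proof (rule prob_dists_eqI[OF Z Q det])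
      show "prob_space (distr Q borel (\<lambda>x. x))" "prob_space (distr Q' borel (\<lambda>x. x))"
        using Q by (auto intro!: prob_space.prob_space_distr id simp: prob_dists_def)
      show "(\<integral>\<^sup>+x. ennreal (\<psi> k x) \<partial>distr Q borel (\<lambda>x. x)) = (\<integral>\<^sup>+x. ennreal (\<psi> k x) \<partial>distr Q' borel (\<lambda>x. x))" for k
      proof -
        have [measurable]: "\<psi> k \<in> borel_measurable borel" by (intro borel_measurable_continuous_onI \<psi>)
        have "ennreal (\<Phi> Q k) = ennreal (\<Phi> Q' k)" using eq by simp
        then show ?thesis
          unfolding \<Phi>_def using fin[OF Q(1), of k] fin[OF Q(2), of k] Q
          by (simp add: nn_integral_distr id) (metis ennreal_enn2real)
      qed
    qed auto
  qed
  moreover have "(\<lambda>n. \<Phi> (Qs n) k) \<longlonglongrightarrow> \<Phi> Q k"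
    if "\<And>n. Qs n \<in> prob_dists Z" "Q \<in> prob_dists Z" "wconv Z Qs Q" for Qs Q k
    unfolding \<Phi>_def using that \<psi>[of k] by (rule wconv_continuous)
  ultimately show ?thesis using that by blast
qed

text \<open>Uniqueness of limits for a constant sequence; it identifies the second marginal of a
  limit of couplings with \<open>P\<close>.\<close>

lemma wconv_const_eq:
  fixes Z :: "'a::euclidean_space set"
  assumes "closed Z" "Q \<in> prob_dists Z" "Q' \<in> prob_dists Z" "wconv Z (\<lambda>_. Q) Q'"
  shows "Q' = Q"
proof -
  obtain \<Phi> :: "'a measure \<Rightarrow> nat \<Rightarrow> real" where inj: "inj_on \<Phi> (prob_dists Z)"
    and conv: "\<And>Qs Q k. \<lbrakk>\<And>n. Qs n \<in> prob_dists Z; Q \<in> prob_dists Z; wconv Z Qs Q\<rbrakk> \<Longrightarrow> (\<lambda>n. \<Phi> (Qs n) k) \<longlonglongrightarrow> \<Phi> Q k"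
    using prob_dists_determining_sequence[OF assms(1)] by blast
  have "\<Phi> Q k = \<Phi> Q' k" for k
    using conv[of "\<lambda>_. Q" Q' k] assms by (simp add: LIMSEQ_const_iff)
  then show ?thesis using inj_onD[OF inj _ assms(2,3)] by auto
qed

lemma tendsto_fun_componentwise:
  fixes f :: "'n \<Rightarrow> 'i \<Rightarrow> 'b::topological_space"
  assumes "\<And>k. ((\<lambda>n. f n k) \<longlongrightarrow> l k) F"
  shows "(f \<longlongrightarrow> l) F"
proof -
  have "limitin (product_topology (\<lambda>_. euclidean) UNIV) f l F"
    unfolding limitin_componentwise using assms by auto
  then show ?thesis by (simp add: euclidean_product_topology)
qed

text \<open>The injection \<open>\<Phi>\<close> into the metrizable space of sequences turns sequential compactness into
  compactness, so that arbitrary, possibly uncountable, families of constraints can be treated.\<close>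

lemma seq_compact_measures_fip:
  fixes Z :: "'a::euclidean_space set"
  assumes Z: "closed Z" and B: "B \<subseteq> prob_dists Z"
    and sc: "\<And>Qs. (\<And>n. Qs n \<in> B) \<Longrightarrow> \<exists>(r :: nat \<Rightarrow> nat) Q. strict_mono r \<and> Q \<in> B \<and> wconv Z (Qs \<circ> r) Q"
    and cl: "\<And>i Qs Q. \<lbrakk>i \<in> I; \<And>n. Qs n \<in> S i; Q \<in> B; wconv Z Qs Q\<rbrakk> \<Longrightarrow> Q \<in> S i"
    and SB: "\<And>i. i \<in> I \<Longrightarrow> S i \<subseteq> B"
    and fin: "\<And>F. finite F \<Longrightarrow> F \<subseteq> I \<Longrightarrow> \<exists>Q\<in>B. \<forall>i\<in>F. Q \<in> S i"
  shows "\<exists>Q\<in>B. \<forall>i\<in>I. Q \<in> S i"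
proof -
  obtain \<Phi> :: "'a measure \<Rightarrow> nat \<Rightarrow> real" where inj: "inj_on \<Phi> (prob_dists Z)"
    and conv: "\<And>Qs Q k. \<lbrakk>\<And>n. Qs n \<in> prob_dists Z; Q \<in> prob_dists Z; wconv Z Qs Q\<rbrakk> \<Longrightarrow> (\<lambda>n. \<Phi> (Qs n) k) \<longlonglongrightarrow> \<Phi> Q k"
    using prob_dists_determining_sequence[OF Z] by blast
  have comp: "compact (\<Phi> ` T)"
    if T: "T \<subseteq> B" "\<And>Qs Q. \<lbrakk>\<And>n. Qs n \<in> T; Q \<in> B; wconv Z Qs Q\<rbrakk> \<Longrightarrow> Q \<in> T" for T
    unfolding compact_eq_seq_compact_metric
  proof (rule seq_compactI)
    fix y :: "nat \<Rightarrow> nat \<Rightarrow> real" assume "\<forall>n. y n \<in> \<Phi> ` T"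
    then obtain Qs where Qs: "\<And>n. Qs n \<in> T" "\<And>n. y n = \<Phi> (Qs n)" unfolding image_iff by metis
    obtain r Q where r: "strict_mono r" "Q \<in> B" "wconv Z (Qs \<circ> r) Q"
      using sc[of Qs] Qs(1) T(1) by blast
    then have "Q \<in> T" using T(2)[of "Qs \<circ> r" Q] Qs(1) by auto
    moreover have "(y \<circ> r) \<longlonglongrightarrow> \<Phi> Q"
    proof -
      have "(\<lambda>n. \<Phi> ((Qs \<circ> r) n) k) \<longlonglongrightarrow> \<Phi> Q k" for k
        using Qs(1) T(1) B r by (intro conv[of "Qs \<circ> r"]) auto
      then show ?thesis
        using Qs(2) by (auto simp: comp_def intro!: tendsto_fun_componentwise)
    qed
    ultimately show "\<exists>l\<in>\<Phi> ` T. \<exists>r. strict_mono r \<and> (y \<circ> r) \<longlonglongrightarrow> l"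
      using r(1) by blast
  qed
  have "\<Phi> ` B \<inter> \<Inter>((\<lambda>i. \<Phi> ` S i) ` I) \<noteq> {}"
  proof (rule compact_imp_fip)
    show "compact (\<Phi> ` B)" by (rule comp) auto
    show "closed T" if "T \<in> (\<lambda>i. \<Phi> ` S i) ` I" for T
    proof -
      obtain i where i: "i \<in> I" "T = \<Phi> ` S i" using \<open>T \<in> _\<close> by auto
      have "compact (\<Phi> ` S i)" by (rule comp[OF SB[OF i(1)] cl[OF i(1)]])
      then show ?thesis unfolding i(2) by (rule compact_imp_closed)
    qed
    fix F' assume "finite F'" "F' \<subseteq> (\<lambda>i. \<Phi> ` S i) ` I"
    then obtain F where F: "F \<subseteq> I" "finite F" "F' = (\<lambda>i. \<Phi> ` S i) ` F"
      by (meson finite_subset_image)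
    then show "\<Phi> ` B \<inter> \<Inter>F' \<noteq> {}" using fin[OF F(2,1)] by fastforce
  qed
  then obtain Q where Q: "Q \<in> B" "\<And>i. i \<in> I \<Longrightarrow> \<Phi> Q \<in> \<Phi> ` S i" by auto
  have "Q \<in> S i" if i: "i \<in> I" for i
  proof -
    obtain Q' where "Q' \<in> S i" "\<Phi> Q = \<Phi> Q'" using Q(2)[OF i] by auto
    moreover from this have "Q = Q'" using inj_onD[OF inj] Q(1) SB[OF i] B by blast
    ultimately show ?thesis by simp
  qed
  then show ?thesis using Q(1) by auto
qed

section \<open>Sequential compactness of the ambiguity set\<close>

lemma power_add_le:
  fixes a b :: real
  assumes "0 \<le> a" "0 \<le> b"
  shows "(a + b) ^ p \<le> 2 ^ p * (a ^ p + b ^ p)"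
proof -
  have "(a + b) ^ p \<le> (2 * max a b) ^ p" using assms by (intro power_mono) auto
  also have "\<dots> = 2 ^ p * max a b ^ p" by (simp add: power_mult_distrib)
  also have "max a b ^ p \<le> a ^ p + b ^ p" using assms by (auto simp: max_def)
  finally show ?thesis by simp
qed

context
  fixes Z :: "'a::euclidean_space set" and c :: "'a \<Rightarrow> 'a \<Rightarrow> ennreal" and P :: "'a measure"
    and \<epsilon> :: real and d :: "'a \<Rightarrow> 'a \<Rightarrow> real" and p :: nat
  assumes Z: "closed Z" and c: "lsc_on (Z \<times> Z) (\<lambda>(z, z'). c z z')" and P: "P \<in> prob_dists Z"
    and e: "0 \<le> \<epsilon>" and cg: "cost_growth c Z P d p" and p: "0 < p"
begin

lemma growth_metric: "Metric_space Z d"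
  and growth_compact: "z\<^sub>0 \<in> Z \<Longrightarrow> compact {z \<in> Z. d z z\<^sub>0 \<le> r}"
  and growth_le: "z \<in> Z \<Longrightarrow> z' \<in> Z \<Longrightarrow> ennreal (d z z' ^ p) \<le> c z z'"
  using cg by (auto simp: cost_growth_def)

text \<open>The metric \<open>d\<close> is not assumed continuous for the ambient topology;
  compactness of its sublevel sets makes them Borel.\<close>

lemma growth_measurable:
  assumes "z\<^sub>0 \<in> Z"
  shows "(\<lambda>z. d z z\<^sub>0) \<in> borel_measurable (restrict_space borel Z)"
proof (rule borel_measurableI_le)
  fix r
  have "{z \<in> Z. d z z\<^sub>0 \<le> r} \<in> sets borel" using growth_compact[OF assms] by (simp add: borel_compact)
  then show "{z \<in> space (restrict_space borel Z). d z z\<^sub>0 \<le> r} \<in> sets (restrict_space borel Z)"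
    using Z by (auto simp: sets_restrict_space_iff space_restrict_space)
qed

text \<open>The cost assumption controls the moment about one particular point only; the triangle
  inequality moves the centre.\<close>

lemma growth_moment_reference:
  assumes z1: "z\<^sub>1 \<in> Z"
  shows "(\<integral>\<^sup>+z. ennreal (d z z\<^sub>1 ^ p) \<partial>P) < \<infinity>"
proof -
  interpret Metric_space Z d by (rule growth_metric)
  interpret prob_space P using P by (simp add: prob_dists_def)
  obtain z0 C where z0: "z0 \<in> Z" "C < \<infinity>" "(\<integral>\<^sup>+z. c z z0 \<partial>P) \<le> C"
    using cg by (auto simp: cost_growth_def)
  have m: "(\<lambda>z. ennreal (d z z0 ^ p)) \<in> borel_measurable P"
    by (intro measurable_prob_dists[OF P] measurable_compose[OF _ measurable_ennreal] borel_measurable_power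
        growth_measurable z0)
  have "(\<integral>\<^sup>+z. ennreal (d z z\<^sub>1 ^ p) \<partial>P) \<le> (\<integral>\<^sup>+z. ennreal (2 ^ p) * (ennreal (d z z0 ^ p) + ennreal (d z0 z\<^sub>1 ^ p)) \<partial>P)"
  proof (intro nn_integral_mono)
    fix z assume "z \<in> space P"
    then have z: "z \<in> Z" using space_prob_dists[OF P] by simp
    have "d z z\<^sub>1 ^ p \<le> (d z z0 + d z0 z\<^sub>1) ^ p" using triangle[OF z z0(1) z1] by (intro power_mono) auto
    also have "\<dots> \<le> 2 ^ p * (d z z0 ^ p + d z0 z\<^sub>1 ^ p)" by (rule power_add_le) auto
    finally show "ennreal (d z z\<^sub>1 ^ p) \<le> ennreal (2 ^ p) * (ennreal (d z z0 ^ p) + ennreal (d z0 z\<^sub>1 ^ p))"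
      by (simp add: ennreal_mult[symmetric] ennreal_plus[symmetric] ennreal_leI del: ennreal_plus)
  qed
  also have "\<dots> = ennreal (2 ^ p) * ((\<integral>\<^sup>+z. ennreal (d z z0 ^ p) \<partial>P) + ennreal (d z0 z\<^sub>1 ^ p))"
    using m by (simp add: nn_integral_cmult nn_integral_add emeasure_space_1)
  also have "(\<integral>\<^sup>+z. ennreal (d z z0 ^ p) \<partial>P) \<le> C"
    using space_prob_dists[OF P] by (intro order_trans[OF nn_integral_mono z0(3)] growth_le z0(1)) auto
  then have "(\<integral>\<^sup>+z. ennreal (d z z0 ^ p) \<partial>P) < \<infinity>" using z0(2) by (rule le_less_trans)
  then have "ennreal (2 ^ p) * ((\<integral>\<^sup>+z. ennreal (d z z0 ^ p) \<partial>P) + ennreal (d z0 z\<^sub>1 ^ p)) < \<infinity>"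
    by (simp add: ennreal_mult_less_top)
  finally show ?thesis .
qed

lemma coupling_facts:
  assumes "\<pi> \<in> couplings Q P" "Q \<in> prob_dists Z"
  shows "prob_space \<pi>" "sets \<pi> = sets (restrict_space borel Z \<Otimes>\<^sub>M restrict_space borel Z)"
    "space \<pi> = Z \<times> Z"
    "f \<in> borel_measurable (restrict_space borel Z) \<Longrightarrow> (\<integral>\<^sup>+w. f (fst w) \<partial>\<pi>) = (\<integral>\<^sup>+z. (f z :: ennreal) \<partial>Q)"
    "f \<in> borel_measurable (restrict_space borel Z) \<Longrightarrow> (\<integral>\<^sup>+w. f (snd w) \<partial>\<pi>) = (\<integral>\<^sup>+z. (f z :: ennreal) \<partial>P)"
proof -
  show "prob_space \<pi>" using assms by (simp add: couplings_def)
  have sQ: "sets Q = sets (restrict_space borel Z)" and sP: "sets P = sets (restrict_space borel Z)"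
    using assms P by (auto simp: prob_dists_def)
  show s: "sets \<pi> = sets (restrict_space borel Z \<Otimes>\<^sub>M restrict_space borel Z)"
    using assms(1) sets_pair_measure_cong[OF sQ sP] by (simp add: couplings_def)
  show "space \<pi> = Z \<times> Z"
    using sets_eq_imp_space_eq[OF s] by (simp add: space_pair_measure space_restrict_space)
  have d: "distr \<pi> Q fst = Q" "distr \<pi> P snd = P" using assms(1) by (auto simp: couplings_def)
  have m: "fst \<in> measurable \<pi> Q" "snd \<in> measurable \<pi> P"
    by (simp_all add: measurable_cong_sets[OF s sQ] measurable_cong_sets[OF s sP])
  show "(\<integral>\<^sup>+w. f (fst w) \<partial>\<pi>) = (\<integral>\<^sup>+z. f z \<partial>Q)" if "f \<in> borel_measurable (restrict_space borel Z)"
    using nn_integral_distr[OF m(1), of f] measurable_prob_dists[OF assms(2) that] by (simp add: d)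
  show "(\<integral>\<^sup>+w. f (snd w) \<partial>\<pi>) = (\<integral>\<^sup>+z. f z \<partial>P)" if "f \<in> borel_measurable (restrict_space borel Z)"
    using nn_integral_distr[OF m(2), of f] measurable_prob_dists[OF P that] by (simp add: d)
qed

text \<open>Under a coupling, the distance of the first component to \<open>z\<^sub>1\<close> is at
  most the distance transported plus the distance of the second component to
  \<open>z\<^sub>1\<close>. The cost bounds the first contribution, the moment of \<open>P\<close>
  the second, both uniformly over the ball.\<close>

lemma growth_moment_ball:
  assumes z1: "z\<^sub>1 \<in> Z"
  obtains M :: real where "0 \<le> M" "\<And>Q. Q \<in> ot_ball c Z P \<epsilon> \<Longrightarrow> (\<integral>\<^sup>+z. ennreal (d z z\<^sub>1 ^ p) \<partial>Q) \<le> ennreal M"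
proof -
  interpret Metric_space Z d by (rule growth_metric)
  \<comment> \<open>The 1 is an arbitrary slack for a nearly optimal coupling, and
    \<open>2 ^ p\<close> stems from \<open>power_add_le\<close>.\<close>
  define M where "M = ennreal (2 ^ p) * (ennreal (\<epsilon> + 1) + (\<integral>\<^sup>+z. ennreal (d z z\<^sub>1 ^ p) \<partial>P))"
  have "M < \<infinity>"
    using growth_moment_reference[OF z1] by (simp add: M_def ennreal_mult_less_top)
  have "(\<integral>\<^sup>+z. ennreal (d z z\<^sub>1 ^ p) \<partial>Q) \<le> M" if Q: "Q \<in> ot_ball c Z P \<epsilon>" for Q
  proof -
    have Q': "Q \<in> prob_dists Z" using Q by (simp add: ot_ball_def)
    obtain \<pi> where \<pi>: "\<pi> \<in> couplings Q P" "(\<integral>\<^sup>+w. c (fst w) (snd w) \<partial>\<pi>) \<le> ennreal (\<epsilon> + 1)"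
      using ot_ball_approx_coupling[OF Q e, of 1] by auto
    note cf = coupling_facts[OF \<pi>(1) Q']
    have mc [measurable]: "(\<lambda>w. c (fst w) (snd w)) \<in> borel_measurable \<pi>"
      using cost_measurable[OF Z c] measurable_cong_sets[OF cf(2) refl] by blast
    have md: "(\<lambda>z. ennreal (d z z\<^sub>1 ^ p)) \<in> borel_measurable (restrict_space borel Z)"
      by (intro measurable_compose[OF _ measurable_ennreal] borel_measurable_power growth_measurable z1)
    have ms [measurable]: "(\<lambda>w. ennreal (d (snd w) z\<^sub>1 ^ p)) \<in> borel_measurable \<pi>"
      using measurable_compose[OF measurable_snd md] measurable_cong_sets[OF cf(2) refl] by blast
    have "(\<integral>\<^sup>+z. ennreal (d z z\<^sub>1 ^ p) \<partial>Q) = (\<integral>\<^sup>+w. ennreal (d (fst w) z\<^sub>1 ^ p) \<partial>\<pi>)"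
      using cf(4)[OF md] by simp
    also have "\<dots> \<le> (\<integral>\<^sup>+w. ennreal (2 ^ p) * (c (fst w) (snd w) + ennreal (d (snd w) z\<^sub>1 ^ p)) \<partial>\<pi>)"
    proof (intro nn_integral_mono)
      fix w assume "w \<in> space \<pi>"
      then have w: "fst w \<in> Z" "snd w \<in> Z" by (simp_all add: cf(3) mem_Times_iff)
      have "d (fst w) z\<^sub>1 ^ p \<le> (d (fst w) (snd w) + d (snd w) z\<^sub>1) ^ p"
        using triangle[OF w z1] by (intro power_mono) auto
      also have "\<dots> \<le> 2 ^ p * (d (fst w) (snd w) ^ p + d (snd w) z\<^sub>1 ^ p)" by (rule power_add_le) auto
      finally have "ennreal (d (fst w) z\<^sub>1 ^ p) \<le> ennreal (2 ^ p) * (ennreal (d (fst w) (snd w) ^ p) + ennreal (d (snd w) z\<^sub>1 ^ p))"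
        by (simp add: ennreal_mult[symmetric] ennreal_plus[symmetric] ennreal_leI del: ennreal_plus)
      also have "\<dots> \<le> ennreal (2 ^ p) * (c (fst w) (snd w) + ennreal (d (snd w) z\<^sub>1 ^ p))"
        by (intro mult_left_mono add_right_mono growth_le w) auto
      finally show "ennreal (d (fst w) z\<^sub>1 ^ p) \<le> \<dots>" .
    qed
    also have "\<dots> = ennreal (2 ^ p) * ((\<integral>\<^sup>+w. c (fst w) (snd w) \<partial>\<pi>) + (\<integral>\<^sup>+w. ennreal (d (snd w) z\<^sub>1 ^ p) \<partial>\<pi>))"
      by (simp only: nn_integral_cmult[OF borel_measurable_add[OF mc ms]] nn_integral_add[OF mc ms])
    also have "\<dots> \<le> M"
      unfolding M_def cf(5)[OF md] by (intro mult_left_mono add_right_mono \<pi>) auto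
    finally show ?thesis .
  qed
  then show ?thesis
    using \<open>M < \<infinity>\<close> by (intro that[of "enn2real M"]) simp_all
qed

lemma growth_moment_reference_real:
  assumes "z\<^sub>1 \<in> Z"
  shows "\<exists>M\<ge>0. (\<integral>\<^sup>+z. ennreal (d z z\<^sub>1 ^ p) \<partial>P) \<le> ennreal M"
  using growth_moment_reference[OF assms]
  by (intro exI[of _ "enn2real (\<integral>\<^sup>+z. ennreal (d z z\<^sub>1 ^ p) \<partial>P)"]) simp

text \<open>Couplings, and not only their first marginals, are passed to the limit: the limit
  distribution then comes with a coupling to \<open>P\<close>. Slack \<open>1 / Suc n\<close> in the
  costs brings the limit cost down to \<open>\<epsilon>\<close> itself.\<close>

lemma ot_ball_seq_compact:
  assumes Qs: "\<And>n. Qs n \<in> ot_ball c Z P \<epsilon>"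
  shows "\<exists>(r :: nat \<Rightarrow> nat) Q. strict_mono r \<and> Q \<in> ot_ball c Z P \<epsilon> \<and> wconv Z (Qs \<circ> r) Q"
proof -
  interpret Metric_space Z d by (rule growth_metric)
  let ?R = "restrict_space borel Z :: 'a measure"
  obtain z0 where z0: "z0 \<in> Z" using cg by (auto simp: cost_growth_def)
  have QsZ: "Qs n \<in> prob_dists Z" for n using Qs by (simp add: ot_ball_def)
  have "\<forall>n. \<exists>\<pi>. \<pi> \<in> couplings (Qs n) P \<and> (\<integral>\<^sup>+w. c (fst w) (snd w) \<partial>\<pi>) \<le> ennreal (\<epsilon> + 1 / real (Suc n))"
  proof
    fix n
    show "\<exists>\<pi>. \<pi> \<in> couplings (Qs n) P \<and> (\<integral>\<^sup>+w. c (fst w) (snd w) \<partial>\<pi>) \<le> ennreal (\<epsilon> + 1 / real (Suc n))"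
      using ot_ball_approx_coupling[OF Qs e, of "1 / real (Suc n)" n] by auto
  qed
  then obtain \<pi> where \<pi>: "\<And>n. \<pi> n \<in> couplings (Qs n) P"
    and \<pi>c: "\<And>n. (\<integral>\<^sup>+w. c (fst w) (snd w) \<partial>\<pi> n) \<le> ennreal (\<epsilon> + 1 / real (Suc n))"
    by metis
  note cf = coupling_facts[OF \<pi> QsZ]
  have id: "(\<lambda>w. w) \<in> measurable (\<pi> n) (borel :: ('a \<times> 'a) measure)" for n
    using measurable_restrict_pair_borel measurable_cong_sets[OF cf(2) refl] by blast
  define \<mu> where "\<mu> n = distr (\<pi> n) borel (\<lambda>w. w)" for n
  have int\<mu>: "(\<integral>\<^sup>+w. f w \<partial>\<mu> n) = (\<integral>\<^sup>+w. f w \<partial>\<pi> n)" if "f \<in> borel_measurable borel" for f n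
    unfolding \<mu>_def using that by (subst nn_integral_distr[OF id]) auto
  obtain M1 where M1: "0 \<le> M1" "\<And>Q. Q \<in> ot_ball c Z P \<epsilon> \<Longrightarrow> (\<integral>\<^sup>+z. ennreal (d z z0 ^ p) \<partial>Q) \<le> ennreal M1"
    using growth_moment_ball[OF z0] by blast
  obtain M2 where M2: "0 \<le> M2" "(\<integral>\<^sup>+z. ennreal (d z z0 ^ p) \<partial>P) \<le> ennreal M2"
    using growth_moment_reference_real[OF z0] by blast
  \<comment> \<open>The maximum makes every sublevel set a product of two compact ones, and
    \<open>\<infinity>\<close> off \<open>Z \<times> Z\<close> confines it to that set.\<close>
  define V where "V w = (if w \<in> Z \<times> Z then max (ennreal (d (fst w) z0 ^ p)) (ennreal (d (snd w) z0 ^ p)) else \<infinity>)" for w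
  have V_compact: "compact {w. V w \<le> a}" if a: "a < \<infinity>" for a
  proof -
    obtain \<alpha> where \<alpha>: "a = ennreal \<alpha>" "0 \<le> \<alpha>" using a by (cases a) auto
    have root: "ennreal (d z z0 ^ p) \<le> a \<longleftrightarrow> d z z0 \<le> root p \<alpha>" for z
    proof -
      have "d z z0 ^ p \<le> root p \<alpha> ^ p \<longleftrightarrow> d z z0 \<le> root p \<alpha>"
        using p \<alpha>(2) by (intro power_mono_iff) auto
      then show ?thesis using p \<alpha> by simp
    qed
    have "V w \<le> a \<longleftrightarrow> w \<in> {z \<in> Z. d z z0 \<le> root p \<alpha>} \<times> {z \<in> Z. d z z0 \<le> root p \<alpha>}" for w
    proof (cases "w \<in> Z \<times> Z")
      case True
      then show ?thesis by (simp add: V_def mem_Times_iff root)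
    next
      case False
      then have "V w = \<infinity>" by (simp add: V_def)
      then show ?thesis using a False by (auto simp: not_le)
    qed
    then have "{w. V w \<le> a} = {z \<in> Z. d z z0 \<le> root p \<alpha>} \<times> {z \<in> Z. d z z0 \<le> root p \<alpha>}"
      by blast
    then show ?thesis using growth_compact[OF z0] by (simp add: compact_Times)
  qed
  have V_meas: "V \<in> borel_measurable borel"
    by (intro lsc_borel_measurable compact_imp_closed V_compact)
  have md: "(\<lambda>z. ennreal (d z z0 ^ p)) \<in> borel_measurable ?R"
    by (intro measurable_compose[OF _ measurable_ennreal] borel_measurable_power growth_measurable z0)
  have V_int: "(\<integral>\<^sup>+w. V w \<partial>\<mu> n) \<le> ennreal M1 + ennreal M2" for n
  proof -
    have [measurable]: "(\<lambda>w. ennreal (d (fst w) z0 ^ p)) \<in> borel_measurable (\<pi> n)"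
      "(\<lambda>w. ennreal (d (snd w) z0 ^ p)) \<in> borel_measurable (\<pi> n)"
      using measurable_compose[OF measurable_fst md] measurable_compose[OF measurable_snd md]
        measurable_cong_sets[OF cf(2) refl] by blast+
    have "(\<integral>\<^sup>+w. V w \<partial>\<mu> n) \<le> (\<integral>\<^sup>+w. ennreal (d (fst w) z0 ^ p) + ennreal (d (snd w) z0 ^ p) \<partial>\<pi> n)"
      unfolding int\<mu>[OF V_meas] using cf(3)
      by (intro nn_integral_mono) (auto simp: V_def max_def add_increasing add_increasing2)
    also have "\<dots> = (\<integral>\<^sup>+z. ennreal (d z z0 ^ p) \<partial>Qs n) + (\<integral>\<^sup>+z. ennreal (d z z0 ^ p) \<partial>P)"
      by (subst nn_integral_add) (simp_all only: cf(4,5)[OF md], measurable)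
    also have "\<dots> \<le> ennreal M1 + ennreal M2" by (intro add_mono M1 M2 Qs)
    finally show ?thesis .
  qed
  obtain r :: "nat \<Rightarrow> nat" and \<Omega> :: "real measure" and X Y where r: "strict_mono r" and \<Omega>: "prob_space \<Omega>"
    and X [measurable]: "\<And>n. X n \<in> borel_measurable \<Omega>" and Y [measurable]: "Y \<in> borel_measurable \<Omega>"
    and law: "\<And>n. distr \<Omega> borel (X n) = \<mu> (r n)" and lim: "AE \<omega> in \<Omega>. (\<lambda>n. X n \<omega>) \<longlonglongrightarrow> (Y \<omega> :: 'a \<times> 'a)"
  proof (rule skorohod_representation[of \<mu> V "ennreal M1 + ennreal M2"])
    show "prob_space (\<mu> n)" for n
      unfolding \<mu>_def by (intro prob_space.prob_space_distr cf(1) id)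
    show "sets (\<mu> n) = sets borel" for n by (simp add: \<mu>_def)
    show "compact {w. V w \<le> a}" if "a < \<infinity>" for a by (rule V_compact[OF that])
    show "ennreal M1 + ennreal M2 < \<infinity>" by simp
    show "(\<integral>\<^sup>+w. V w \<partial>\<mu> n) \<le> ennreal M1 + ennreal M2" for n by (rule V_int)
  qed (rule that; assumption)
  interpret \<Omega>: prob_space \<Omega> by (rule \<Omega>)
  \<comment> \<open>Applied three times: to the extended cost and to test functions of either
    marginal.\<close>
  have fatou: "(\<integral>\<^sup>+\<omega>. f (Y \<omega>) \<partial>\<Omega>) \<le> liminf (\<lambda>n. \<integral>\<^sup>+w. f w \<partial>\<pi> (r n))"
    if f: "\<And>a. a < \<infinity> \<Longrightarrow> closed {w. f w \<le> a}" for f :: "'a \<times> 'a \<Rightarrow> ennreal"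
  proof -
    have [measurable]: "f \<in> borel_measurable borel" by (rule lsc_borel_measurable[OF f])
    have "(\<integral>\<^sup>+\<omega>. f (Y \<omega>) \<partial>\<Omega>) \<le> (\<integral>\<^sup>+\<omega>. liminf (\<lambda>n. f (X n \<omega>)) \<partial>\<Omega>)"
      using lim by (intro nn_integral_mono_AE) (auto elim!: eventually_mono intro: liminf_ge_of_closed_sublevels[OF f])
    also have "\<dots> \<le> liminf (\<lambda>n. \<integral>\<^sup>+\<omega>. f (X n \<omega>) \<partial>\<Omega>)"
      by (intro nn_integral_liminf) measurable
    also have "(\<lambda>n. \<integral>\<^sup>+\<omega>. f (X n \<omega>) \<partial>\<Omega>) = (\<lambda>n. \<integral>\<^sup>+w. f w \<partial>\<pi> (r n))"
    proof
      fix n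
      have "(\<integral>\<^sup>+\<omega>. f (X n \<omega>) \<partial>\<Omega>) = (\<integral>\<^sup>+w. f w \<partial>distr \<Omega> borel (X n))"
        by (subst nn_integral_distr) auto
      then show "(\<integral>\<^sup>+\<omega>. f (X n \<omega>) \<partial>\<Omega>) = (\<integral>\<^sup>+w. f w \<partial>\<pi> (r n))"
        unfolding law by (simp add: int\<mu>)
    qed
    finally show ?thesis .
  qed
  let ?G = "extend_top (Z \<times> Z) (\<lambda>(z, z'). c z z')"
  have G_closed: "closed {w. ?G w \<le> a}" if "a < \<infinity>" for a
    using that by (intro closed_sublevel_extend_top closed_Times Z c)
  have [measurable]: "?G \<in> borel_measurable borel" by (rule lsc_borel_measurable[OF G_closed])
  have "(\<integral>\<^sup>+\<omega>. ?G (Y \<omega>) \<partial>\<Omega>) \<le> liminf (\<lambda>n. \<integral>\<^sup>+w. ?G w \<partial>\<pi> (r n))"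
    by (rule fatou[OF G_closed])
  also have "\<dots> \<le> liminf (\<lambda>n. ennreal (\<epsilon> + 1 / real (Suc n)))"
  proof (intro Liminf_mono always_eventually allI)
    fix n
    have "(\<integral>\<^sup>+w. ?G w \<partial>\<pi> (r n)) = (\<integral>\<^sup>+w. c (fst w) (snd w) \<partial>\<pi> (r n))"
      using cf(3) by (intro nn_integral_cong) (auto simp: extend_top_def)
    also have "\<dots> \<le> ennreal (\<epsilon> + 1 / real (Suc (r n)))" by (rule \<pi>c)
    also have "\<dots> \<le> ennreal (\<epsilon> + 1 / real (Suc n))"
      using seq_suble[OF r, of n] by (intro ennreal_leI add_left_mono divide_left_mono) auto
    finally show "(\<integral>\<^sup>+w. ?G w \<partial>\<pi> (r n)) \<le> ennreal (\<epsilon> + 1 / real (Suc n))" .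
  qed
  also have "\<dots> = ennreal \<epsilon>"
  proof (rule lim_imp_Liminf)
    have "(\<lambda>n. \<epsilon> + 1 / real (Suc n)) \<longlonglongrightarrow> \<epsilon> + 0"
      by (intro tendsto_add tendsto_const LIMSEQ_Suc lim_1_over_n)
    then show "(\<lambda>n. ennreal (\<epsilon> + 1 / real (Suc n))) \<longlonglongrightarrow> ennreal \<epsilon>"
      by (intro tendsto_ennrealI) simp
  qed simp
  finally have cost: "(\<integral>\<^sup>+\<omega>. ?G (Y \<omega>) \<partial>\<Omega>) \<le> ennreal \<epsilon>" .
  have "(\<integral>\<^sup>+\<omega>. ?G (Y \<omega>) \<partial>\<Omega>) \<noteq> \<infinity>" using cost by (auto simp: top_unique)
  then have "AE \<omega> in \<Omega>. ?G (Y \<omega>) \<noteq> \<infinity>" by (intro nn_integral_PInf_AE) measurable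
  then have YZ: "AE \<omega> in \<Omega>. Y \<omega> \<in> Z \<times> Z"
    by (rule eventually_mono) (auto simp: extend_top_def split: if_splits)
  \<comment> \<open>Finite cost puts the limit in \<open>Z \<times> Z\<close> only almost surely; a
    change on a null set makes its components random points of \<open>Z\<close>.\<close>
  define Y' where "Y' \<omega> = (if Y \<omega> \<in> Z \<times> Z then Y \<omega> else (z0, z0))" for \<omega>
  have YY': "AE \<omega> in \<Omega>. Y' \<omega> = Y \<omega>" using YZ by (rule eventually_mono) (simp add: Y'_def)
  have Y'Z: "fst (Y' \<omega>) \<in> Z" "snd (Y' \<omega>) \<in> Z" for \<omega> using z0 by (auto simp: Y'_def)
  have [measurable]: "Z \<times> Z \<in> sets borel" using closed_Times[OF Z Z] by (rule borel_closed)
  have Y'm: "Y' \<in> borel_measurable \<Omega>" unfolding Y'_def by measurable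
  have fst_m: "(\<lambda>\<omega>. fst (Y' \<omega>)) \<in> measurable \<Omega> ?R" and snd_m: "(\<lambda>\<omega>. snd (Y' \<omega>)) \<in> measurable \<Omega> ?R"
    using measurable_compose[OF Y'm borel_measurable_continuous_onI[OF continuous_on_fst[OF continuous_on_id]]]
      measurable_compose[OF Y'm borel_measurable_continuous_onI[OF continuous_on_snd[OF continuous_on_id]]]
    by (intro measurable_restrict_space2 funcsetI Y'Z; simp)+
  have pair_m: "Y' \<in> measurable \<Omega> (?R \<Otimes>\<^sub>M ?R)"
    using measurable_Pair[OF fst_m snd_m] by simp
  define Q where "Q = distr \<Omega> ?R (\<lambda>\<omega>. fst (Y' \<omega>))"
  define P' where "P' = distr \<Omega> ?R (\<lambda>\<omega>. snd (Y' \<omega>))"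
  define \<rho> where "\<rho> = distr \<Omega> (?R \<Otimes>\<^sub>M ?R) Y'"
  have QZ: "Q \<in> prob_dists Z" "P' \<in> prob_dists Z"
    unfolding Q_def P'_def prob_dists_def by (auto intro!: \<Omega>.prob_space_distr fst_m snd_m)
  have w1: "wconv Z (Qs \<circ> r) Q"
    unfolding wconv_def
  proof (intro allI impI)
    fix \<phi> :: "'a \<Rightarrow> ennreal" assume \<phi>: "lsc_on Z \<phi>"
    have \<phi>m: "\<phi> \<in> borel_measurable ?R" by (rule lsc_on_borel_measurable_restrict[OF Z \<phi>])
    have "(\<integral>\<^sup>+z. \<phi> z \<partial>Q) = (\<integral>\<^sup>+\<omega>. \<phi> (fst (Y' \<omega>)) \<partial>\<Omega>)"
      unfolding Q_def by (rule nn_integral_distr[OF fst_m]) (use \<phi>m in simp)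
    also have "\<dots> = (\<integral>\<^sup>+\<omega>. extend_top Z \<phi> (fst (Y \<omega>)) \<partial>\<Omega>)"
    proof (rule nn_integral_cong_AE)
      show "AE \<omega> in \<Omega>. \<phi> (fst (Y' \<omega>)) = extend_top Z \<phi> (fst (Y \<omega>))"
      proof (rule eventually_mono[OF YY'])
        fix \<omega> assume "Y' \<omega> = Y \<omega>"
        then show "\<phi> (fst (Y' \<omega>)) = extend_top Z \<phi> (fst (Y \<omega>))"
          using Y'Z[of \<omega>] by (simp add: extend_top_def)
      qed
    qed
    also have "\<dots> \<le> liminf (\<lambda>n. \<integral>\<^sup>+w. extend_top Z \<phi> (fst w) \<partial>\<pi> (r n))"
    proof (rule fatou)
      fix a :: ennreal assume "a < \<infinity>"
      from closed_sublevel_extend_top[OF Z \<phi> this]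
      have "closed (fst -` {x. extend_top Z \<phi> x \<le> a})" by (rule closed_vimage_fst)
      then show "closed {w :: 'a \<times> 'a. extend_top Z \<phi> (fst w) \<le> a}" by (simp add: vimage_def)
    qed
    also have "(\<lambda>n. \<integral>\<^sup>+w. extend_top Z \<phi> (fst w) \<partial>\<pi> (r n)) = (\<lambda>n. \<integral>\<^sup>+z. \<phi> z \<partial>(Qs \<circ> r) n)"
    proof
      fix n
      have "(\<integral>\<^sup>+w. extend_top Z \<phi> (fst w) \<partial>\<pi> (r n)) = (\<integral>\<^sup>+w. \<phi> (fst w) \<partial>\<pi> (r n))"
        using cf(3) by (intro nn_integral_cong) (auto simp: extend_top_def)
      then show "(\<integral>\<^sup>+w. extend_top Z \<phi> (fst w) \<partial>\<pi> (r n)) = (\<integral>\<^sup>+z. \<phi> z \<partial>(Qs \<circ> r) n)"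
        using cf(4)[OF \<phi>m] by simp
    qed
    finally show "(\<integral>\<^sup>+z. \<phi> z \<partial>Q) \<le> liminf (\<lambda>n. \<integral>\<^sup>+z. \<phi> z \<partial>(Qs \<circ> r) n)" .
  qed
  have w2: "wconv Z (\<lambda>_. P) P'"
    unfolding wconv_def
  proof (intro allI impI)
    fix \<phi> :: "'a \<Rightarrow> ennreal" assume \<phi>: "lsc_on Z \<phi>"
    have \<phi>m: "\<phi> \<in> borel_measurable ?R" by (rule lsc_on_borel_measurable_restrict[OF Z \<phi>])
    have "(\<integral>\<^sup>+z. \<phi> z \<partial>P') = (\<integral>\<^sup>+\<omega>. \<phi> (snd (Y' \<omega>)) \<partial>\<Omega>)"
      unfolding P'_def by (rule nn_integral_distr[OF snd_m]) (use \<phi>m in simp)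
    also have "\<dots> = (\<integral>\<^sup>+\<omega>. extend_top Z \<phi> (snd (Y \<omega>)) \<partial>\<Omega>)"
    proof (rule nn_integral_cong_AE)
      show "AE \<omega> in \<Omega>. \<phi> (snd (Y' \<omega>)) = extend_top Z \<phi> (snd (Y \<omega>))"
      proof (rule eventually_mono[OF YY'])
        fix \<omega> assume "Y' \<omega> = Y \<omega>"
        then show "\<phi> (snd (Y' \<omega>)) = extend_top Z \<phi> (snd (Y \<omega>))"
          using Y'Z[of \<omega>] by (simp add: extend_top_def)
      qed
    qed
    also have "\<dots> \<le> liminf (\<lambda>n. \<integral>\<^sup>+w. extend_top Z \<phi> (snd w) \<partial>\<pi> (r n))"
    proof (rule fatou)
      fix a :: ennreal assume "a < \<infinity>"
      from closed_sublevel_extend_top[OF Z \<phi> this]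
      have "closed (snd -` {x. extend_top Z \<phi> x \<le> a})" by (rule closed_vimage_snd)
      then show "closed {w :: 'a \<times> 'a. extend_top Z \<phi> (snd w) \<le> a}" by (simp add: vimage_def)
    qed
    also have "(\<lambda>n. \<integral>\<^sup>+w. extend_top Z \<phi> (snd w) \<partial>\<pi> (r n)) = (\<lambda>n. \<integral>\<^sup>+z. \<phi> z \<partial>P)"
    proof
      fix n
      have "(\<integral>\<^sup>+w. extend_top Z \<phi> (snd w) \<partial>\<pi> (r n)) = (\<integral>\<^sup>+w. \<phi> (snd w) \<partial>\<pi> (r n))"
        using cf(3) by (intro nn_integral_cong) (auto simp: extend_top_def)
      then show "(\<integral>\<^sup>+w. extend_top Z \<phi> (snd w) \<partial>\<pi> (r n)) = (\<integral>\<^sup>+z. \<phi> z \<partial>P)"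
        using cf(5)[OF \<phi>m] by simp
    qed
    finally show "(\<integral>\<^sup>+z. \<phi> z \<partial>P') \<le> liminf (\<lambda>n. \<integral>\<^sup>+z. \<phi> z \<partial>P)" .
  qed
  have P'P: "P' = P" by (rule wconv_const_eq[OF Z P QZ(2) w2])
  have sQ: "sets Q = sets ?R" "sets P = sets ?R" using QZ P by (auto simp: prob_dists_def)
  have "\<rho> \<in> couplings Q P"
  proof -
    have "distr \<rho> Q fst = Q"
    proof -
      have "distr \<rho> Q fst = distr \<rho> ?R fst" by (rule distr_cong) (simp_all add: sQ)
      also have "\<dots> = Q" unfolding \<rho>_def Q_def using pair_m by (subst distr_distr) (auto simp: comp_def)
      finally show ?thesis .
    qed
    moreover have "distr \<rho> P snd = P"
    proof -
      have "distr \<rho> P snd = distr \<rho> ?R snd" by (rule distr_cong) (simp_all add: sQ)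
      also have "\<dots> = P'" unfolding \<rho>_def P'_def using pair_m by (subst distr_distr) (auto simp: comp_def)
      finally show ?thesis by (simp add: P'P)
    qed
    ultimately show ?thesis
      unfolding couplings_def using \<Omega>.prob_space_distr[OF pair_m] sets_pair_measure_cong[OF sQ]
      by (simp add: \<rho>_def)
  qed
  moreover have "(\<integral>\<^sup>+w. c (fst w) (snd w) \<partial>\<rho>) \<le> ennreal \<epsilon>"
  proof -
    have "(\<integral>\<^sup>+w. c (fst w) (snd w) \<partial>\<rho>) = (\<integral>\<^sup>+\<omega>. c (fst (Y' \<omega>)) (snd (Y' \<omega>)) \<partial>\<Omega>)"
      unfolding \<rho>_def by (rule nn_integral_distr[OF pair_m]) (simp add: cost_measurable[OF Z c])
    also have "\<dots> = (\<integral>\<^sup>+\<omega>. ?G (Y \<omega>) \<partial>\<Omega>)"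
    proof (rule nn_integral_cong_AE)
      show "AE \<omega> in \<Omega>. c (fst (Y' \<omega>)) (snd (Y' \<omega>)) = ?G (Y \<omega>)"
        using YZ by eventually_elim (auto simp: Y'_def extend_top_def)
    qed
    finally show ?thesis using cost by simp
  qed
  ultimately have "ot_discrepancy c Q P \<le> ennreal \<epsilon>"
    unfolding ot_discrepancy_def by (rule INF_lower2)
  then have "Q \<in> ot_ball c Z P \<epsilon>" using QZ(1) by (simp add: ot_ball_def)
  with r w1 show ?thesis by blast
qed

end

section \<open>Compactness in the decision\<close>

lemma usc_on_uminus: "usc_on S f \<Longrightarrow> lsc_on S (\<lambda>x. - f x :: ereal)"
  unfolding usc_on_def lsc_on_def ereal_Liminf_uminus by simp

text \<open>Raising by \<open>K\<close> and cutting at 0 is monotone, and a level \<open>y\<close>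
  of the result corresponds to the level \<open>y - K\<close> of \<open>f\<close>.\<close>

lemma lsc_on_shift:
  assumes "lsc_on S f"
  shows "lsc_on S (\<lambda>x. e2ennreal (f x + ereal K))"
  unfolding lsc_on_def le_Liminf_iff
proof (intro ballI allI impI)
  fix x y assume x: "x \<in> S" and y: "y < e2ennreal (f x + ereal K)"
  obtain y' where y': "y = ennreal y'" "0 \<le> y'" using y by (cases y) auto
  have iff: "y < e2ennreal (a + ereal K) \<longleftrightarrow> ereal (y' - K) < a" for a
    using y' by (cases a) (auto simp: ennreal_less_iff e2ennreal_neg)
  have "\<forall>\<^sub>F z in at x within S. ereal (y' - K) < f z"
    using assms x y unfolding iff lsc_on_def le_Liminf_iff by blast
  then show "\<forall>\<^sub>F z in at x within S. y < e2ennreal (f z + ereal K)" unfolding iff .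
qed

lemma lsc_on_le_liminf:
  fixes X :: "nat \<Rightarrow> 'a::topological_space"
  assumes f: "lsc_on S f" and X: "X \<longlonglongrightarrow> x" "\<And>n. X n \<in> S" "x \<in> S"
  shows "f x \<le> liminf (\<lambda>n. f (X n))"
  unfolding le_Liminf_iff
proof (intro allI impI)
  fix y assume y: "y < f x"
  then have "\<forall>\<^sub>F z in at x within S. y < f z"
    using f X(3) unfolding lsc_on_def le_Liminf_iff by blast
  then obtain T where T: "open T" "x \<in> T" "\<And>z. z \<in> T \<Longrightarrow> z \<noteq> x \<Longrightarrow> z \<in> S \<Longrightarrow> y < f z"
    unfolding eventually_at_topological by auto
  have "\<forall>\<^sub>F n in sequentially. X n \<in> T" using X(1) T(1,2) by (rule topological_tendstoD)
  then show "\<forall>\<^sub>F n in sequentially. y < f (X n)"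
  proof eventually_elim
    case (elim n)
    then show ?case using T(3)[of "X n"] X(2) y by (cases "X n = x") auto
  qed
qed

text \<open>Otherwise all the closed sublevel sets are non-empty, and a common point would have the
  value \<open>-\<infinity>\<close>.\<close>

lemma bounded_below_compact:
  fixes f :: "'a::t2_space \<Rightarrow> ereal"
  assumes K: "compact K" and cl: "\<And>a::real. closed {x \<in> K. f x \<le> ereal a}"
    and nf: "\<And>x. x \<in> K \<Longrightarrow> f x \<noteq> -\<infinity>"
  shows "\<exists>m::real. \<forall>x\<in>K. ereal m \<le> f x"
proof (rule ccontr)
  assume "\<nexists>m::real. \<forall>x\<in>K. ereal m \<le> f x"
  then have ex: "\<exists>x\<in>K. f x < ereal m" for m :: real by (auto simp: not_le)
  have "K \<inter> \<Inter>((\<lambda>a. {x \<in> K. f x \<le> ereal a}) ` UNIV) \<noteq> {}"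
  proof (rule compact_imp_fip[OF K])
    fix F' assume "finite F'" "F' \<subseteq> (\<lambda>a. {x \<in> K. f x \<le> ereal a}) ` UNIV"
    then obtain F where F: "finite F" "F' = (\<lambda>a. {x \<in> K. f x \<le> ereal a}) ` F"
      by (meson finite_subset_image)
    obtain x where x: "x \<in> K" "f x < ereal (Min (insert 0 F))" using ex by blast
    have "f x \<le> ereal a" if "a \<in> F" for a
    proof -
      have "Min (insert 0 F) \<le> a" using F(1) that by (intro Min_le) auto
      then have "ereal (Min (insert 0 F)) \<le> ereal a" by simp
      with x(2) show ?thesis by order
    qed
    then show "K \<inter> \<Inter>F' \<noteq> {}" using x(1) F(2) by auto
  qed (use cl in auto)
  then obtain x where "x \<in> K" "\<And>a::real. f x \<le> ereal a" by auto
  then show False using nf[of x] ereal_bot by metis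
qed

lemma SUP_INF_le_INF_SUP:
  fixes F :: "'q \<Rightarrow> 't \<Rightarrow> 'a::complete_lattice"
  shows "(SUP q\<in>B. INF t\<in>T. F q t) \<le> (INF t\<in>T. SUP q\<in>B. F q t)"
  by (intro SUP_least INF_greatest) (meson INF_lower SUP_upper order_trans)

lemma expect_loss_convex:
  fixes loss :: "'t::real_vector \<Rightarrow> 'z \<Rightarrow> ereal"
  assumes "\<And>z. z \<in> space Q \<Longrightarrow> ereal_convex_on \<Theta> (\<lambda>\<theta>. loss \<theta> z)"
    and \<theta>: "\<theta> \<in> \<Theta>" "\<theta>' \<in> \<Theta>" and u: "0 < u" "u < 1"
  shows "expect Q (loss (u *\<^sub>R \<theta> + (1 - u) *\<^sub>R \<theta>')) \<le>
    expect Q (\<lambda>z. ereal u * loss \<theta> z + ereal (1 - u) * loss \<theta>' z)"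
  using assms by (intro expect_mono) (auto simp: ereal_convex_on_def)

lemma expect_mix:
  assumes M: "prob_space M" "prob_space N" "sets N = sets M" and u: "0 < u" "u < 1"
    and f: "f \<in> borel_measurable M" and fin: "neg_int M f < \<infinity>" "neg_int N f < \<infinity>"
  shows "expect (mix u M N) f = ereal u * expect M f + ereal (1 - u) * expect N f"
proof -
  have m: "(\<lambda>x. e2ennreal (f x)) \<in> borel_measurable M" "(\<lambda>x. e2ennreal (- f x)) \<in> borel_measurable M"
    using f by measurable
  show ?thesis
    using fin u unfolding expect_def nn_integral_mix[OF M u m(1)] nn_integral_mix[OF M u m(2)]
      plus_ennreal.rep_eq times_ennreal.rep_eq
    by (cases "neg_int M f"; cases "neg_int N f"; cases "pos_int M f"; cases "pos_int N f")
      (auto simp: algebra_simps)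
qed

text \<open>Compares the tail functional in the definition of uniform integrability with the tail
  left by truncation, and with the whole negative part.\<close>

lemma neg_tail_le:
  assumes "0 < K"
  shows "e2ennreal (- x - ereal K) \<le> e2ennreal \<bar>- min 0 x\<bar> * of_bool (ereal K \<le> \<bar>- min 0 x\<bar>)"
    "e2ennreal (- x) \<le> ennreal K + e2ennreal \<bar>- min 0 x\<bar> * of_bool (ereal K \<le> \<bar>- min 0 x\<bar>)"
proof -
  show "e2ennreal (- x - ereal K) \<le> e2ennreal \<bar>- min 0 x\<bar> * of_bool (ereal K \<le> \<bar>- min 0 x\<bar>)"
    using assms by (cases x) (auto simp: min_def e2ennreal_neg ennreal_neg intro!: ennreal_leI)
  show "e2ennreal (- x) \<le> ennreal K + e2ennreal \<bar>- min 0 x\<bar> * of_bool (ereal K \<le> \<bar>- min 0 x\<bar>)"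
    using assms by (cases x) (auto simp: min_def e2ennreal_neg ennreal_neg add_increasing intro!: ennreal_leI)
qed

context
  fixes \<Theta> :: "'t::euclidean_space set" and Z :: "'z::topological_space set"
    and loss :: "'t \<Rightarrow> 'z \<Rightarrow> ereal" and B :: "'z measure set"
  assumes \<Theta>: "closed \<Theta>" "convex \<Theta>"
    and B: "B \<subseteq> prob_dists Z"
    and B_mix: "\<And>Q Q' u. \<lbrakk>Q \<in> B; Q' \<in> B; 0 < u; u < 1\<rbrakk> \<Longrightarrow> mix u Q Q' \<in> B"
    and meas: "\<And>\<theta> Q. \<theta> \<in> \<Theta> \<Longrightarrow> Q \<in> B \<Longrightarrow> loss \<theta> \<in> borel_measurable Q"
    and cvx: "\<And>z. z \<in> Z \<Longrightarrow> ereal_convex_on \<Theta> (\<lambda>\<theta>. loss \<theta> z)"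
    and lsc: "lsc_in_decision \<Theta> Z loss"
    and ui: "loc_unif_integrable_neg_part B \<Theta> loss"
    and infc: "inf_compact_for_some B \<Theta> loss"
begin

lemma B_prob: "Q \<in> B \<Longrightarrow> prob_space Q" and B_space: "Q \<in> B \<Longrightarrow> space Q = Z"
  and B_sets: "Q \<in> B \<Longrightarrow> Q' \<in> B \<Longrightarrow> sets Q' = sets Q"
  using B space_prob_dists[of Q Z] by (auto simp: prob_dists_def)

text \<open>One function \<open>\<tau>\<close> serves all decisions near
  \<open>\<theta>\<^sub>0\<close>: its decay feeds the truncation argument, its finiteness for large
  \<open>K\<close> the integrability of negative parts.\<close>

lemma local_tail:
  assumes "Q \<in> B" "\<theta>\<^sub>0 \<in> \<Theta>"
  obtains U and \<tau> :: "real \<Rightarrow> ennreal" where "open U" "\<theta>\<^sub>0 \<in> U" "(\<tau> \<longlongrightarrow> 0) at_top"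
    "\<And>\<theta> K. \<lbrakk>\<theta> \<in> U \<inter> \<Theta>; 0 < K\<rbrakk> \<Longrightarrow> (\<integral>\<^sup>+z. e2ennreal (- loss \<theta> z - ereal K) \<partial>Q) \<le> \<tau> K"
    "\<And>\<theta> K. \<lbrakk>\<theta> \<in> U \<inter> \<Theta>; 0 < K\<rbrakk> \<Longrightarrow> neg_int Q (loss \<theta>) \<le> ennreal K + \<tau> K"
proof -
  interpret prob_space Q by (rule B_prob) fact
  obtain U where U: "open U" "\<theta>\<^sub>0 \<in> U" "uniformly_integrable Q (U \<inter> \<Theta>) (\<lambda>\<theta> z. - min 0 (loss \<theta> z))"
    using ui assms unfolding loc_unif_integrable_neg_part_def by blast
  define t where "t K \<theta> z = e2ennreal \<bar>- min 0 (loss \<theta> z)\<bar> * indicator {z. ereal K \<le> \<bar>- min 0 (loss \<theta> z)\<bar>} z"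
    for K :: real and \<theta> z
  have t: "t K \<theta> z = e2ennreal \<bar>- min 0 (loss \<theta> z)\<bar> * of_bool (ereal K \<le> \<bar>- min 0 (loss \<theta> z)\<bar>)" for K \<theta> z
    by (simp add: t_def indicator_def)
  define \<tau> where "\<tau> K = (SUP \<theta>\<in>U \<inter> \<Theta>. \<integral>\<^sup>+z. t K \<theta> z \<partial>Q)" for K
  have \<tau>: "(\<integral>\<^sup>+z. t K \<theta> z \<partial>Q) \<le> \<tau> K" if "\<theta> \<in> U \<inter> \<Theta>" for \<theta> K
    unfolding \<tau>_def by (rule SUP_upper[OF that])
  show ?thesis
  proof (rule that[OF U(1,2)])
    show "(\<tau> \<longlongrightarrow> 0) at_top"
      using U(3) unfolding uniformly_integrable_def \<tau>_def t_def by simp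
    fix \<theta> and K :: real assume \<theta>: "\<theta> \<in> U \<inter> \<Theta>" and K: "0 < K"
    have [measurable]: "loss \<theta> \<in> borel_measurable Q" using meas \<theta> assms(1) by auto
    have [measurable]: "t K \<theta> \<in> borel_measurable Q" unfolding t of_bool_def by measurable
    show "(\<integral>\<^sup>+z. e2ennreal (- loss \<theta> z - ereal K) \<partial>Q) \<le> \<tau> K"
      using neg_tail_le(1)[OF K] by (intro order_trans[OF nn_integral_mono \<tau>[OF \<theta>]]) (simp add: t)
    have "neg_int Q (loss \<theta>) \<le> (\<integral>\<^sup>+z. ennreal K + t K \<theta> z \<partial>Q)"
      using neg_tail_le(2)[OF K] by (intro nn_integral_mono) (simp add: t)
    also have "\<dots> = ennreal K + (\<integral>\<^sup>+z. t K \<theta> z \<partial>Q)"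
      by (subst nn_integral_add) (auto simp: emeasure_space_1)
    also have "\<dots> \<le> ennreal K + \<tau> K" by (intro add_left_mono \<tau> \<theta>)
    finally show "neg_int Q (loss \<theta>) \<le> ennreal K + \<tau> K" .
  qed
qed

lemma neg_int_loss_finite:
  assumes "Q \<in> B" "\<theta> \<in> \<Theta>"
  shows "neg_int Q (loss \<theta>) < \<infinity>"
proof -
  obtain U and \<tau> :: "real \<Rightarrow> ennreal" where U: "\<theta> \<in> U" "(\<tau> \<longlongrightarrow> 0) at_top"
    "\<And>\<theta> K. \<lbrakk>\<theta> \<in> U \<inter> \<Theta>; 0 < K\<rbrakk> \<Longrightarrow> neg_int Q (loss \<theta>) \<le> ennreal K + \<tau> K"
    using local_tail[OF assms] by metis
  have "\<forall>\<^sub>F K in at_top. \<tau> K < 1" by (rule order_tendstoD(2)[OF U(2)]) simp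
  then have "\<forall>\<^sub>F K in at_top. \<tau> K < 1 \<and> 1 \<le> K" by (intro eventually_conj eventually_ge_at_top)
  then obtain K where K: "\<tau> K < 1" "1 \<le> K" unfolding eventually_at_top_linorder by blast
  have "neg_int Q (loss \<theta>) \<le> ennreal K + \<tau> K" using U assms K by (intro U(3)) auto
  also have "\<dots> < \<infinity>" using K(1) by (auto intro: less_trans)
  finally show ?thesis .
qed

lemma closed_risk_sublevel:
  assumes Q: "Q \<in> B"
  shows "closed {\<theta> \<in> \<Theta>. expect Q (loss \<theta>) \<le> ereal a}"
  unfolding closed_sequential_limits
proof (intro allI impI, elim conjE)
  fix x \<theta> assume x: "\<forall>n. x n \<in> {\<theta> \<in> \<Theta>. expect Q (loss \<theta>) \<le> ereal a}" and lim: "x \<longlonglongrightarrow> \<theta>"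
  have \<theta>: "\<theta> \<in> \<Theta>" using closed_sequentially[OF \<Theta>(1) _ lim] x by auto
  obtain U and \<tau> :: "real \<Rightarrow> ennreal" where U: "open U" "\<theta> \<in> U" and \<tau>: "(\<tau> \<longlongrightarrow> 0) at_top"
    "\<And>\<theta> K. \<lbrakk>\<theta> \<in> U \<inter> \<Theta>; 0 < K\<rbrakk> \<Longrightarrow> (\<integral>\<^sup>+z. e2ennreal (- loss \<theta> z - ereal K) \<partial>Q) \<le> \<tau> K"
    using local_tail[OF Q \<theta>] by metis
  obtain N where N: "\<And>n. n \<ge> N \<Longrightarrow> x n \<in> U"
    using topological_tendstoD[OF lim U] unfolding eventually_sequentially by blast
  \<comment> \<open>Tails are uniform only near \<open>\<theta>\<close>, so the terms outside
    \<open>U\<close> are dropped.\<close>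
  define y where "y n = x (n + N)" for n
  have y: "y n \<in> U \<inter> \<Theta>" "expect Q (loss (y n)) \<le> ereal a" for n
    using x N by (auto simp: y_def)
  have ylim: "y \<longlonglongrightarrow> \<theta>" unfolding y_def by (rule LIMSEQ_ignore_initial_segment[OF lim])
  have "expect Q (loss \<theta>) \<le> ereal a"
  proof (rule expect_le_limit[where g = "\<lambda>n. loss (y n)" and N = "\<lambda>_. Q"])
    fix K :: real assume "0 < K"
    have "(\<integral>\<^sup>+z. e2ennreal (loss \<theta> z + ereal K) \<partial>Q) \<le> (\<integral>\<^sup>+z. liminf (\<lambda>n. e2ennreal (loss (y n) z + ereal K)) \<partial>Q)"
    proof (rule nn_integral_mono)
      fix z assume "z \<in> space Q"
      then have "lsc_on \<Theta> (\<lambda>\<theta>. loss \<theta> z)" using lsc B_space[OF Q] by (simp add: lsc_in_decision_def)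
      from lsc_on_shift[OF this] show "e2ennreal (loss \<theta> z + ereal K) \<le> liminf (\<lambda>n. e2ennreal (loss (y n) z + ereal K))"
        by (rule lsc_on_le_liminf[OF _ ylim _ \<theta>]) (use y in auto)
    qed
    also have "\<dots> \<le> liminf (\<lambda>n. \<integral>\<^sup>+z. e2ennreal (loss (y n) z + ereal K) \<partial>Q)"
    proof (rule nn_integral_liminf)
      fix n
      have [measurable]: "loss (y n) \<in> borel_measurable Q" using meas y Q by auto
      show "(\<lambda>z. e2ennreal (loss (y n) z + ereal K)) \<in> borel_measurable Q" by measurable
    qed
    finally show "(\<integral>\<^sup>+z. e2ennreal (loss \<theta> z + ereal K) \<partial>Q) \<le> liminf (\<lambda>n. \<integral>\<^sup>+z. e2ennreal (loss (y n) z + ereal K) \<partial>Q)" .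
  next
    show "neg_int Q (loss \<theta>) < \<infinity>" by (rule neg_int_loss_finite[OF Q \<theta>])
    show "neg_int Q (loss (y n)) < \<infinity>" for n using y by (intro neg_int_loss_finite[OF Q]) auto
  qed (use \<tau> y \<theta> Q in \<open>auto intro!: B_prob meas\<close>)
  then show "\<theta> \<in> {\<theta> \<in> \<Theta>. expect Q (loss \<theta>) \<le> ereal a}" using \<theta> by simp
qed

lemma risk_convex:
  assumes "\<theta> \<in> \<Theta>" "\<theta>' \<in> \<Theta>" "0 < u" "u < 1" "Q \<in> B"
  shows "expect Q (loss (u *\<^sub>R \<theta> + (1 - u) *\<^sub>R \<theta>')) \<le>
    ereal u * expect Q (loss \<theta>) + ereal (1 - u) * expect Q (loss \<theta>')"
proof -
  have "expect Q (loss (u *\<^sub>R \<theta> + (1 - u) *\<^sub>R \<theta>')) \<le>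
      expect Q (\<lambda>z. ereal u * loss \<theta> z + ereal (1 - u) * loss \<theta>' z)"
    using assms B_space cvx by (intro expect_loss_convex) auto
  also have "\<dots> = ereal u * expect Q (loss \<theta>) + ereal (1 - u) * expect Q (loss \<theta>')"
    using assms by (intro expect_combination meas neg_int_loss_finite) auto
  finally show ?thesis .
qed

lemma risk_mix:
  assumes "Q \<in> B" "Q' \<in> B" "0 < u" "u < 1" "\<theta> \<in> \<Theta>"
  shows "expect (mix u Q Q') (loss \<theta>) = ereal u * expect Q (loss \<theta>) + ereal (1 - u) * expect Q' (loss \<theta>)"
  using assms by (intro expect_mix B_prob B_sets meas neg_int_loss_finite) auto

lemma \<Theta>_combination: "\<theta> \<in> \<Theta> \<Longrightarrow> \<theta>' \<in> \<Theta> \<Longrightarrow> 0 < u \<Longrightarrow> u < 1 \<Longrightarrow> u *\<^sub>R \<theta> + (1 - u) *\<^sub>R \<theta>' \<in> \<Theta>"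
  using \<Theta>(2) by (auto simp: convex_alt convexD)

lemma risk_bounded_below:
  assumes "compact K" "K \<subseteq> \<Theta>" "Q \<in> B"
  shows "\<exists>m::real. \<forall>\<theta>\<in>K. ereal m \<le> expect Q (loss \<theta>)"
proof (rule bounded_below_compact[OF assms(1)])
  fix a :: real
  have "{\<theta> \<in> K. expect Q (loss \<theta>) \<le> ereal a} = K \<inter> {\<theta> \<in> \<Theta>. expect Q (loss \<theta>) \<le> ereal a}"
    using assms(2) by auto
  then show "closed {\<theta> \<in> K. expect Q (loss \<theta>) \<le> ereal a}"
    using assms by (simp add: closed_Int closed_risk_sublevel compact_imp_closed)
qed (use assms in \<open>auto intro!: expect_not_MInfty neg_int_loss_finite\<close>)

text \<open>Risks are bounded below only on compact sets, so the finite alternative is confined to a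
  sublevel set \<open>K\<close> of the inf-compact risk. Outside \<open>K\<close> that risk itself
  is above \<open>\<beta>\<close>, and a mixture of its distribution \<open>Q0\<close> with the one
  found for \<open>K\<close> covers all of \<open>\<Theta>\<close>.\<close>

lemma primal_separation:
  fixes \<alpha> \<beta> :: real
  assumes "\<alpha> < \<beta>" and gt: "\<And>\<theta>. \<theta> \<in> \<Theta> \<Longrightarrow> \<exists>Q\<in>B. ereal \<beta> < expect Q (loss \<theta>)"
  shows "\<exists>Q\<in>B. \<forall>\<theta>\<in>\<Theta>. ereal \<alpha> < expect Q (loss \<theta>)"
proof -
  obtain Q0 where Q0: "Q0 \<in> B" and comp: "\<And>t::real. compact {\<theta> \<in> \<Theta>. expect Q0 (loss \<theta>) \<le> ereal t}"
    using infc by (auto simp: inf_compact_for_some_def inf_compact_on_def)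
  define K where "K = {\<theta> \<in> \<Theta>. expect Q0 (loss \<theta>) \<le> ereal \<beta>}"
  have K: "compact K" "K \<subseteq> \<Theta>" using comp by (auto simp: K_def)
  obtain \<gamma> where \<gamma>: "\<alpha> < \<gamma>" "\<gamma> < \<beta>" using dense[OF assms(1)] by auto
  \<comment> \<open>If no finite set sufficed, the closed sets on which a risk is at most
    \<open>\<beta>\<close> would meet in a point of \<open>K\<close>, contrary to
    \<open>gt\<close>.\<close>
  have "\<exists>S\<subseteq>B. finite S \<and> (\<forall>\<theta>\<in>K. \<exists>Q\<in>S. ereal \<beta> < expect Q (loss \<theta>))"
  proof (rule ccontr)
    assume neg: "\<not> ?thesis"
    have "K \<inter> \<Inter>((\<lambda>Q. {\<theta> \<in> \<Theta>. expect Q (loss \<theta>) \<le> ereal \<beta>}) ` B) \<noteq> {}"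
    proof (rule compact_imp_fip[OF K(1)])
      fix F' assume "finite F'" "F' \<subseteq> (\<lambda>Q. {\<theta> \<in> \<Theta>. expect Q (loss \<theta>) \<le> ereal \<beta>}) ` B"
      then obtain S where S: "S \<subseteq> B" "finite S" "F' = (\<lambda>Q. {\<theta> \<in> \<Theta>. expect Q (loss \<theta>) \<le> ereal \<beta>}) ` S"
        by (meson finite_subset_image)
      then obtain \<theta> where "\<theta> \<in> K" "\<forall>Q\<in>S. expect Q (loss \<theta>) \<le> ereal \<beta>"
        using neg by (auto simp: not_less)
      then show "K \<inter> \<Inter>F' \<noteq> {}" using S(3) K(2) by auto
    qed (use closed_risk_sublevel in auto)
    then show False using gt Q0 by (fastforce simp: not_le[symmetric])
  qed
  then obtain S where S: "S \<subseteq> B" "finite S" "\<And>\<theta>. \<theta> \<in> K \<Longrightarrow> \<exists>Q\<in>S. ereal \<beta> < expect Q (loss \<theta>)" by auto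
  have "\<exists>Q\<in>B. \<forall>\<theta>\<in>K. ereal \<gamma> < expect Q (loss \<theta>)"
  proof (rule convexlike_finite_alternative[OF S(2,1), where \<beta> = \<beta> and F = "\<lambda>Q \<theta>. expect Q (loss \<theta>)"])
    show "B \<noteq> {}" using Q0 by auto
    show "\<exists>Q''\<in>B. \<forall>\<theta>\<in>K. ereal t * expect Q (loss \<theta>) + ereal (1 - t) * expect Q' (loss \<theta>) \<le> expect Q'' (loss \<theta>)"
      if "Q \<in> B" "Q' \<in> B" "0 < t" "t < 1" for Q Q' t
      using that K(2) by (intro bexI[of _ "mix t Q Q'"] ballI) (auto simp: risk_mix B_mix subset_eq)
    show "\<exists>w\<in>K. \<forall>Q\<in>B. expect Q (loss w) \<le> ereal u * expect Q (loss \<theta>) + ereal (1 - u) * expect Q (loss \<theta>')"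
      if \<theta>: "\<theta> \<in> K" "\<theta>' \<in> K" and u: "0 < u" "u < 1" for \<theta> \<theta>' u
    proof -
      let ?w = "u *\<^sub>R \<theta> + (1 - u) *\<^sub>R \<theta>'"
      have \<theta>\<Theta>: "\<theta> \<in> \<Theta>" "\<theta>' \<in> \<Theta>" using \<theta> K(2) by auto
      have cv: "\<forall>Q\<in>B. expect Q (loss ?w) \<le> ereal u * expect Q (loss \<theta>) + ereal (1 - u) * expect Q (loss \<theta>')"
        using risk_convex[OF \<theta>\<Theta> u] by auto
      moreover have "expect Q0 (loss ?w) \<le> ereal \<beta>"
        using \<theta> u Q0 cv by (intro order_trans[OF bspec[OF cv Q0] ereal_convex_bound]) (auto simp: K_def)
      ultimately show ?thesis using \<Theta>_combination[OF \<theta>\<Theta> u] by (intro bexI[of _ ?w]) (auto simp: K_def)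
    qed
    show "expect Q (loss \<theta>) \<noteq> -\<infinity>" if "\<theta> \<in> K" "Q \<in> B" for \<theta> Q
      using that K(2) by (auto intro!: expect_not_MInfty neg_int_loss_finite)
    show "\<exists>m::real. \<forall>\<theta>\<in>K. ereal m \<le> expect Q (loss \<theta>)" if "Q \<in> B" for Q
      by (rule risk_bounded_below[OF K that])
  qed (use S(3) \<gamma> in auto)
  then obtain Q1 where Q1: "Q1 \<in> B" "\<And>\<theta>. \<theta> \<in> K \<Longrightarrow> ereal \<gamma> < expect Q1 (loss \<theta>)" by auto
  have "\<exists>t. 0 < t \<and> t < 1 \<and> (\<forall>\<theta>\<in>\<Theta>. ereal \<alpha> < ereal t * expect Q0 (loss \<theta>) + ereal (1 - t) * expect Q1 (loss \<theta>))"
  proof (rule convex_alternative)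
    show "convexlike_pair \<Theta> (\<lambda>\<theta>. expect Q0 (loss \<theta>)) (\<lambda>\<theta>. expect Q1 (loss \<theta>))"
      unfolding convexlike_pair_def using risk_convex \<Theta>_combination Q0 Q1(1) by meson
    show "expect Q0 (loss \<theta>) \<noteq> -\<infinity>" "expect Q1 (loss \<theta>) \<noteq> -\<infinity>" if "\<theta> \<in> \<Theta>" for \<theta>
      using that Q0 Q1(1) by (auto intro!: expect_not_MInfty neg_int_loss_finite)
    show "\<exists>m::real. \<forall>\<theta>\<in>\<Theta>. expect Q0 (loss \<theta>) \<le> ereal L \<longrightarrow> ereal m \<le> expect Q1 (loss \<theta>)" for L
      using risk_bounded_below[OF comp[of L] _ Q1(1)] by auto
    show "\<exists>m::real. \<forall>\<theta>\<in>\<Theta>. ereal m \<le> expect Q0 (loss \<theta>)"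
    proof -
      obtain m :: real where m: "\<And>\<theta>. \<theta> \<in> \<Theta> \<Longrightarrow> expect Q0 (loss \<theta>) \<le> ereal 0 \<Longrightarrow> ereal m \<le> expect Q0 (loss \<theta>)"
        using risk_bounded_below[OF comp[of 0] _ Q0] by auto
      have "ereal (min m 0) \<le> expect Q0 (loss \<theta>)" if "\<theta> \<in> \<Theta>" for \<theta>
      proof (cases "expect Q0 (loss \<theta>) \<le> ereal 0")
        case True
        have "ereal (min m 0) \<le> ereal m" by simp
        also have "\<dots> \<le> expect Q0 (loss \<theta>)" using m[OF that True] .
        finally show ?thesis .
      next
        case False
        have "ereal (min m 0) \<le> ereal 0" by simp
        then show ?thesis using False by order
      qed
      then show ?thesis by blast
    qed
    show "ereal \<gamma> < expect Q0 (loss \<theta>) \<or> ereal \<gamma> < expect Q1 (loss \<theta>)" if "\<theta> \<in> \<Theta>" for \<theta>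
    proof (cases "\<theta> \<in> K")
      case False
      then have "ereal \<beta> < expect Q0 (loss \<theta>)" using that by (auto simp: K_def)
      moreover have "ereal \<gamma> < ereal \<beta>" using \<gamma> by simp
      ultimately show ?thesis by (blast intro: less_trans)
    qed (use Q1(2) in auto)
    show "\<alpha> < \<gamma>" by fact
  qed
  then obtain t where t: "0 < t" "t < 1"
    "\<And>\<theta>. \<theta> \<in> \<Theta> \<Longrightarrow> ereal \<alpha> < ereal t * expect Q0 (loss \<theta>) + ereal (1 - t) * expect Q1 (loss \<theta>)" by auto
  then show ?thesis
    using Q0 Q1(1) by (intro bexI[of _ "mix t Q0 Q1"]) (auto simp: risk_mix B_mix)
qed

lemma primal_minimax:
  "(INF \<theta>\<in>\<Theta>. SUP Q\<in>B. expect Q (loss \<theta>)) = (SUP Q\<in>B. INF \<theta>\<in>\<Theta>. expect Q (loss \<theta>))"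
proof (rule antisym[OF _ SUP_INF_le_INF_SUP], rule ccontr)
  assume "\<not> (INF \<theta>\<in>\<Theta>. SUP Q\<in>B. expect Q (loss \<theta>)) \<le> (SUP Q\<in>B. INF \<theta>\<in>\<Theta>. expect Q (loss \<theta>))"
  then have lt: "(SUP Q\<in>B. INF \<theta>\<in>\<Theta>. expect Q (loss \<theta>)) < (INF \<theta>\<in>\<Theta>. SUP Q\<in>B. expect Q (loss \<theta>))" by simp
  obtain \<alpha> :: real where \<alpha>: "(SUP Q\<in>B. INF \<theta>\<in>\<Theta>. expect Q (loss \<theta>)) < ereal \<alpha>"
    "ereal \<alpha> < (INF \<theta>\<in>\<Theta>. SUP Q\<in>B. expect Q (loss \<theta>))" using ereal_dense2[OF lt] by blast
  \<comment> \<open>A second level inside the supposed gap pays for the drop in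
    \<open>primal_separation\<close>.\<close>
  obtain \<beta> :: real where \<beta>: "\<alpha> < \<beta>" "ereal \<beta> < (INF \<theta>\<in>\<Theta>. SUP Q\<in>B. expect Q (loss \<theta>))"
    using ereal_dense2[OF \<alpha>(2)] by auto
  have "\<exists>Q\<in>B. ereal \<beta> < expect Q (loss \<theta>)" if "\<theta> \<in> \<Theta>" for \<theta>
    using less_INF_D[OF \<beta>(2) that] by (simp add: less_SUP_iff)
  from primal_separation[OF \<beta>(1) this] obtain Q where Q: "Q \<in> B" "\<forall>\<theta>\<in>\<Theta>. ereal \<alpha> < expect Q (loss \<theta>)" by blast
  have "ereal \<alpha> \<le> (INF \<theta>\<in>\<Theta>. expect Q (loss \<theta>))" using Q(2) by (intro INF_greatest less_imp_le) auto
  also have "\<dots> \<le> (SUP Q\<in>B. INF \<theta>\<in>\<Theta>. expect Q (loss \<theta>))" using Q(1) by (rule SUP_upper)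
  finally show False using \<alpha>(1) by simp
qed

text \<open>A finite worst case yields a real level \<open>t0\<close> above the optimal value. The
  sets \<open>T t\<close> for levels above the optimal value are nested, compact and non-empty, and
  a common point is a minimizer.\<close>

lemma primal_attained:
  assumes "finite_worst_case B \<Theta> loss"
  shows "\<exists>\<theta>\<^sub>0\<in>\<Theta>. (SUP Q\<in>B. expect Q (loss \<theta>\<^sub>0)) = (INF \<theta>\<in>\<Theta>. SUP Q\<in>B. expect Q (loss \<theta>))"
proof -
  let ?S = "\<lambda>\<theta>. SUP Q\<in>B. expect Q (loss \<theta>)"
  define v where "v = (INF \<theta>\<in>\<Theta>. ?S \<theta>)"
  obtain Q0 where Q0: "Q0 \<in> B" and comp: "\<And>t::real. compact {\<theta> \<in> \<Theta>. expect Q0 (loss \<theta>) \<le> ereal t}"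
    using infc by (auto simp: inf_compact_for_some_def inf_compact_on_def)
  obtain \<theta>1 where "\<theta>1 \<in> \<Theta>" "?S \<theta>1 < \<infinity>" using assms by (auto simp: finite_worst_case_def)
  then have "v < \<infinity>" unfolding v_def by (rule le_less_trans[OF INF_lower])
  then obtain t0 :: real where t0: "v < ereal t0" using ereal_dense2 by blast
  define T where "T t = {\<theta> \<in> \<Theta>. ?S \<theta> \<le> ereal t}" for t
  have T_eq: "T t = \<Inter>((\<lambda>Q. {\<theta> \<in> \<Theta>. expect Q (loss \<theta>) \<le> ereal t}) ` B)" for t
    using Q0 by (auto simp: T_def SUP_le_iff)
  have T_closed: "closed (T t)" for t
    unfolding T_eq by (intro closed_INT ballI closed_risk_sublevel)
  have T_compact: "compact (T t)" for t
  proof -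
    have "T t = {\<theta> \<in> \<Theta>. expect Q0 (loss \<theta>) \<le> ereal t} \<inter> T t" using Q0 by (auto simp: T_eq)
    then show ?thesis using compact_Int_closed[OF comp T_closed] by metis
  qed
  have "T t0 \<inter> \<Inter>(T ` {t. v < ereal t}) \<noteq> {}"
  proof (rule compact_imp_fip[OF T_compact])
    fix F' assume "finite F'" "F' \<subseteq> T ` {t. v < ereal t}"
    then obtain F where F: "F \<subseteq> {t. v < ereal t}" "finite F" "F' = T ` F" by (meson finite_subset_image)
    define s where "s = Min (insert t0 F)"
    have "s \<in> insert t0 F" unfolding s_def using F(2) by (intro Min_in) auto
    then have "v < ereal s" using t0 F(1) by auto
    then obtain \<theta> where \<theta>: "\<theta> \<in> \<Theta>" "?S \<theta> < ereal s" unfolding v_def INF_less_iff by blast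
    have "\<theta> \<in> T t" if "t \<in> insert t0 F" for t
    proof -
      have "s \<le> t" unfolding s_def using F(2) that by (intro Min_le) auto
      then have "ereal s \<le> ereal t" by simp
      then have "?S \<theta> \<le> ereal t" using \<theta>(2) by order
      then show ?thesis using \<theta>(1) by (simp add: T_def)
    qed
    then show "T t0 \<inter> \<Inter>F' \<noteq> {}" using F(3) by auto
  qed (use T_closed in auto)
  then obtain \<theta> where \<theta>: "\<theta> \<in> T t0" "\<And>t. v < ereal t \<Longrightarrow> \<theta> \<in> T t" by auto
  have "?S \<theta> \<le> v"
  proof (rule ccontr)
    assume "\<not> ?S \<theta> \<le> v"
    then obtain t :: real where "v < ereal t" "ereal t < ?S \<theta>" using ereal_dense2[of v "?S \<theta>"] by (auto simp: not_le)
    then show False using \<theta>(2)[of t] by (auto simp: T_def dest: leD)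
  qed
  moreover have "v \<le> ?S \<theta>" unfolding v_def using \<theta>(1) by (intro INF_lower) (simp add: T_def)
  ultimately show ?thesis using \<theta>(1) unfolding v_def by (intro bexI[of _ \<theta>]) (auto simp: T_def)
qed

end

section \<open>Compactness in the distribution\<close>

text \<open>Beyond the radius \<open>s\<close> one has
  \<open>D powr r = D ^ p * D powr (r - p)\<close> and the last factor is at most
  \<open>s powr (r - p)\<close>; the 2 absorbs the summand 1. As \<open>s\<close> grows, the weight
  of the \<open>p\<close>-th power tends to 0.\<close>

lemma growth_split:
  fixes D g r s :: real
  assumes "0 < g" "0 < r" "r < real p" "0 \<le> D" "1 \<le> s"
  shows "g * (1 + D powr r) \<le> g * (1 + s powr r) + 2 * g * s powr (r - real p) * D ^ p"
proof (cases "D \<le> s")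
  case True
  have "D powr r \<le> s powr r" using True assms by (intro powr_mono2) auto
  then have "g * (1 + D powr r) \<le> g * (1 + s powr r)" using assms by (intro mult_left_mono) auto
  then show ?thesis using assms by (intro add_increasing2) auto
next
  case False
  then have D: "1 \<le> D" "s \<le> D" using assms by auto
  have "D powr r = D powr real p * D powr (r - real p)" by (simp flip: powr_add)
  also have "\<dots> \<le> D powr real p * s powr (r - real p)"
    using assms D by (intro mult_left_mono powr_mono2') auto
  also have "D powr real p = D ^ p" using D by (simp add: powr_realpow)
  finally have "2 * g * D powr r \<le> 2 * g * (D ^ p * s powr (r - real p))"
    using assms by (intro mult_left_mono) auto
  moreover have "1 \<le> D powr r" using D assms by (intro ge_one_powr_ge_zero) auto
  then have "g * (1 + D powr r) \<le> g * (2 * D powr r)" using assms by (intro mult_left_mono) auto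
  moreover have "0 \<le> g * (1 + s powr r)" using assms by (auto intro!: mult_nonneg_nonneg add_nonneg_nonneg)
  ultimately show ?thesis by (simp add: algebra_simps)
qed

context
  fixes \<Theta> :: "'t::euclidean_space set" and Z :: "'z::euclidean_space set"
    and loss :: "'t \<Rightarrow> 'z \<Rightarrow> ereal" and c :: "'z \<Rightarrow> 'z \<Rightarrow> ennreal" and P :: "'z measure"
    and \<epsilon> :: real and d :: "'z \<Rightarrow> 'z \<Rightarrow> real" and p :: nat
  assumes \<Theta>: "convex \<Theta>" "\<Theta> \<noteq> {}"
    and Z: "closed Z"
    and not_MInf: "\<And>\<theta> z. loss \<theta> z \<noteq> -\<infinity>"
    and P: "P \<in> prob_dists Z"
    and c: "lsc_on (Z \<times> Z) (\<lambda>(z, z'). c z z')"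
    and usc: "\<And>\<theta>. \<theta> \<in> \<Theta> \<Longrightarrow> usc_on Z (loss \<theta>)"
    and meas: "\<And>\<theta> Q. \<theta> \<in> \<Theta> \<Longrightarrow> Q \<in> prob_dists Z \<Longrightarrow> loss \<theta> \<in> borel_measurable Q"
    and cvx: "\<And>z. z \<in> Z \<Longrightarrow> ereal_convex_on \<Theta> (\<lambda>\<theta>. loss \<theta> z)"
    and e: "0 \<le> \<epsilon>"
    and cg: "cost_growth c Z P d p" and lg: "loss_growth \<Theta> Z loss d p"
    and ne: "ot_ball c Z P \<epsilon> \<noteq> {}"
begin

abbreviation (input) "\<B> \<equiv> ot_ball c Z P \<epsilon>"

lemma p_pos: "0 < p"
  using lg \<Theta>(2) by (fastforce simp: loss_growth_def)

lemma ball_facts: "Q \<in> \<B> \<Longrightarrow> Q \<in> prob_dists Z" "Q \<in> \<B> \<Longrightarrow> prob_space Q" "Q \<in> \<B> \<Longrightarrow> space Q = Z"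
    "Q \<in> \<B> \<Longrightarrow> Q' \<in> \<B> \<Longrightarrow> sets Q' = sets Q"
  using space_prob_dists[of Q Z] by (auto simp: ot_ball_def prob_dists_def)

lemma loss_finite:
  assumes "\<theta> \<in> \<Theta>" "z \<in> Z"
  shows "loss \<theta> z \<noteq> \<infinity>"
proof -
  have "\<exists>a. loss \<theta> z \<le> ereal a" using lg assms unfolding loss_growth_def by blast
  then show ?thesis by auto
qed

text \<open>Splitting at radius \<open>s\<close> bounds the part of the loss above
  \<open>g * (1 + s powr r)\<close> by a vanishing multiple of the \<open>p\<close>-th moment, which
  is bounded over the ball. This replaces an assumption of uniform integrability of positive
  parts.\<close>

lemma pos_part_bounds:
  assumes \<theta>: "\<theta> \<in> \<Theta>"
  obtains \<tau> :: "real \<Rightarrow> ennreal" and N :: real where "(\<tau> \<longlongrightarrow> 0) at_top" "0 \<le> N"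
    "\<And>Q K. Q \<in> \<B> \<Longrightarrow> (\<integral>\<^sup>+z. e2ennreal (loss \<theta> z - ereal K) \<partial>Q) \<le> \<tau> K"
    "\<And>Q. Q \<in> \<B> \<Longrightarrow> pos_int Q (loss \<theta>) \<le> ennreal N"
proof -
  obtain g z0 r where g: "0 < g" "z0 \<in> Z" "0 < r" "r < real p"
    "\<And>z. z \<in> Z \<Longrightarrow> loss \<theta> z \<le> ereal (g * (1 + d z z0 powr r))"
    using lg \<theta> unfolding loss_growth_def by blast
  interpret Metric_space Z d using cg by (simp add: cost_growth_def)
  obtain M where M: "0 \<le> M" "\<And>Q. Q \<in> \<B> \<Longrightarrow> (\<integral>\<^sup>+z. ennreal (d z z0 ^ p) \<partial>Q) \<le> ennreal M"
    using growth_moment_ball[OF Z c P e cg p_pos g(2)] by blast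
  have dm: "(\<lambda>z. ennreal (d z z0 ^ p)) \<in> borel_measurable Q" if "Q \<in> \<B>" for Q
    using growth_measurable[OF Z c P e cg p_pos g(2)]
    by (intro measurable_prob_dists[OF ball_facts(1)[OF that]] measurable_compose[OF _ measurable_ennreal]
        borel_measurable_power)
  have bound: "loss \<theta> z \<le> ereal (g * (1 + s powr r) + 2 * g * s powr (r - real p) * d z z0 ^ p)"
    if "z \<in> Z" "1 \<le> s" for z s
    by (rule order_trans[OF g(5)[OF that(1)]]) (use growth_split[OF g(1,3,4) _ that(2), of "d z z0"] in simp)
  have int: "(\<integral>\<^sup>+z. e2ennreal (loss \<theta> z - ereal (g * (1 + s powr r))) \<partial>Q) \<le> ennreal (2 * g * s powr (r - real p) * M)"
    if Q: "Q \<in> \<B>" and s: "1 \<le> s" for Q s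
  proof -
    have "(\<integral>\<^sup>+z. e2ennreal (loss \<theta> z - ereal (g * (1 + s powr r))) \<partial>Q)
        \<le> (\<integral>\<^sup>+z. ennreal (2 * g * s powr (r - real p)) * ennreal (d z z0 ^ p) \<partial>Q)"
    proof (rule nn_integral_mono)
      fix z assume "z \<in> space Q"
      then have "loss \<theta> z - ereal (g * (1 + s powr r)) \<le> ereal (2 * g * s powr (r - real p) * d z z0 ^ p)"
        using bound[of z s] s ball_facts(3)[OF Q] by (cases "loss \<theta> z") auto
      from e2ennreal_mono[OF this] show "e2ennreal (loss \<theta> z - ereal (g * (1 + s powr r)))
          \<le> ennreal (2 * g * s powr (r - real p)) * ennreal (d z z0 ^ p)"
        using g(1) by (simp add: ennreal_mult[symmetric])
    qed
    also have "\<dots> = ennreal (2 * g * s powr (r - real p)) * (\<integral>\<^sup>+z. ennreal (d z z0 ^ p) \<partial>Q)"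
      by (rule nn_integral_cmult[OF dm[OF Q]])
    also have "\<dots> \<le> ennreal (2 * g * s powr (r - real p)) * ennreal M"
      by (intro mult_left_mono M Q) auto
    finally show ?thesis using g(1) M(1) by (simp add: ennreal_mult[symmetric])
  qed
  \<comment> \<open>Solving \<open>K = g * (1 + s powr r)\<close> gives
    \<open>s = (K / g - 1) powr (1 / r)\<close>. The requirement \<open>1 \<le> s\<close> means
    \<open>2 * g \<le> K\<close>; for smaller \<open>K\<close> the trivial bound
    \<open>\<infinity>\<close> does not affect the limit.\<close>
  define \<tau> where "\<tau> K = (if K < 2 * g then \<infinity> else ennreal (2 * g * (K / g - 1) powr ((r - real p) / r) * M))" for K
  \<comment> \<open>The bound \<open>2 * g + 2 * g * M\<close> on the positive part is the splitting
    with \<open>s = 1\<close>.\<close>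
  show ?thesis
  proof (rule that[of \<tau> "2 * g + 2 * g * M"])
    have "((\<lambda>K. 2 * g * (K / g - 1) powr ((r - real p) / r) * M) \<longlongrightarrow> 2 * g * 0 * M) at_top"
    proof (intro tendsto_intros tendsto_neg_powr)
      show "(r - real p) / r < 0" using g(3,4) by (simp add: divide_neg_pos)
      show "filterlim (\<lambda>K. K / g - 1) at_top at_top"
        using g(1) by real_asymp
    qed
    then have "((\<lambda>K. ennreal (2 * g * (K / g - 1) powr ((r - real p) / r) * M)) \<longlongrightarrow> 0) at_top"
      by (auto dest: tendsto_ennrealI)
    moreover have "\<forall>\<^sub>F K in at_top. ennreal (2 * g * (K / g - 1) powr ((r - real p) / r) * M) = \<tau> K"
      using eventually_ge_at_top[of "2 * g"] by eventually_elim (simp add: \<tau>_def)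
    ultimately show "(\<tau> \<longlongrightarrow> 0) at_top" by (rule Lim_transform_eventually)
    show "0 \<le> 2 * g + 2 * g * M" using g(1) M(1) by simp
    show "(\<integral>\<^sup>+z. e2ennreal (loss \<theta> z - ereal K) \<partial>Q) \<le> \<tau> K" if Q: "Q \<in> \<B>" for Q K
    proof (cases "K < 2 * g")
      case False
      define s where "s = (K / g - 1) powr (1 / r)"
      have K: "1 \<le> K / g - 1" using False g(1) by (simp add: field_simps)
      then have s: "1 \<le> s" unfolding s_def using g(3) by (intro ge_one_powr_ge_zero) auto
      have s_powr: "s powr (r - real p) = (K / g - 1) powr ((r - real p) / r)"
        unfolding s_def by (simp add: powr_powr)
      have "s powr r = K / g - 1" unfolding s_def using K g(3) by (simp add: powr_powr)
      then have "K = g * (1 + s powr r)" using g(1) by simp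
      then show ?thesis using int[OF Q s] False by (simp add: \<tau>_def s_powr)
    qed (simp add: \<tau>_def)
    show "pos_int Q (loss \<theta>) \<le> ennreal (2 * g + 2 * g * M)" if Q: "Q \<in> \<B>" for Q
    proof -
      interpret prob_space Q by (rule ball_facts(2)[OF Q])
      have "pos_int Q (loss \<theta>) \<le> (\<integral>\<^sup>+z. ennreal (2 * g) + ennreal (2 * g) * ennreal (d z z0 ^ p) \<partial>Q)"
      proof (rule nn_integral_mono)
        fix z assume "z \<in> space Q"
        then have "loss \<theta> z \<le> ereal (2 * g + 2 * g * d z z0 ^ p)"
          using bound[of z 1] ball_facts(3)[OF Q] by (simp add: mult.commute)
        from e2ennreal_mono[OF this] show "e2ennreal (loss \<theta> z) \<le> ennreal (2 * g) + ennreal (2 * g) * ennreal (d z z0 ^ p)"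
          using g(1) by (simp add: ennreal_mult[symmetric] ennreal_plus[symmetric] del: ennreal_plus)
      qed
      also have "\<dots> = ennreal (2 * g) + ennreal (2 * g) * (\<integral>\<^sup>+z. ennreal (d z z0 ^ p) \<partial>Q)"
        using dm[OF Q] by (simp add: nn_integral_add nn_integral_cmult emeasure_space_1)
      also have "\<dots> \<le> ennreal (2 * g) + ennreal (2 * g) * ennreal M"
        by (intro add_left_mono mult_left_mono M Q) auto
      also have "\<dots> = ennreal (2 * g + 2 * g * M)"
        using g(1) M(1) by (simp add: ennreal_mult)
      finally show ?thesis .
    qed
  qed
qed

text \<open>The growth condition controls the loss from above only. Expectations of
  \<open>- loss\<close> therefore stay away from \<open>-\<infinity>\<close> and have closed
  sublevel sets, as the finite alternative and the compactness argument require.\<close>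

abbreviation (input) "gain \<theta> Q \<equiv> expect Q (\<lambda>z. - loss \<theta> z)"

lemma pos_int_finite:
  assumes "\<theta> \<in> \<Theta>" "Q \<in> \<B>"
  shows "pos_int Q (loss \<theta>) < \<infinity>"
proof -
  obtain N :: real where "\<And>Q. Q \<in> \<B> \<Longrightarrow> pos_int Q (loss \<theta>) \<le> ennreal N"
    using pos_part_bounds[OF assms(1)] by metis
  from this[OF assms(2)] show ?thesis by (rule le_less_trans) simp
qed

lemma gain_eq: "\<theta> \<in> \<Theta> \<Longrightarrow> Q \<in> \<B> \<Longrightarrow> gain \<theta> Q = - expect Q (loss \<theta>)"
  by (rule expect_uminus[OF pos_int_finite])

lemma neg_int_gain: "\<theta> \<in> \<Theta> \<Longrightarrow> Q \<in> \<B> \<Longrightarrow> neg_int Q (\<lambda>z. - loss \<theta> z) < \<infinity>"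
  using pos_int_finite by simp

lemma gain_meas: "\<theta> \<in> \<Theta> \<Longrightarrow> Q \<in> \<B> \<Longrightarrow> (\<lambda>z. - loss \<theta> z) \<in> borel_measurable Q"
  using meas[of \<theta> Q] ball_facts(1) by auto

text \<open>The gain raised by \<open>K\<close> and cut at 0 is an admissible test function for
  \<open>wconv\<close>, and its tail below \<open>- K\<close> is the tail of the loss above
  \<open>K\<close>, uniformly small over the ball.\<close>

lemma gain_sublevel_closed:
  assumes \<theta>: "\<theta> \<in> \<Theta>" and Qs: "\<And>n. Qs n \<in> \<B>" "\<And>n. gain \<theta> (Qs n) \<le> ereal a"
    and Q: "Q \<in> \<B>" "wconv Z Qs Q"
  shows "gain \<theta> Q \<le> ereal a"
proof -
  obtain \<tau> :: "real \<Rightarrow> ennreal" where \<tau>: "(\<tau> \<longlongrightarrow> 0) at_top"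
    "\<And>Q K. Q \<in> \<B> \<Longrightarrow> (\<integral>\<^sup>+z. e2ennreal (loss \<theta> z - ereal K) \<partial>Q) \<le> \<tau> K"
    using pos_part_bounds[OF \<theta>] by metis
  show ?thesis
  proof (rule expect_le_limit[where g = "\<lambda>_ z. - loss \<theta> z" and N = Qs and \<tau> = \<tau>])
    show "prob_space Q" "prob_space (Qs n)" for n using Q Qs ball_facts(2) by auto
    show "(\<lambda>z. - loss \<theta> z) \<in> borel_measurable Q" "(\<lambda>z. - loss \<theta> z) \<in> borel_measurable (Qs n)" for n
      using gain_meas[OF \<theta>] Q Qs by auto
    show "neg_int Q (\<lambda>z. - loss \<theta> z) < \<infinity>" "neg_int (Qs n) (\<lambda>z. - loss \<theta> z) < \<infinity>" for n
      using neg_int_gain[OF \<theta>] Q Qs by blast+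
    show "gain \<theta> (Qs n) \<le> ereal a" for n by (rule Qs)
    show "(\<integral>\<^sup>+z. e2ennreal (- loss \<theta> z + ereal K) \<partial>Q) \<le> liminf (\<lambda>n. \<integral>\<^sup>+z. e2ennreal (- loss \<theta> z + ereal K) \<partial>Qs n)" for K
      using Q(2) lsc_on_shift[OF usc_on_uminus[OF usc[OF \<theta>]], of K] unfolding wconv_def by blast
    show "(\<integral>\<^sup>+z. e2ennreal (- (- loss \<theta> z) - ereal K) \<partial>Qs n) \<le> \<tau> K" for K n
      using \<tau>(2)[OF Qs(1)] by simp
  qed (rule \<tau>)
qed

text \<open>The growth condition makes the losses at \<open>\<theta>\<close> and
  \<open>\<theta>'\<close> finite, so that the convexity inequality can be negated without meeting
  \<open>\<infinity> - \<infinity>\<close>.\<close>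

lemma gain_concave:
  assumes \<theta>: "\<theta> \<in> \<Theta>" "\<theta>' \<in> \<Theta>" and u: "0 < u" "u < 1" and Q: "Q \<in> \<B>"
  shows "ereal u * gain \<theta> Q + ereal (1 - u) * gain \<theta>' Q \<le> gain (u *\<^sub>R \<theta> + (1 - u) *\<^sub>R \<theta>') Q"
proof -
  have "ereal u * gain \<theta> Q + ereal (1 - u) * gain \<theta>' Q =
      expect Q (\<lambda>z. ereal u * - loss \<theta> z + ereal (1 - u) * - loss \<theta>' z)"
    using u by (intro expect_combination[symmetric] gain_meas neg_int_gain \<theta> Q) auto
  also have "\<dots> \<le> gain (u *\<^sub>R \<theta> + (1 - u) *\<^sub>R \<theta>') Q"
  proof (rule expect_mono)
    fix z assume "z \<in> space Q"
    then have z: "z \<in> Z" using ball_facts(3)[OF Q] by simp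
    obtain x y where xy: "loss \<theta> z = ereal x" "loss \<theta>' z = ereal y"
      using loss_finite[OF _ z] \<theta> not_MInf by (metis ereal_cases)
    have "loss (u *\<^sub>R \<theta> + (1 - u) *\<^sub>R \<theta>') z \<le> ereal u * loss \<theta> z + ereal (1 - u) * loss \<theta>' z"
      using cvx[OF z] \<theta> u by (auto simp: ereal_convex_on_def)
    then have "loss (u *\<^sub>R \<theta> + (1 - u) *\<^sub>R \<theta>') z \<le> ereal (u * x + (1 - u) * y)"
      by (simp add: xy)
    then show "ereal u * - loss \<theta> z + ereal (1 - u) * - loss \<theta>' z \<le> - loss (u *\<^sub>R \<theta> + (1 - u) *\<^sub>R \<theta>') z"
      by (cases "loss (u *\<^sub>R \<theta> + (1 - u) *\<^sub>R \<theta>') z") (auto simp: xy)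
  qed
  finally show ?thesis .
qed

text \<open>Were there no such \<open>Q\<close>, every distribution would have gain above
  \<open>- \<alpha>\<close> for some decision in \<open>S\<close>. The alternative then yields a
  single decision with gain above \<open>- \<beta>\<close> throughout, hence with worst-case risk at
  most \<open>\<beta>\<close>, which is below the optimal value.\<close>

lemma dual_finite:
  assumes "finite S" "S \<subseteq> \<Theta>" and \<alpha>: "ereal \<alpha> < (INF \<theta>\<in>\<Theta>. SUP Q\<in>\<B>. expect Q (loss \<theta>))"
  shows "\<exists>Q\<in>\<B>. \<forall>\<theta>\<in>S. gain \<theta> Q \<le> ereal (- \<alpha>)"
proof (rule ccontr)
  assume neg: "\<not> ?thesis"
  obtain \<beta> :: real where \<beta>: "\<alpha> < \<beta>" "ereal \<beta> < (INF \<theta>\<in>\<Theta>. SUP Q\<in>\<B>. expect Q (loss \<theta>))"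
    using ereal_dense2[OF \<alpha>] by auto
  have "\<exists>\<theta>\<in>\<Theta>. \<forall>Q\<in>\<B>. ereal (- \<beta>) < gain \<theta> Q"
  proof (rule convexlike_finite_alternative[OF assms(1,2) \<Theta>(2), where \<beta> = "- \<alpha>" and F = gain])
    show "\<exists>\<theta>''\<in>\<Theta>. \<forall>Q\<in>\<B>. ereal t * gain \<theta> Q + ereal (1 - t) * gain \<theta>' Q \<le> gain \<theta>'' Q"
      if "\<theta> \<in> \<Theta>" "\<theta>' \<in> \<Theta>" "0 < t" "t < 1" for \<theta> \<theta>' t
      using that \<Theta>(1) by (intro bexI[of _ "t *\<^sub>R \<theta> + (1 - t) *\<^sub>R \<theta>'"] ballI gain_concave) (auto intro!: convexD)
    show "\<exists>w\<in>\<B>. \<forall>\<theta>\<in>\<Theta>. gain \<theta> w \<le> ereal u * gain \<theta> Q + ereal (1 - u) * gain \<theta> Q'"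
      if Q: "Q \<in> \<B>" "Q' \<in> \<B>" and u: "0 < u" "u < 1" for Q Q' u
    proof (intro bexI[of _ "mix u Q Q'"] ballI)
      show "mix u Q Q' \<in> \<B>" by (rule ot_ball_mix[OF Z c P e Q u])
      fix \<theta> assume \<theta>: "\<theta> \<in> \<Theta>"
      have "gain \<theta> (mix u Q Q') = ereal u * gain \<theta> Q + ereal (1 - u) * gain \<theta> Q'"
        by (rule expect_mix[OF ball_facts(2)[OF Q(1)] ball_facts(2)[OF Q(2)] ball_facts(4)[OF Q] u
            gain_meas[OF \<theta> Q(1)] neg_int_gain[OF \<theta> Q(1)] neg_int_gain[OF \<theta> Q(2)]])
      then show "gain \<theta> (mix u Q Q') \<le> ereal u * gain \<theta> Q + ereal (1 - u) * gain \<theta> Q'" by simp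
    qed
    show "gain \<theta> Q \<noteq> -\<infinity>" if "Q \<in> \<B>" "\<theta> \<in> \<Theta>" for Q \<theta>
      by (rule expect_not_MInfty[OF neg_int_gain[OF that(2,1)]])
    show "\<exists>m::real. \<forall>Q\<in>\<B>. ereal m \<le> gain \<theta> Q" if \<theta>: "\<theta> \<in> \<Theta>" for \<theta>
    proof -
      obtain N :: real where N: "0 \<le> N" "\<And>Q. Q \<in> \<B> \<Longrightarrow> pos_int Q (loss \<theta>) \<le> ennreal N"
        using pos_part_bounds[OF \<theta>] by metis
      have "ereal (- N) \<le> gain \<theta> Q" if "Q \<in> \<B>" for Q
      proof -
        have "enn2ereal (pos_int Q (loss \<theta>)) \<le> enn2ereal (ennreal N)"
          using N(2)[OF that] by (simp only: less_eq_ennreal.rep_eq)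
        then have "enn2ereal 0 - enn2ereal (ennreal N) \<le> gain \<theta> Q"
          unfolding expect_def by (intro ereal_minus_mono) (simp_all add: zero_ennreal.rep_eq)
        then show ?thesis using N(1) by (simp add: zero_ennreal.rep_eq)
      qed
      then show ?thesis by blast
    qed
    show "\<exists>\<theta>\<in>S. ereal (- \<alpha>) < gain \<theta> Q" if "Q \<in> \<B>" for Q
      using neg that by (auto simp: not_le)
  qed (use \<beta> in auto)
  then obtain \<theta> where \<theta>: "\<theta> \<in> \<Theta>" "\<And>Q. Q \<in> \<B> \<Longrightarrow> ereal (- \<beta>) < gain \<theta> Q" by blast
  have "(SUP Q\<in>\<B>. expect Q (loss \<theta>)) \<le> ereal \<beta>"
  proof (rule SUP_least)
    fix Q assume Q: "Q \<in> \<B>"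
    have "- ereal \<beta> < - expect Q (loss \<theta>)" using \<theta>(2)[OF Q] gain_eq[OF \<theta>(1) Q] by simp
    then show "expect Q (loss \<theta>) \<le> ereal \<beta>" by (simp only: ereal_minus_less_minus less_imp_le)
  qed
  moreover have "ereal \<beta> < (SUP Q\<in>\<B>. expect Q (loss \<theta>))" using less_INF_D[OF \<beta>(2) \<theta>(1)] .
  ultimately show False by simp
qed

text \<open>The constraints are indexed by a decision and a real level below the value
  \<open>v\<close>. A distribution meeting all of them has risk at least \<open>v\<close> for every
  decision, which proves equality and attainment at once.\<close>

lemma dual_minimax_attained:
  "(INF \<theta>\<in>\<Theta>. SUP Q\<in>\<B>. expect Q (loss \<theta>)) = (SUP Q\<in>\<B>. INF \<theta>\<in>\<Theta>. expect Q (loss \<theta>)) \<and>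
   (\<exists>Q\<^sub>0\<in>\<B>. (INF \<theta>\<in>\<Theta>. expect Q\<^sub>0 (loss \<theta>)) = (SUP Q\<in>\<B>. INF \<theta>\<in>\<Theta>. expect Q (loss \<theta>)))"
proof -
  define v where "v = (INF \<theta>\<in>\<Theta>. SUP Q\<in>\<B>. expect Q (loss \<theta>))"
  have "\<exists>Q\<in>\<B>. \<forall>i\<in>\<Theta> \<times> {\<alpha>. ereal \<alpha> < v}. Q \<in> {Q \<in> \<B>. gain (fst i) Q \<le> ereal (- snd i)}"
  proof (rule seq_compact_measures_fip[OF Z])
    show "\<B> \<subseteq> prob_dists Z" using ball_facts(1) by auto
    show "\<exists>(r :: nat \<Rightarrow> nat) Q. strict_mono r \<and> Q \<in> \<B> \<and> wconv Z (Qs \<circ> r) Q" if "\<And>n. Qs n \<in> \<B>" for Qs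
      by (rule ot_ball_seq_compact[OF Z c P e cg p_pos that])
    show "Q \<in> {Q \<in> \<B>. gain (fst i) Q \<le> ereal (- snd i)}"
      if "i \<in> \<Theta> \<times> {\<alpha>. ereal \<alpha> < v}" "\<And>n. Qs n \<in> {Q \<in> \<B>. gain (fst i) Q \<le> ereal (- snd i)}"
        "Q \<in> \<B>" "wconv Z Qs Q" for i Qs Q
    proof -
      have "fst i \<in> \<Theta>" "\<And>n. Qs n \<in> \<B>" "\<And>n. gain (fst i) (Qs n) \<le> ereal (- snd i)"
      proof -
        show "fst i \<in> \<Theta>" using that(1) unfolding mem_Times_iff by blast
        show "Qs n \<in> \<B>" "gain (fst i) (Qs n) \<le> ereal (- snd i)" for n using that(2)[of n] by blast+
      qed
      from gain_sublevel_closed[OF this that(3,4)] show ?thesis using that(3) by simp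
    qed
    show "\<exists>Q\<in>\<B>. \<forall>i\<in>F. Q \<in> {Q \<in> \<B>. gain (fst i) Q \<le> ereal (- snd i)}"
      if F: "finite F" "F \<subseteq> \<Theta> \<times> {\<alpha>. ereal \<alpha> < v}" for F
    proof (cases "F = {}")
      \<comment> \<open>The case \<open>v = -\<infinity>\<close>, in which there are no constraints
        at all, is covered here.\<close>
      case True
      then show ?thesis using ne by auto
    next
      case False
      \<comment> \<open>The strictest of the finitely many levels is imposed on all the decisions
        involved.\<close>
      define \<alpha> where "\<alpha> = Max (snd ` F)"
      have "\<alpha> \<in> snd ` F" unfolding \<alpha>_def using F(1) False by (intro Max_in) auto
      then have "ereal \<alpha> < v" using F(2) by auto
      then obtain Q where Q: "Q \<in> \<B>" "\<forall>\<theta>\<in>fst ` F. gain \<theta> Q \<le> ereal (- \<alpha>)"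
        using dual_finite[of "fst ` F" \<alpha>] F unfolding v_def by fastforce
      have "gain (fst i) Q \<le> ereal (- snd i)" if i: "i \<in> F" for i
      proof -
        have "snd i \<le> \<alpha>" unfolding \<alpha>_def using F(1) i by (intro Max_ge) auto
        then have "ereal (- \<alpha>) \<le> ereal (- snd i)" by simp
        with Q(2) i show ?thesis by (auto intro: order_trans)
      qed
      then show ?thesis using Q(1) by (intro bexI[OF _ Q(1)] ballI CollectI conjI)
    qed
  qed auto
  then obtain Q where Q: "Q \<in> \<B>" "\<And>\<theta> \<alpha>. \<theta> \<in> \<Theta> \<Longrightarrow> ereal \<alpha> < v \<Longrightarrow> gain \<theta> Q \<le> ereal (- \<alpha>)"
    by fastforce
  have "v \<le> expect Q (loss \<theta>)" if \<theta>: "\<theta> \<in> \<Theta>" for \<theta>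
  proof (rule ccontr)
    assume "\<not> v \<le> expect Q (loss \<theta>)"
    then obtain \<alpha> :: real where \<alpha>: "expect Q (loss \<theta>) < ereal \<alpha>" "ereal \<alpha> < v"
      using ereal_dense2[of "expect Q (loss \<theta>)" v] by (auto simp: not_le)
    have "- expect Q (loss \<theta>) \<le> - ereal \<alpha>" using Q(2)[OF \<theta> \<alpha>(2)] gain_eq[OF \<theta> Q(1)] by simp
    then have "ereal \<alpha> \<le> expect Q (loss \<theta>)" by (simp only: ereal_minus_le_minus)
    then show False using \<alpha>(1) by simp
  qed
  then have "v \<le> (INF \<theta>\<in>\<Theta>. expect Q (loss \<theta>))" by (rule INF_greatest)
  moreover have "(INF \<theta>\<in>\<Theta>. expect Q (loss \<theta>)) \<le> (SUP Q\<in>\<B>. INF \<theta>\<in>\<Theta>. expect Q (loss \<theta>))"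
    using Q(1) by (rule SUP_upper)
  moreover have "(SUP Q\<in>\<B>. INF \<theta>\<in>\<Theta>. expect Q (loss \<theta>)) \<le> v"
    unfolding v_def by (rule SUP_INF_le_INF_SUP)
  ultimately show ?thesis using Q(1) unfolding v_def by (intro conjI bexI[of _ Q]) order+
qed

end

section \<open>The minimax theorem\<close>

theorem theorem1:
  fixes \<Theta> :: "(real ^ 'm) set"
    and Z :: "(real ^ 'd) set"
    and loss :: "real ^ 'm \<Rightarrow> real ^ 'd \<Rightarrow> ereal"
    and c :: "real ^ 'd \<Rightarrow> real ^ 'd \<Rightarrow> ennreal"
    and P :: "(real ^ 'd) measure"
    and \<epsilon> :: real
  assumes "closed \<Theta>" and "\<Theta> \<noteq> {}"
    and "closed Z" and "Z \<noteq> {}"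
    and "\<And>\<theta> z. loss \<theta> z \<noteq> -\<infinity>"
    and "P \<in> prob_dists Z"
    and "\<And>z z'. z \<in> Z \<Longrightarrow> z' \<in> Z \<Longrightarrow> c z z' = 0 \<longleftrightarrow> z = z'"
    and "lsc_on (Z \<times> Z) (\<lambda>(z, z'). c z z')"
    and "\<And>\<theta>. \<theta> \<in> \<Theta> \<Longrightarrow> usc_on Z (loss \<theta>)"
    and "\<And>\<theta>. \<theta> \<in> \<Theta> \<Longrightarrow> ereal_integrable P (loss \<theta>)"
    and "convex \<Theta>"
    and "\<And>z. z \<in> Z \<Longrightarrow> ereal_convex_on \<Theta> (\<lambda>\<theta>. loss \<theta> z)"
    and "0 \<le> \<epsilon>"
  shows
    "(lsc_in_decision \<Theta> Z loss \<and>
      loc_unif_integrable_neg_part (ot_ball c Z P \<epsilon>) \<Theta> loss \<and>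
      inf_compact_for_some (ot_ball c Z P \<epsilon>) \<Theta> loss \<and>
      finite_worst_case (ot_ball c Z P \<epsilon>) \<Theta> loss
      \<longrightarrow>
        (INF \<theta>\<in>\<Theta>. SUP Q\<in>ot_ball c Z P \<epsilon>. expect Q (loss \<theta>)) =
          (SUP Q\<in>ot_ball c Z P \<epsilon>. INF \<theta>\<in>\<Theta>. expect Q (loss \<theta>)) \<and>
        (\<exists>\<theta>\<^sub>0\<in>\<Theta>. (SUP Q\<in>ot_ball c Z P \<epsilon>. expect Q (loss \<theta>\<^sub>0)) =
          (INF \<theta>\<in>\<Theta>. SUP Q\<in>ot_ball c Z P \<epsilon>. expect Q (loss \<theta>))))
     \<and>
     (finite_optimal_risk (ot_ball c Z P \<epsilon>) \<Theta> loss \<and>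
      (\<exists>d p. cost_growth c Z P d p \<and> loss_growth \<Theta> Z loss d p)
      \<longrightarrow>
        (INF \<theta>\<in>\<Theta>. SUP Q\<in>ot_ball c Z P \<epsilon>. expect Q (loss \<theta>)) =
          (SUP Q\<in>ot_ball c Z P \<epsilon>. INF \<theta>\<in>\<Theta>. expect Q (loss \<theta>)) \<and>
        (\<exists>Q\<^sub>0\<in>ot_ball c Z P \<epsilon>. (INF \<theta>\<in>\<Theta>. expect Q\<^sub>0 (loss \<theta>)) =
          (SUP Q\<in>ot_ball c Z P \<epsilon>. INF \<theta>\<in>\<Theta>. expect Q (loss \<theta>))))
     \<and>
     (lsc_in_decision \<Theta> Z loss \<and>
      loc_unif_integrable_neg_part (ot_ball c Z P \<epsilon>) \<Theta> loss \<and>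
      inf_compact_for_some (ot_ball c Z P \<epsilon>) \<Theta> loss \<and>
      finite_worst_case (ot_ball c Z P \<epsilon>) \<Theta> loss \<and>
      finite_optimal_risk (ot_ball c Z P \<epsilon>) \<Theta> loss \<and>
      (\<exists>d p. cost_growth c Z P d p \<and> loss_growth \<Theta> Z loss d p)
      \<longrightarrow>
        (INF \<theta>\<in>\<Theta>. SUP Q\<in>ot_ball c Z P \<epsilon>. expect Q (loss \<theta>)) =
          (SUP Q\<in>ot_ball c Z P \<epsilon>. INF \<theta>\<in>\<Theta>. expect Q (loss \<theta>)) \<and>
        (\<exists>\<theta>\<^sub>0\<in>\<Theta>. (SUP Q\<in>ot_ball c Z P \<epsilon>. expect Q (loss \<theta>\<^sub>0)) =
          (INF \<theta>\<in>\<Theta>. SUP Q\<in>ot_ball c Z P \<epsilon>. expect Q (loss \<theta>))) \<and>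
        (\<exists>Q\<^sub>0\<in>ot_ball c Z P \<epsilon>. (INF \<theta>\<in>\<Theta>. expect Q\<^sub>0 (loss \<theta>)) =
          (SUP Q\<in>ot_ball c Z P \<epsilon>. INF \<theta>\<in>\<Theta>. expect Q (loss \<theta>))))"
proof -
  note no_MInf = assms(5) and c_lsc = assms(8) and usc = assms(9) and assms_int = assms(10)
    and convex_loss = assms(12)
  note assms = \<open>closed \<Theta>\<close> \<open>\<Theta> \<noteq> {}\<close> \<open>closed Z\<close> \<open>P \<in> prob_dists Z\<close> \<open>convex \<Theta>\<close> \<open>0 \<le> \<epsilon>\<close>
  let ?B = "ot_ball c Z P \<epsilon>"
  have meas: "loss \<theta> \<in> borel_measurable Q" if "\<theta> \<in> \<Theta>" "Q \<in> prob_dists Z" for \<theta> Q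
  proof -
    \<comment> \<open>All distributions on \<open>Z\<close> share one sigma-algebra, so
      measurability passes from \<open>P\<close> to every \<open>Q\<close>.\<close>
    have "sets Q = sets P" using that(2) assms(4) by (simp add: prob_dists_def)
    moreover have "loss \<theta> \<in> borel_measurable P" using assms_int[OF that(1)] by (simp add: ereal_integrable_def)
    ultimately show ?thesis by (simp cong: measurable_cong_sets)
  qed
  have B: "?B \<subseteq> prob_dists Z" by (auto simp: ot_ball_def)
  have mix: "mix u Q Q' \<in> ?B" if "Q \<in> ?B" "Q' \<in> ?B" "0 < u" "u < 1" for Q Q' u
    by (rule ot_ball_mix[OF assms(3) c_lsc assms(4,6) that])
  have measB: "loss \<theta> \<in> borel_measurable Q" if "\<theta> \<in> \<Theta>" "Q \<in> ?B" for \<theta> Q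
    using meas that B by auto
  note primal = primal_minimax[OF assms(1,5) B mix measB convex_loss]
    primal_attained[OF assms(1,5) B mix measB convex_loss]
  have dual: "(INF \<theta>\<in>\<Theta>. SUP Q\<in>?B. expect Q (loss \<theta>)) = (SUP Q\<in>?B. INF \<theta>\<in>\<Theta>. expect Q (loss \<theta>)) \<and>
      (\<exists>Q\<^sub>0\<in>?B. (INF \<theta>\<in>\<Theta>. expect Q\<^sub>0 (loss \<theta>)) = (SUP Q\<in>?B. INF \<theta>\<in>\<Theta>. expect Q (loss \<theta>)))"
    if "finite_optimal_risk ?B \<Theta> loss" "cost_growth c Z P d p" "loss_growth \<Theta> Z loss d p" for d p
  proof -
    have "?B \<noteq> {}" using that(1) by (auto simp: finite_optimal_risk_def)
    from dual_minimax_attained[OF assms(5,2,3) no_MInf assms(4) c_lsc usc meas convex_loss assms(6) that(2,3) this]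
    show ?thesis .
  qed
  \<comment> \<open>Part (iii) takes the minimizer from (i) and the maximizer from (ii).\<close>
  show ?thesis using primal dual by blast
qed

end
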